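(* There exist constants $c,C,p_0>0$ such that for all $p\in(0,p_0)$, $$ \exp\frac{-2\lambda+c\sqrt p}{p}\;\le\;\mathbb{P}_p\big(\text{indefinite growth}\big)\;\le\;\exp\frac{-2\lambda+C\sqrt p\,(\log p^{-1})^3}{p}, $$ where $\lambda=\pi^2/18$.
   Context: Local bootstrap percolation on $\mathbb{Z}^2$ with parameter $p\in(0,1)$. At each time $t=0,1,2,\dots$ each site of $\mathbb{Z}^2$ is in one of three states: empty ($\circ$), occupied ($\bullet$) or active ($\star$). The initial configuration $\sigma\in\{\circ,\bullet,\star\}^{\mathbb{Z}^2}$ is random with law $\mathbb{P}_p$: the states of different sites are independent; the origin $0=(0,0)$ is $\star$ with probability $p$ and $\circ$ with probability $1-p$; every site $x\neq 0$ is $\bullet$ with probability $p$ and $\circ$ with probability $1-p$. The configuration at time $t+1$ is obtained from that at time $t$ by the deterministic rules: (1) each $\bullet$ becomes $\star$ if it has at least one $\star$ within $\ell^1$-distance $2$; (2) each $\circ$ becomes $\star$ if it has at least two $\star$'s within $\ell^1$-distance $1$; (3) all other states remain unchanged. "Indefinite growth" is the event that every site of $\mathbb{Z}^2$ eventually becomes active. *)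

theory Defs
  imports "HOL-Probability.Probability"
begin

datatype lbp_state = Empty | Occupied | Active

type_synonym site = "int \<times> int"
type_synonym config = "site \<Rightarrow> lbp_state"

definition l1dist :: "site \<Rightarrow> site \<Rightarrow> int" where
  "l1dist x y = \<bar>fst x - fst y\<bar> + \<bar>snd x - snd y\<bar>"

definition lbp_step :: "config \<Rightarrow> config" where
  "lbp_step \<sigma> x =
     (case \<sigma> x of
        Occupied \<Rightarrow> (if \<exists>y. l1dist x y \<le> 2 \<and> \<sigma> y = Active then Active else Occupied)
      | Empty \<Rightarrow> (if card {y. l1dist x y \<le> 1 \<and> \<sigma> y = Active} \<ge> 2 then Active else Empty)
      | Active \<Rightarrow> Active)"

definition lbp_init :: "(site \<Rightarrow> bool) \<Rightarrow> config" where
  "lbp_init \<omega> x = (if \<omega> x then (if x = (0,0) then Active else Occupied) else Empty)"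

definition lbp_config :: "(site \<Rightarrow> bool) \<Rightarrow> nat \<Rightarrow> config" where
  "lbp_config \<omega> t = (lbp_step ^^ t) (lbp_init \<omega>)"

definition indefinite_growth :: "(site \<Rightarrow> bool) \<Rightarrow> bool" where
  "indefinite_growth \<omega> \<longleftrightarrow> (\<forall>x. \<exists>t. lbp_config \<omega> t x = Active)"

definition lbp_measure :: "real \<Rightarrow> (site \<Rightarrow> bool) measure" where
  "lbp_measure p = PiM UNIV (\<lambda>_. measure_pmf (bernoulli_pmf p))"

definition growth_prob :: "real \<Rightarrow> real" where
  "growth_prob p = measure (lbp_measure p) {\<omega> \<in> space (lbp_measure p). indefinite_growth \<omega>}"

end

theory Submission
  imports Defs "HOL-Real_Asymp.Real_Asymp"
begin

text \<open>
  The active set is always a rectangle, and it grows by a column (row) next to a side of length \<open>n\<close>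
  unless the two neighbouring columns (rows) are empty there. With \<open>z = - ln (1 - p)\<close>, extending the
  rectangle costs a factor \<open>exp (- cost (n z))\<close> per line, so that growth along the diagonal has
  probability about \<open>exp (- 2 \<Sum>\<^sub>j cost (j z))\<close>, and the integral of \<open>cost\<close> over \<open>(0, \<infinity>)\<close> is \<open>\<pi>\<^sup>2 / 18\<close>. This
  integral is elementary because \<open>cost\<close> is an involution with a primitive in terms of the dilogarithm.

  For the lower bound, a quadrant is filled along the diagonal. Of the order of \<open>1 / p\<close> steps have a
  third way to succeed, by a detour whose relative weight is of order \<open>\<surd>p\<close>; this yields the gain
  \<open>exp (c / \<surd>p)\<close>. For the upper bound, the chain of rectangles is observed only when a side has grown
  by a factor \<open>1 + \<surd>p\<close>. Convexity of \<open>cost\<close> shows that no path of side lengths is cheaper than the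
  diagonal, and the corner sites, which serve rows and columns at once, contribute the error term.
\<close>


section \<open>The entropy function and its integral\<close>

text \<open>Both scales \<open>sqrt p\<close> come from a balance. For the detour, take K rows:
  their widths differ, and charging them all at one width costs a factor exp (O (K^2 p)), while the
  K sites of the second column that must contain an occupied one do so with probability of order K
  p. The largest K with bounded loss is of order 1 / sqrt p, which leaves a weight of order sqrt p.
  For the upper bound, put l = ln (1 / p) and let the observed sides grow by a ratio 1 + \<delta>.
  There are about l / \<delta> steps; each pays order l for the union bound and for boundary
  factors, and order l^2 \<delta>^2 / p for the corners. The total l^2 / \<delta> + l^3 \<delta> / p
  is balanced in p by \<delta> = sqrt p, and l^3 / sqrt p remains. The obstacle is that corner sites
  couple horizontal and vertical growth. Their configuration is therefore fixed beforehand, and each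
  occupied corner site is treated as a free hit for one column and one row. Rectangles so short that
  a ratio 1 + \<delta> is less than one line are not charged at all.\<close>

text \<open>\<open>bet u\<close> is the nonnegative root of \<open>b\<^sup>2 = u * b + u * (1 - u)\<close>. If lines are hit independently with
  probability \<open>u\<close>, then the probability that no two consecutive ones among \<open>l\<close> lines are missed is
  of order \<open>bet u ^ l\<close>.\<close>

definition bet :: "real \<Rightarrow> real" where
  "bet u = (u + sqrt (u * (4 - 3 * u))) / 2"

definition cost :: "real \<Rightarrow> real" where
  "cost x = - ln (bet (1 - exp (- x)))"

lemma bet_square:
  assumes "0 \<le> u" "u \<le> 1"
  shows "bet u ^ 2 = u * bet u + u * (1 - u)"
proof -
  have "sqrt (u * (4 - 3 * u)) ^ 2 = u * (4 - 3 * u)"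
    using assms by simp
  then show ?thesis
    unfolding bet_def by (simp add: power2_eq_square field_simps)
qed

lemma bet_ge:
  assumes "0 \<le> u" "u \<le> 1"
  shows "u \<le> bet u"
proof -
  have "u * u \<le> u * (4 - 3 * u)"
    using assms by (intro mult_left_mono) auto
  then have "u \<le> sqrt (u * (4 - 3 * u))"
    by (simp add: real_le_rsqrt power2_eq_square)
  then show ?thesis unfolding bet_def by simp
qed

lemma bet_le_1:
  assumes "0 \<le> u" "u \<le> 1"
  shows "bet u \<le> 1"
proof -
  have "(2 - u) ^ 2 - u * (4 - 3 * u) = 4 * (1 - u) ^ 2"
    by (simp add: power2_eq_square algebra_simps)
  then have "u * (4 - 3 * u) \<le> (2 - u) ^ 2"
    by (smt (verit) zero_le_power2)
  then have "sqrt (u * (4 - 3 * u)) \<le> 2 - u"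
    using assms by (simp add: real_le_lsqrt)
  then show ?thesis unfolding bet_def by simp
qed

lemma bet_pos: "0 < u \<Longrightarrow> u \<le> 1 \<Longrightarrow> 0 < bet u"
  using bet_ge[of u] by simp

lemma bet_square_ge:
  assumes "0 \<le> u" "u \<le> 1"
  shows "u \<le> bet u ^ 2"
proof -
  have "u * u \<le> u * bet u"
    using bet_ge[OF assms] assms by (intro mult_left_mono) auto
  then show ?thesis
    using bet_square[OF assms] by (simp add: algebra_simps)
qed

lemma le_betI:
  assumes "0 < u" "u \<le> 1" "0 \<le> y" "y ^ 2 \<le> u * y + u * (1 - u)"
  shows "y \<le> bet u"
proof (rule ccontr)
  assume "\<not> y \<le> bet u"
  then have y: "bet u < y" by simp
  have b: "u \<le> bet u" "bet u ^ 2 = u * bet u + u * (1 - u)"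
    using assms bet_ge bet_square by auto
  have "0 < (y - bet u) * (y + bet u - u)"
    using y b assms by (intro mult_pos_pos) auto
  also have "\<dots> = (y ^ 2 - u * y) - (bet u ^ 2 - u * bet u)"
    by (simp add: power2_eq_square algebra_simps)
  also have "\<dots> \<le> 0" using b assms by simp
  finally show False by simp
qed

lemma bet_unique:
  assumes "0 < u" "u \<le> 1" "0 < y" "y ^ 2 = u * y + u * (1 - u)"
  shows "y = bet u"
proof -
  have b: "u \<le> bet u" "bet u ^ 2 = u * bet u + u * (1 - u)"
    using assms bet_ge bet_square by auto
  have "(y - bet u) * (y + bet u - u) = (y ^ 2 - u * y) - (bet u ^ 2 - u * bet u)"
    by (simp add: power2_eq_square algebra_simps)
  also have "\<dots> = 0" using b assms by simp
  finally have "y = bet u \<or> y = u - bet u" by auto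
  then show ?thesis
  proof
    assume "y = u - bet u"
    then show ?thesis using b assms by auto
  qed
qed

text \<open>At y = \<open>bet u\<close>, replacing \<open>u\<close> by \<open>v\<close> raises the
  right-hand side of the quadratic by (v - u) (y + 1 - u - v), which is nonnegative since y \<ge> u
  and v \<le> 1. So y does not exceed the root for \<open>v\<close>.\<close>

lemma bet_mono:
  assumes "0 \<le> u" "u \<le> v" "v \<le> 1"
  shows "bet u \<le> bet v"
proof (cases "u = 0")
  case True
  then show ?thesis using bet_ge[of v] assms by (simp add: bet_def)
next
  case False
  let ?y = "bet u"
  have b: "u \<le> ?y" "?y ^ 2 = u * ?y + u * (1 - u)"
    using assms bet_ge bet_square by auto
  have "0 \<le> (v - u) * (?y + 1 - u - v)"
    using assms b by (intro mult_nonneg_nonneg) auto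
  then have "?y ^ 2 \<le> v * ?y + v * (1 - v)"
    using b by (simp add: algebra_simps)
  then show ?thesis using False assms b by (intro le_betI) auto
qed

lemma bet_less_1:
  assumes "0 \<le> u" "u < 1"
  shows "bet u < 1"
proof (rule ccontr)
  assume "\<not> bet u < 1"
  then have "bet u = 1" using bet_le_1[of u] assms by simp
  then have "(1 - u) ^ 2 = 0"
    using bet_square[of u] assms by (simp add: power2_eq_square algebra_simps)
  then show False using assms by simp
qed

lemma exp_neg_cost:
  assumes "x > 0"
  shows "exp (- cost x) = bet (1 - exp (- x))"
  using assms bet_pos[of "1 - exp (- x)"] unfolding cost_def by simp

lemma cost_pos: "x > 0 \<Longrightarrow> cost x > 0"
  using bet_less_1[of "1 - exp (-x)"] bet_pos[of "1 - exp (-x)"] unfolding cost_def by simp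

lemma cost_antimono:
  assumes "0 < x" "x \<le> y"
  shows "cost y \<le> cost x"
  using bet_mono[of "1 - exp (-x)" "1 - exp (-y)"] bet_pos[of "1 - exp (-x)"]  bet_pos[of "1 - exp (-y)"] assms
  unfolding cost_def by simp

text \<open>With q = \<open>exp (- x)\<close> and f = \<open>exp (- cost x)\<close>, the quadratic
  equation of \<open>bet\<close> reads f^2 + f q + q^2 = f + q. It is symmetric, so q is in turn the
  root belonging to 1 - f.\<close>

lemma cost_cost:
  assumes "x > 0"
  shows "cost (cost x) = x"
proof -
  define f where "f = bet (1 - exp (- x))"
  have f: "f = exp (- cost x)" using exp_neg_cost[OF assms] f_def by simp
  have "0 < f" "f < 1" using cost_pos[OF assms] f by auto
  moreover have "f ^ 2 = (1 - exp (- x)) * f + (1 - exp (- x)) * exp (- x)"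
    using bet_square[of "1 - exp (- x)"] assms f_def by simp
  ultimately have "exp (- x) = bet (1 - f)"
    by (intro bet_unique) (auto simp: power2_eq_square algebra_simps)
  then have "exp (- cost (cost x)) = exp (- x)"
    using exp_neg_cost[OF cost_pos[OF assms]] f by simp
  then show ?thesis by simp
qed

text \<open>With \<open>s = exp (cost x - x)\<close>, both \<open>exp (- cost x)\<close> and \<open>exp (- x)\<close> are rational functions of \<open>s\<close>, and
  exchanging \<open>x\<close> with \<open>cost x\<close> replaces \<open>s\<close> by \<open>1 / s\<close>.\<close>

definition slope :: "real \<Rightarrow> real" where
  "slope x = exp (cost x - x)"

lemma slope_pos: "slope x > 0" by (simp add: slope_def)

text \<open>Substituting q = s f into f^2 + f q + q^2 = f + q and dividing by f leaves the linear
  equation f (1 + s + s^2) = 1 + s.\<close>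

lemma slope_param:
  assumes "x > 0"
  shows "exp (- cost x) = (1 + slope x) / (1 + slope x + slope x ^ 2)"
    and "exp (- x) = slope x * (1 + slope x) / (1 + slope x + slope x ^ 2)"
proof -
  define f where "f = exp (- cost x)"
  define s where "s = slope x"
  have sp: "s > 0" by (simp add: s_def slope_def)
  have fp: "f > 0" by (simp add: f_def)
  have q: "exp (- x) = s * f"
    by (simp add: s_def f_def slope_def flip: exp_add)
  have b: "bet (1 - exp (- x)) = f" using exp_neg_cost[OF assms] by (simp add: f_def)
  have "f ^ 2 = (1 - exp (- x)) * f + (1 - exp (- x)) * exp (- x)"
    using bet_square[of "1 - exp (- x)"] assms unfolding b by simp
  then have "f ^ 2 = (1 - s * f) * f + (1 - s * f) * (s * f)"
    unfolding q .
  then have "f * (f * (1 + s + s ^ 2)) = f * (1 + s)"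
    by (simp add: power2_eq_square algebra_simps)
  then have "f * (1 + s + s ^ 2) = 1 + s" using fp by simp
  then have f: "f = (1 + s) / (1 + s + s ^ 2)"
    using sp by (simp add: eq_divide_eq add_pos_pos) (smt (verit) zero_le_power2)
  then show "exp (- cost x) = (1 + slope x) / (1 + slope x + slope x ^ 2)"
    by (simp add: f_def s_def)
  show "exp (- x) = slope x * (1 + slope x) / (1 + slope x + slope x ^ 2)"
    using q f by (simp add: s_def)
qed

text \<open>Implicit differentiation of the symmetric relation gives the derivative of
  \<open>cost\<close>. In terms of \<open>slope\<close> it is rational, so that its monotonicity is
  a polynomial inequality.\<close>

definition dcost :: "real \<Rightarrow> real" where
  "dcost s = - (s ^ 2 * (2 + s) / (1 + 2 * s))"

lemma cost_deriv:
  assumes "x > 0"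
  shows "(cost has_real_derivative dcost (slope x)) (at x)"
proof -
  define q u where "q = exp (- x)" and "u = 1 - q"
  define s where "s = slope x"
  define f where "f = bet u"
  define E where "E = 1 + s + s ^ 2"
  have sp: "s > 0" by (simp add: s_def slope_def)
  have E: "E > 0" using sp by (simp add: E_def add_pos_pos)
  have q: "0 < q" "q < 1" using assms by (auto simp: q_def)
  have up: "0 < u" "u < 1" using q by (auto simp: u_def)
  have "f = (1 + s) / E"
    using slope_param(1)[OF assms] exp_neg_cost[OF assms]
    by (simp add: f_def u_def q_def E_def s_def)
  moreover have "q = s * (1 + s) / E"
    using slope_param(2)[OF assms] by (simp add: q_def E_def s_def)
  ultimately have fs: "f * E = 1 + s" "q * E = s * (1 + s)"
    using E by auto
  have fpos: "f > 0" using bet_pos[of u] up f_def by simp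
  have sq: "sqrt (u * (4 - 3 * u)) = 2 * f - u"
    by (simp add: f_def bet_def add_divide_distrib)
  have spos: "u * (4 - 3 * u) > 0" using up by simp
  have D: "(2 * f - u) * E = 1 + 2 * s"
    using fs by (simp add: u_def E_def algebra_simps power2_eq_square)
  have Dp: "2 * f - u > 0" using sq spos by (metis real_sqrt_gt_zero)
  have N: "(f + 2 * q - 1) * E = s * (2 + s)"
    using fs by (simp add: E_def algebra_simps power2_eq_square)
  have 1: "((\<lambda>x. 1 - exp (- x)) has_real_derivative q) (at x)"
    by (auto intro!: derivative_eq_intros simp: q_def)
  have 2: "(bet has_real_derivative ((1 + (4 - 6 * u) / (2 * (2 * f - u))) / 2)) (at u)"
  proof -
    have "((\<lambda>u. u * (4 - 3 * u)) has_real_derivative (4 - 6 * u)) (at u)"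
      by (auto intro!: derivative_eq_intros)
    then have "((\<lambda>u. sqrt (u * (4 - 3 * u))) has_real_derivative
        inverse (sqrt (u * (4 - 3 * u))) / 2 * (4 - 6 * u)) (at u)"
      by (rule DERIV_chain2[where f = sqrt and g = "\<lambda>u. u * (4 - 3 * u)", OF DERIV_real_sqrt[OF spos]])
    from DERIV_cdivide[OF DERIV_add[OF DERIV_ident this], of 2]
    have "(bet has_real_derivative (1 + inverse (sqrt (u * (4 - 3 * u))) / 2 * (4 - 6 * u)) / 2) (at u)"
      unfolding bet_def[abs_def] .
    moreover have "inverse w / 2 * (4 - 6 * u) = (4 - 6 * u) / (2 * w)" for w :: real
      by (cases "w = 0") (simp_all add: field_simps)
    ultimately show ?thesis unfolding sq by (simp only:)
  qed
  have two: "(bet has_real_derivative (f + 2 * q - 1) / (2 * f - u)) (at u)"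
  proof -
    have "(1 + (4 - 6 * u) / (2 * (2 * f - u))) / 2 = (f + 2 * q - 1) / (2 * f - u)"
      using Dp by (simp add: field_simps u_def)
    then show ?thesis using 2 by (simp only:)
  qed
  have 3: "((\<lambda>x. bet (1 - exp (- x))) has_real_derivative (f + 2 * q - 1) / (2 * f - u) * q) (at x)"
  proof -
    have "(bet has_real_derivative (f + 2 * q - 1) / (2 * f - u)) (at (1 - exp (- x)))"
      using two unfolding u_def[unfolded q_def, symmetric] .
    from DERIV_chain2[where f = bet and g = "\<lambda>x. 1 - exp (- x)", OF this 1] show ?thesis .
  qed
  have 4: "(cost has_real_derivative - (((f + 2 * q - 1) / (2 * f - u) * q) / f)) (at x)"
  proof -
    have fx: "bet (1 - exp (- x)) = f" by (simp add: f_def u_def q_def)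
    have "((\<lambda>x. ln (bet (1 - exp (- x)))) has_real_derivative
        1 / f * ((f + 2 * q - 1) / (2 * f - u) * q)) (at x)"
      by (rule DERIV_chain2[where f = ln and g = "\<lambda>x. bet (1 - exp (- x))", OF _ 3])
        (unfold fx, rule DERIV_ln_divide[OF fpos])
    from DERIV_minus[OF this] show ?thesis
      unfolding cost_def[abs_def] by (simp only: times_divide_eq_left mult_1_left)
  qed
  have "(f + 2 * q - 1) / (2 * f - u) * q / f = ((f + 2 * q - 1) * E * (q * E)) / (((2 * f - u) * E) * (f * E))"
    using E by simp
  also have "\<dots> = (s * (2 + s) * (s * (1 + s))) / ((1 + 2 * s) * (1 + s))"
    unfolding N D fs by simp
  also have "\<dots> = s ^ 2 * (2 + s) / (1 + 2 * s)"
    using sp by (simp add: divide_simps power2_eq_square)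
  finally show ?thesis using 4 by (simp add: dcost_def s_def)
qed

lemma dcost_antimono:
  assumes "0 < s" "s \<le> t"
  shows "dcost t \<le> dcost s"
proof -
  have "0 \<le> (t - s) * (2 * (t + s) + (t^2 + t * s + s^2) + 4 * s * t + 2 * s * t * (t + s))"
    using assms by (intro mult_nonneg_nonneg add_nonneg_nonneg) auto
  also have "\<dots> = t ^ 2 * (2 + t) * (1 + 2 * s) - s ^ 2 * (2 + s) * (1 + 2 * t)"
    by (simp add: algebra_simps power2_eq_square)
  finally have "s ^ 2 * (2 + s) / (1 + 2 * s) \<le> t ^ 2 * (2 + t) / (1 + 2 * t)"
    using assms by (simp add: divide_simps)
  then show ?thesis by (simp add: dcost_def)
qed

lemma slope_antimono:
  assumes "0 < x" "x \<le> y"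
  shows "slope y \<le> slope x"
  using cost_antimono[OF assms] assms by (simp add: slope_def)

text \<open>The derivative \<open>dcost (slope x)\<close> increases because \<open>dcost\<close> and
  \<open>slope\<close> both decrease.\<close>

lemma cost_convex: "convex_on {0<..} cost"
proof (rule convex_on_realI)
  show "connected {0::real<..}" by simp
  fix x y :: real
  assume "x \<in> {0<..}" "y \<in> {0<..}" "x \<le> y"
  then show "dcost (slope x) \<le> dcost (slope y)"
    by (intro dcost_antimono slope_pos slope_antimono) auto
qed (auto intro: cost_deriv)

text \<open>The fixed point of \<open>cost\<close>: f = q turns the symmetric relation into 3 q^2 =
  2 q, hence q = 2 / 3. From here on \<open>slope\<close> is at most 1.\<close>

definition x0 :: real where "x0 = ln (3 / 2)"

lemma x0_pos: "x0 > 0" by (simp add: x0_def)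

lemma exp_x0: "exp (- x0) = 2 / 3"
  by (simp add: x0_def exp_minus)

lemma x0_le_1: "x0 \<le> 1 / 2"
proof -
  have "x0 \<le> 3 / 2 - 1" unfolding x0_def by (rule ln_le_minus_one) simp
  then show ?thesis by simp
qed

lemma x0_ge: "1 / 3 \<le> x0"
  using ln_le_minus_one[of "2/3::real"] ln_div[of 1 "3/2::real"] unfolding x0_def by simp

lemma cost_x0: "cost x0 = x0"
proof -
  have "(2/3::real) = bet (1 - exp (- x0))"
    by (rule bet_unique) (auto simp: exp_x0 power2_eq_square)
  then have "cost x0 = - ln (2 / 3)" by (simp add: cost_def)
  then show ?thesis by (simp add: x0_def ln_div)
qed

lemma cost_le_x0: "x0 \<le> x \<Longrightarrow> cost x \<le> x0"
  using cost_antimono[of x0 x] x0_pos cost_x0 by simp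

lemma cost_ge_x0: "0 < x \<Longrightarrow> x \<le> x0 \<Longrightarrow> x0 \<le> cost x"
  using cost_antimono[of x x0] x0_pos cost_x0 by simp

lemma slope_le: "x0 \<le> x \<Longrightarrow> slope x \<le> (3 / 2) * exp (- x)"
proof -
  assume "x0 \<le> x"
  then have "exp (cost x) \<le> exp x0" using cost_le_x0 by simp
  also have "exp x0 = 3 / 2" by (simp add: x0_def)
  finally show ?thesis by (simp add: slope_def exp_diff exp_minus field_simps)
qed

lemma slope_le_1: "x0 \<le> x \<Longrightarrow> slope x \<le> 1"
  using cost_le_x0[of x] by (simp add: slope_def)

lemma slope_less_1: "x0 < x \<Longrightarrow> slope x < 1"
  using cost_le_x0[of x] by (simp add: slope_def)

lemma dcost_ge: assumes "0 < s" "s \<le> 1" shows "- 1 \<le> dcost s"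
  using dcost_antimono[OF assms] by (simp add: dcost_def)

lemma cost_Lipschitz:
  assumes "x0 \<le> x" "x \<le> y"
  shows "cost x - cost y \<le> y - x"
proof (cases "x = y")
  case False
  then have "x < y" using assms by simp
  then obtain w where w: "x < w" "w < y" "cost y - cost x = (y - x) * dcost (slope w)"
    using MVT2[of x y cost "\<lambda>x. dcost (slope x)"] cost_deriv assms x0_pos by force
  have "- 1 \<le> dcost (slope w)"
    using w assms by (intro dcost_ge slope_pos slope_le_1) auto
  then have "(y - x) * (- 1) \<le> (y - x) * dcost (slope w)"
    using \<open>x < y\<close> by (intro mult_left_mono) auto
  then show ?thesis using w by simp
qed simp

lemma cost_ge_slope:
  assumes "x0 \<le> x"
  shows "slope x ^ 2 / 3 \<le> cost x"
proof -
  have xp: "x > 0" using assms x0_pos by simp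
  define s where "s = slope x"
  have s: "0 < s" "s \<le> 1" using slope_pos slope_le_1[OF assms] by (auto simp: s_def)
  have d: "1 \<le> 1 + s + s^2" "1 + s + s^2 \<le> 3"
    using s by (auto simp: power_le_one add_nonneg_nonneg)
      (smt (verit) power_le_one)
  have "exp (- cost x) = 1 - s ^ 2 / (1 + s + s ^ 2)"
    using slope_param(1)[OF xp] d by (simp add: s_def field_simps)
  also have "\<dots> \<le> 1 - s ^ 2 / 3"
    using divide_left_mono[of "1 + s + s ^ 2" 3 "s ^ 2"] d s by simp
  finally have "exp (- cost x) \<le> 1 - s ^ 2 / 3" .
  moreover have "1 - cost x \<le> exp (- cost x)" using exp_ge_add_one_self[of "- cost x"] by simp
  ultimately show ?thesis by (simp add: s_def)
qed

section \<open>The dilogarithm and the area under the entropy function\<close>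

lemma pi_square_le_12: "pi ^ 2 \<le> 12"
proof -
  have "pi ^ 2 \<le> (3.2::real) ^ 2" using pi_approx by (intro power_mono) auto
  then show ?thesis by (simp add: power2_eq_square)
qed

text \<open>The term for \<open>n = 0\<close> vanishes because \<open>1 / 0 = 0\<close>.\<close>

definition dilog :: "real \<Rightarrow> real" where
  "dilog x = (\<Sum>n. 1 / real n ^ 2 * x ^ n)"

lemma inverse_squares_summable: "summable (\<lambda>n. 1 / real n ^ 2)"
  using inverse_power_summable[of 2, where 'a=real] by (simp add: divide_inverse)

lemma inverse_squares_suminf: "(\<Sum>n. 1 / real n ^ 2) = pi ^ 2 / 6"
proof -
  have "(\<lambda>n. 1 / real (Suc n) ^ 2) sums (pi\<^sup>2 / 6)"
    using inverse_squares_sums by (simp add: add.commute)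
  then have "(\<lambda>n. 1 / real n ^ 2) sums (pi\<^sup>2 / 6 + 1 / real 0 ^ 2)"
    by (subst (asm) sums_Suc_iff)
  then show ?thesis by (simp add: sums_iff)
qed

lemma dilog_summable:
  assumes "0 \<le> x" "x \<le> 1"
  shows "summable (\<lambda>n. 1 / real n ^ 2 * x ^ n)"
proof (rule summable_comparison_test'[OF inverse_squares_summable])
  fix n
  show "norm (1 / real n ^ 2 * x ^ n) \<le> 1 / real n ^ 2"
    using assms by (simp add: power_le_one mult_left_le divide_right_mono)
qed

lemma dilog_1: "dilog 1 = pi ^ 2 / 6"
  by (simp add: dilog_def inverse_squares_suminf)

lemma dilog_nonneg:
  assumes "0 \<le> x" "x \<le> 1"
  shows "0 \<le> dilog x"
  unfolding dilog_def using assms by (intro suminf_nonneg dilog_summable) auto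

lemma dilog_le:
  assumes "0 \<le> x" "x \<le> 1"
  shows "dilog x \<le> x * (pi ^ 2 / 6)"
proof -
  have "dilog x \<le> (\<Sum>n. x * (1 / real n ^ 2))"
    unfolding dilog_def
  proof (rule suminf_le)
    fix n
    show "1 / real n ^ 2 * x ^ n \<le> x * (1 / real n ^ 2)"
    proof (cases n)
      case (Suc m)
      have "x ^ n \<le> x" using assms Suc by (simp add: mult_left_le power_le_one)
      then show ?thesis by (simp add: divide_right_mono)
    qed simp
  next
    show "summable (\<lambda>n. 1 / real n ^ 2 * x ^ n)" by (rule dilog_summable[OF assms])
    show "summable (\<lambda>n. x * (1 / real n ^ 2))"
      by (intro summable_mult inverse_squares_summable)
  qed
  also have "\<dots> = x * (pi ^ 2 / 6)"
    by (subst suminf_mult) (simp_all only: inverse_squares_summable inverse_squares_suminf)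
  finally show ?thesis .
qed

lemma dilog_continuous: "continuous_on {0..1} dilog"
proof -
  have "uniform_limit {0..1} (\<lambda>N x. \<Sum>n<N. 1 / real n ^ 2 * x ^ n) (\<lambda>x. \<Sum>n. 1 / real n ^ 2 * x ^ n) sequentially"
  proof (rule Weierstrass_m_test[OF _ inverse_squares_summable])
    fix n and x :: real
    assume "x \<in> {0..1}"
    then show "norm (1 / real n ^ 2 * x ^ n) \<le> 1 / real n ^ 2"
      by (simp add: power_le_one mult_left_le divide_right_mono)
  qed
  moreover have "\<forall>\<^sub>F N in sequentially. continuous_on {0..1} (\<lambda>x::real. \<Sum>n<N. 1 / real n ^ 2 * x ^ n)"
    by (intro always_eventually allI continuous_intros)
  ultimately show ?thesis unfolding dilog_def[abs_def]
    by (intro uniform_limit_theorem[where F = sequentially]) auto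
qed

lemma dilog_deriv:
  assumes "0 < y" "y < 1"
  shows "(dilog has_real_derivative (- ln (1 - y) / y)) (at y)"
proof -
  have 1: "(dilog has_real_derivative (\<Sum>n. diffs (\<lambda>n. 1 / real n ^ 2) n * y ^ n)) (at y)"
    unfolding dilog_def[abs_def]
    by (rule termdiffs_strong[where K = 1]) (use assms inverse_squares_summable in auto)
  have 2: "diffs (\<lambda>n. 1 / real n ^ 2) n = 1 / real (Suc n)" for n
    by (simp add: diffs_def power2_eq_square)
  have sm: "summable (\<lambda>n. 1 / real (Suc n) * y ^ n)"
  proof (rule summable_comparison_test'[of "\<lambda>n. y ^ n"])
    show "summable (\<lambda>n. y ^ n)" using assms by simp
    show "norm (1 / real (Suc n) * y ^ n) \<le> y ^ n" for n
      using assms by (simp add: divide_simps)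
  qed
  have "ln (1 - y) = (\<Sum>n. (-1) ^ n * (1 / real (n + 1)) * ((1 - y) - 1) ^ Suc n)"
    using assms by (intro ln_series) auto
  also have "(\<lambda>n. (-1) ^ n * (1 / real (n + 1)) * ((1 - y) - 1) ^ Suc n) = (\<lambda>n. - y * (1 / real (Suc n) * y ^ n))"
  proof
    fix n
    have "(-1) ^ n * (- y) ^ n = y ^ n" by (simp flip: power_mult_distrib)
    then have "(-1) ^ n * (- y) ^ Suc n = - y * y ^ n" by (simp add: algebra_simps)
    then show "(-1) ^ n * (1 / real (n + 1)) * ((1 - y) - 1) ^ Suc n = - y * (1 / real (Suc n) * y ^ n)"
      by (simp add: algebra_simps)
  qed
  also have "(\<Sum>n. - y * (1 / real (Suc n) * y ^ n)) = - y * (\<Sum>n. 1 / real (Suc n) * y ^ n)"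
    by (rule suminf_mult[OF sm])
  finally have "(\<Sum>n. 1 / real (Suc n) * y ^ n) = - ln (1 - y) / y"
    using assms by (simp add: field_simps)
  then show ?thesis using 1 2 by simp
qed

text \<open>A closed form for the integral of \<^term>\<open>cost\<close> over \<open>[x, \<infinity>)\<close>, valid for \<open>x \<ge> x0\<close> only: for smaller \<open>x\<close> the
  series defining \<^term>\<open>dilog\<close> diverges.\<close>

definition cost_tail :: "real \<Rightarrow> real" where
  "cost_tail x = dilog (slope x ^ 2) / 2 - dilog (slope x ^ 3) / 3 - cost x ^ 2 / 2"

lemma slope_deriv:
  assumes "x > 0"
  shows "(slope has_real_derivative slope x * (dcost (slope x) - 1)) (at x)"
  unfolding slope_def[abs_def]
  by (rule derivative_eq_intros cost_deriv[OF assms] refl | simp add: slope_def)+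

text \<open>Here exp (- cost x) = (1 - s^2) / (1 - s^3), and the logarithmic derivative of s is d -
  1. The two dilogarithms together contribute (d - 1) * cost x; the square contributes - d * cost x,
  which leaves - cost x.\<close>

lemma cost_tail_deriv:
  assumes "x > x0"
  shows "(cost_tail has_real_derivative - cost x) (at x)"
proof -
  have xp: "x > 0" using assms x0_pos by simp
  define s where "s = slope x"
  define d where "d = dcost (slope x)"
  have s: "0 < s" "s < 1" using slope_pos slope_less_1[OF assms] by (auto simp: s_def)
  have s2: "0 < s^2" "s^2 < 1" "0 < s^3" "s^3 < 1"
    using s by (auto simp: power_less_one_iff)
  have d1: "(slope has_real_derivative s * (d - 1)) (at x)"
    using slope_deriv[OF xp] by (simp add: s_def d_def)
  have p2: "((\<lambda>x. slope x ^ 2) has_real_derivative 2 * s^2 * (d - 1)) (at x)"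
    using DERIV_power[OF d1, of 2] by (simp add: s_def power2_eq_square algebra_simps)
  have p3: "((\<lambda>x. slope x ^ 3) has_real_derivative 3 * s^3 * (d - 1)) (at x)"
    using DERIV_power[OF d1, of 3] by (simp add: s_def power2_eq_square power3_eq_cube algebra_simps)
  have D2: "((\<lambda>x. dilog (slope x ^ 2)) has_real_derivative (- ln (1 - s^2) / s^2) * (2 * s^2 * (d - 1))) (at x)"
    using DERIV_chain2[where f = dilog and g = "\<lambda>x. slope x ^ 2", OF dilog_deriv p2] s2 by (simp add: s_def)
  have D3: "((\<lambda>x. dilog (slope x ^ 3)) has_real_derivative (- ln (1 - s^3) / s^3) * (3 * s^3 * (d - 1))) (at x)"
    using DERIV_chain2[where f = dilog and g = "\<lambda>x. slope x ^ 3", OF dilog_deriv p3] s2 by (simp add: s_def)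
  have C: "((\<lambda>x. cost x ^ 2) has_real_derivative 2 * cost x * d) (at x)"
    using DERIV_power[OF cost_deriv[OF xp], of 2] by (simp add: d_def algebra_simps)
  have "exp (- cost x) = (1 + s) / (1 + s + s^2)" using slope_param(1)[OF xp] by (simp add: s_def)
  also have "\<dots> = (1 - s^2) / (1 - s^3)"
  proof -
    have "1 - s^2 = (1 - s) * (1 + s)" "1 - s^3 = (1 - s) * (1 + s + s^2)"
      by (simp_all add: algebra_simps power2_eq_square power3_eq_cube)
    then show ?thesis using s by simp
  qed
  finally have "- cost x = ln ((1 - s^2) / (1 - s^3))" by (metis ln_exp)
  then have lf: "cost x = ln (1 - s^3) - ln (1 - s^2)" using s2 by (simp add: ln_div)
  have "(cost_tail has_real_derivative ((- ln (1 - s^2) / s^2) * (2 * s^2 * (d - 1))) / 2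
      - ((- ln (1 - s^3) / s^3) * (3 * s^3 * (d - 1))) / 3 - (2 * cost x * d) / 2) (at x)"
    unfolding cost_tail_def[abs_def]
    by (intro DERIV_diff DERIV_cdivide D2 D3 C)
  moreover have "((- ln (1 - s^2) / s^2) * (2 * s^2 * (d - 1))) / 2
      - ((- ln (1 - s^3) / s^3) * (3 * s^3 * (d - 1))) / 3 - (2 * cost x * d) / 2
      = (d - 1) * (ln (1 - s^3) - ln (1 - s^2)) - cost x * d"
  proof -
    have "(- X / s^2) * (2 * s^2 * (d - 1)) / 2 - (- Y / s^3) * (3 * s^3 * (d - 1)) / 3 - 2 * cost x * d / 2
        = (d - 1) * (Y - X) - cost x * d" for X Y
      using s by (simp add: field_simps)
    then show ?thesis .
  qed
  moreover have "(d - 1) * (ln (1 - s^3) - ln (1 - s^2)) - cost x * d = - cost x"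
    unfolding lf[symmetric] by (simp add: algebra_simps)
  ultimately show ?thesis by (simp only:)
qed

lemma cost_continuous: "continuous_on {0<..} cost"
  by (meson DERIV_isCont continuous_at_imp_continuous_on cost_deriv greaterThan_iff)

lemma cost_tail_continuous: "continuous_on {x0..} cost_tail"
proof -
  have c: "continuous_on {x0..} cost"
    by (rule continuous_on_subset[OF cost_continuous]) (use x0_pos in auto)
  have s: "continuous_on {x0..} slope"
    unfolding slope_def[abs_def] by (intro continuous_intros c)
  have r: "slope x \<in> {0..1}" if "x \<in> {x0..}" for x
    using slope_pos[of x] slope_le_1[of x] that by auto
  have "continuous_on {x0..} (\<lambda>x. dilog (slope x ^ k))" for k
    by (rule continuous_on_compose2[OF dilog_continuous])
      (use r in \<open>auto intro!: continuous_intros s power_le_one\<close>)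
  then show ?thesis
    unfolding cost_tail_def[abs_def] by (intro continuous_intros c) auto
qed

lemma cost_tail_le:
  assumes "x0 \<le> x"
  shows "cost_tail x \<le> slope x ^ 2"
proof -
  have s: "0 \<le> slope x" "slope x \<le> 1" using slope_pos[of x] slope_le_1[OF assms] by auto
  have "dilog (slope x ^ 2) \<le> slope x ^ 2 * (pi ^ 2 / 6)"
    using s by (intro dilog_le) (auto intro: power_le_one)
  also have "\<dots> \<le> slope x ^ 2 * 2" using pi_square_le_12 by (intro mult_left_mono) auto
  finally have "dilog (slope x ^ 2) / 2 \<le> slope x ^ 2" by simp
  moreover have "0 \<le> dilog (slope x ^ 3)"
    using s by (intro dilog_nonneg) (auto intro: power_le_one)
  ultimately show ?thesis unfolding cost_tail_def
    by (smt (verit) divide_nonneg_nonneg zero_le_power2)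
qed

lemma cost_tail_diff:
  assumes "x0 \<le> a" "a \<le> b"
  shows "(b - a) * cost b \<le> cost_tail a - cost_tail b"
    and "cost_tail a - cost_tail b \<le> (b - a) * cost a"
proof -
  have "(b - a) * cost b \<le> cost_tail a - cost_tail b \<and> cost_tail a - cost_tail b \<le> (b - a) * cost a"
  proof (cases "a = b")
    case False
    then have "a < b" using assms by simp
    moreover have "continuous_on {a..b} cost_tail"
      by (rule continuous_on_subset[OF cost_tail_continuous]) (use assms in auto)
    moreover have "(cost_tail has_derivative (\<lambda>h. - cost x * h)) (at x)" if "a < x" "x < b" for x
      using cost_tail_deriv[of x] assms that unfolding has_field_derivative_def by linarith
    ultimately obtain w where w: "a < w" "w < b" "cost_tail b - cost_tail a = - cost w * (b - a)"
      using mvt[of a b cost_tail "\<lambda>x h. - cost x * h"] by metis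
    have "cost b \<le> cost w" "cost w \<le> cost a"
      using w assms x0_pos by (auto intro!: cost_antimono)
    then have "(b - a) * cost b \<le> (b - a) * cost w" "(b - a) * cost w \<le> (b - a) * cost a"
      using assms by (auto intro!: mult_left_mono)
    then show ?thesis using w by (simp add: algebra_simps)
  qed simp
  then show "(b - a) * cost b \<le> cost_tail a - cost_tail b"
    and "cost_tail a - cost_tail b \<le> (b - a) * cost a" by auto
qed

lemma cost_le_slope:
  assumes "x0 \<le> x"
  shows "cost x \<le> slope x ^ 2"
proof -
  have xp: "x > 0" using assms x0_pos by simp
  define s where "s = slope x"
  have s: "0 < s" using slope_pos by (auto simp: s_def)
  have "exp (cost x) = inverse (exp (- cost x))" by (simp add: exp_minus)
  also have "\<dots> = 1 + s ^ 2 / (1 + s)"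
    unfolding slope_param(1)[OF xp] using s by (simp add: s_def field_simps)
  also have "\<dots> \<le> 1 + s ^ 2"
    using s divide_left_mono[of 1 "1 + s" "s ^ 2"] by simp
  finally have "exp (cost x) \<le> 1 + s ^ 2" .
  then show ?thesis using exp_ge_add_one_self[of "cost x"] unfolding s_def by linarith
qed

text \<open>\<open>cost_tail\<close> decreases, and its value at any y is at least
  \<open>- (9 / 2) * exp (- 2 * y)\<close>; letting y tend to infinity replaces an improper
  integral.\<close>

lemma cost_tail_nonneg:
  assumes "x0 \<le> x"
  shows "0 \<le> cost_tail x"
proof -
  have lb: "- (9 / 2) * exp (- 2 * y) \<le> cost_tail x" if "x \<le> y" for y
  proof -
    have y: "x0 \<le> y" "0 < y" using assms that x0_pos by auto
    define s where "s = slope y"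
    have s: "0 < s" "s \<le> 1" using slope_pos slope_le_1[OF y(1)] by (auto simp: s_def)
    have "0 \<le> (y - x) * cost y" using that cost_pos[OF y(2)] by simp
    also have "\<dots> \<le> cost_tail x - cost_tail y" by (rule cost_tail_diff[OF assms that])
    finally have 1: "cost_tail y \<le> cost_tail x" by simp
    have 2: "dilog (s ^ 3) \<le> 2 * s ^ 2"
    proof -
      have "dilog (s ^ 3) \<le> s ^ 3 * (pi ^ 2 / 6)"
        using s by (intro dilog_le) (auto intro: power_le_one)
      also have "\<dots> \<le> s ^ 3 * 2" using pi_square_le_12 s by (intro mult_left_mono) auto
      also have "\<dots> \<le> s ^ 2 * 2" using s by (intro mult_right_mono power_decreasing) auto
      finally show ?thesis by simp
    qed
    have 3: "cost y ^ 2 \<le> s ^ 2"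
    proof (rule power_mono)
      have "cost y \<le> s ^ 2" using cost_le_slope[OF y(1)] by (simp add: s_def)
      also have "\<dots> \<le> s" using s by (simp add: power2_eq_square mult_left_le)
      finally show "cost y \<le> s" .
    qed (use cost_pos[OF y(2)] in simp)
    have 4: "0 \<le> dilog (s ^ 2)"
      using s by (intro dilog_nonneg) (auto intro: power_le_one)
    have "s ^ 2 \<le> ((3 / 2) * exp (- y)) ^ 2"
      using slope_le[OF y(1)] s by (intro power_mono) (auto simp: s_def)
    also have "\<dots> = 9 / 4 * exp (- 2 * y)"
      by (simp add: power_mult_distrib power2_eq_square flip: exp_add)
    finally have "- (9 / 2) * exp (- 2 * y) \<le> - 2 * s ^ 2" by simp
    also have "\<dots> \<le> cost_tail y"
      using 2 3 4 zero_le_power2[of s] unfolding cost_tail_def s_def by linarith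
    finally show ?thesis using 1 by simp
  qed
  have "\<forall>\<^sub>F y in at_top. - (9 / 2) * exp (- 2 * y) \<le> cost_tail x"
    by (rule eventually_at_top_linorderI[of x]) (rule lb)
  moreover have "((\<lambda>y::real. - (9 / 2) * exp (- 2 * y)) \<longlongrightarrow> 0) at_top"
    by real_asymp
  ultimately show ?thesis
    by (intro tendsto_upperbound[where F = at_top and f = "\<lambda>y::real. - (9 / 2) * exp (- 2 * y)"]) auto
qed

text \<open>\<open>cost_area x\<close> is the integral of \<^term>\<open>cost\<close> over \<open>(0, x]\<close>; below the fixed point \<^term>\<open>x0\<close> it is obtained from the tail by reflecting in the
  diagonal, since \<^term>\<open>cost\<close> is an involution.\<close>

definition cost_area :: "real \<Rightarrow> real" where
  "cost_area x = (if x \<le> x0 then x * cost x + cost_tail (cost x) else pi ^ 2 / 18 - cost_tail x)"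

text \<open>The two branches fit together, and this is where the constant arises. At the fixed point
  \<open>slope\<close> is 1, so the tail equals (1/2 - 1/3) pi^2 / 6 - x0^2 / 2; two such tails and
  the square of side \<open>x0\<close> have total area pi^2 / 18.\<close>

lemma cost_area_x0: "x0 * cost x0 + cost_tail (cost x0) = pi ^ 2 / 18 - cost_tail x0"
proof -
  have "slope x0 = 1" by (simp add: slope_def cost_x0)
  then have "cost_tail x0 = pi ^ 2 / 36 - x0 ^ 2 / 2"
    by (simp add: cost_tail_def dilog_1 cost_x0)
  then show ?thesis by (simp add: cost_x0 power2_eq_square)
qed

lemma cost_area_ge: "x0 \<le> x \<Longrightarrow> cost_area x = pi ^ 2 / 18 - cost_tail x"
  using cost_area_x0 by (auto simp: cost_area_def)

lemma cost_area_diff: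
  assumes "0 < a" "a \<le> b"
  shows "(b - a) * cost b \<le> cost_area b - cost_area a"
    and "cost_area b - cost_area a \<le> (b - a) * cost a"
proof -
  let ?P = "\<lambda>a b. (b - a) * cost b \<le> cost_area b - cost_area a \<and> cost_area b - cost_area a \<le> (b - a) * cost a"
  \<comment> \<open>Below the fixed point the reflection turns the vertical strip over [a, b] into a
    strip of the tail between \<open>cost b\<close> and \<open>cost a\<close>.\<close>
  have low: "?P a b" if ab: "0 < a" "a \<le> b" "b \<le> x0" for a b
  proof -
    have "x0 \<le> cost b" "cost b \<le> cost a"
      using ab cost_ge_x0 cost_antimono by auto
    from cost_tail_diff[OF this]
    have "(cost a - cost b) * a \<le> cost_tail (cost b) - cost_tail (cost a)"
      "cost_tail (cost b) - cost_tail (cost a) \<le> (cost a - cost b) * b"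
      using ab cost_cost by auto
    moreover have "cost_area b = b * cost b + cost_tail (cost b)" "cost_area a = a * cost a + cost_tail (cost a)"
      using ab by (auto simp: cost_area_def)
    ultimately show ?thesis by (simp add: algebra_simps)
  qed
  have high: "?P a b" if ab: "x0 \<le> a" "a \<le> b" for a b
    using cost_tail_diff[OF ab] cost_area_ge[of a] cost_area_ge[of b] ab by auto
  have "?P a b"
  proof (cases "b \<le> x0 \<or> x0 \<le> a")
    case True
    then show ?thesis using low high assms by blast
  next
    case False
    then have l: "?P a x0" and h: "?P x0 b" using low[of a x0] high[of x0 b] assms by auto
    have "(x0 - a) * cost b \<le> (x0 - a) * cost x0" "(b - x0) * cost x0 \<le> (b - x0) * cost a"
      using False assms cost_antimono[of x0 b] cost_antimono[of a x0] x0_pos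
      by (auto intro!: mult_left_mono)
    then show ?thesis using l h by (simp add: algebra_simps)
  qed
  then show "(b - a) * cost b \<le> cost_area b - cost_area a"
    and "cost_area b - cost_area a \<le> (b - a) * cost a" by auto
qed

lemma cost_area_le: "0 < x \<Longrightarrow> cost_area x \<le> pi ^ 2 / 18"
proof -
  assume x: "0 < x"
  have up: "cost_area y \<le> pi ^ 2 / 18" if "x0 \<le> y" for y
    using cost_area_ge[OF that] cost_tail_nonneg[OF that] by simp
  show ?thesis
  proof (cases "x \<le> x0")
    case True
    then have "0 \<le> (x0 - x) * cost x0" using cost_pos[OF x0_pos] by simp
    also have "\<dots> \<le> cost_area x0 - cost_area x" by (rule cost_area_diff) (use x True in auto)
    finally show ?thesis using up[of x0] by simp
  qed (use up in simp)
qed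

lemma cost_area_ge_rectangle:
  assumes "0 < x"
  shows "x * cost x \<le> cost_area x"
proof (cases "x \<le> x0")
  case True
  then show ?thesis
    using cost_tail_nonneg[OF cost_ge_x0[OF assms True]] by (simp add: cost_area_def)
next
  case False
  have "(x - x0) * cost x \<le> cost_area x - cost_area x0"
    by (rule cost_area_diff) (use False x0_pos in auto)
  moreover have "x0 * cost x \<le> x0 * cost x0"
    using cost_antimono[of x0 x] x0_pos False by (intro mult_left_mono) auto
  moreover have "x0 * cost x0 \<le> cost_area x0"
    using cost_tail_nonneg[OF cost_ge_x0[OF x0_pos]] by (simp add: cost_area_def)
  ultimately show ?thesis by (simp add: algebra_simps)
qed

text \<open>A right-endpoint Riemann sum of a decreasing function lies below the integral. The first
  cell is treated by \<open>cost_area_ge_rectangle\<close>, since \<open>cost\<close> is unbounded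
  near 0.\<close>

lemma cost_sum_le:
  assumes "z > 0"
  shows "z * (\<Sum>j=1..N. cost (real j * z)) \<le> pi ^ 2 / 18"
proof -
  have "N \<noteq> 0 \<longrightarrow> z * (\<Sum>j=1..N. cost (real j * z)) \<le> cost_area (real N * z)"
  proof (induction N)
    case (Suc N)
    show ?case
    proof (cases "N = 0")
      case True
      then show ?thesis using cost_area_ge_rectangle[OF assms] by simp
    next
      case False
      have "(real (Suc N) * z - real N * z) * cost (real (Suc N) * z)
          \<le> cost_area (real (Suc N) * z) - cost_area (real N * z)"
        by (rule cost_area_diff) (use assms False in auto)
      then show ?thesis using Suc False by (simp add: algebra_simps)
    qed
  qed simp
  then show ?thesis
    using cost_area_le[of "real N * z"] assms by (cases "N = 0") auto
qed

text \<open>Read with left endpoints, the same sum dominates the integral from z to (N + 1) z; the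
  two missing ends are the first cell and the tail.\<close>

lemma cost_sum_ge:
  assumes "z > 0" "x0 \<le> real (Suc N) * z"
  shows "pi ^ 2 / 18 - cost_tail (real (Suc N) * z) - cost_area z \<le> z * (\<Sum>j=1..N. cost (real j * z))"
proof -
  have "cost_area (real (Suc n) * z) - cost_area z \<le> z * (\<Sum>j=1..n. cost (real j * z))" for n
  proof (induction n)
    case (Suc n)
    have "cost_area (real (Suc (Suc n)) * z) - cost_area (real (Suc n) * z)
        \<le> (real (Suc (Suc n)) * z - real (Suc n) * z) * cost (real (Suc n) * z)"
      by (rule cost_area_diff) (use assms in auto)
    then show ?case using Suc by (simp add: algebra_simps)
  qed simp
  from this[of N] show ?thesis using cost_area_ge[OF assms(2)] by simp
qed

section \<open>Discrete growth paths and their cost\<close>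

lemma cost_discrete_convex:
  assumes "z > 0" "n \<ge> 1" "k \<ge> 1"
  shows "real k * cost (real (Suc n) * z) \<le> (real k - 1) * cost (real n * z) + cost (real (n + k) * z)"
proof -
  let ?u = "1 - 1 / real k" and ?v = "1 / real k"
  have k: "?u \<ge> 0" "?v \<ge> 0" "?u + ?v = 1" using assms by auto
  have pos: "real n * z \<in> {0<..}" "real (n + k) * z \<in> {0<..}" using assms by auto
  have "cost (?u *\<^sub>R (real n * z) + ?v *\<^sub>R (real (n + k) * z))
      \<le> ?u * cost (real n * z) + ?v * cost (real (n + k) * z)"
    using cost_convex pos k unfolding convex_on_def by blast
  also have "?u *\<^sub>R (real n * z) + ?v *\<^sub>R (real (n + k) * z) = real (Suc n) * z"
    using assms by (simp add: field_simps)
  finally have "real k * cost (real (Suc n) * z) \<le> real k * (?u * cost (real n * z) + ?v * cost (real (n + k) * z))"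
    by (intro mult_left_mono) auto
  also have "\<dots> = (real k - 1) * cost (real n * z) + cost (real (n + k) * z)"
    using assms by (simp add: field_simps)
  finally show ?thesis .
qed

text \<open>The cost of growing an \<open>m\<close> by \<open>n\<close> rectangle along the diagonal first and then in one direction
  only. Convexity of \<^term>\<open>cost\<close> makes this path optimal (\<open>growth_cost_add2\<close>).\<close>

definition growth_cost :: "real \<Rightarrow> nat \<Rightarrow> nat \<Rightarrow> real" where
  "growth_cost z m n = 2 * (\<Sum>j=1..min m n. cost (real j * z))
     + real (max m n - min m n) * cost (real (min m n) * z)"

lemma growth_cost_commute: "growth_cost z m n = growth_cost z n m"
  by (simp add: growth_cost_def min.commute max.commute)

text \<open>Write c(j) for \<open>cost (real j * z)\<close>. If n = m + k with k \<ge> 1,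
  lengthening the shorter side changes the cost by (k + 1) c(m + 1) - k c(m). Discrete convexity
  bounds k c(m + 1) by (k - 1) c(m) + c(n), and c(m + 1) \<le> c(m) does the rest. If n \<le> m,
  equality holds.\<close>

lemma growth_cost_Suc:
  assumes "z > 0" "m \<ge> 1" "n \<ge> 1"
  shows "growth_cost z (Suc m) n \<le> growth_cost z m n + cost (real n * z)"
proof (cases "n \<le> m")
  case True
  then show ?thesis by (simp add: growth_cost_def Suc_diff_le algebra_simps)
next
  case False
  define k where "k = n - m"
  have n: "n = m + k" and k: "k \<ge> 1" using False by (auto simp: k_def)
  have "cost (real (Suc m) * z) \<le> cost (real m * z)"
    using assms by (intro cost_antimono) auto
  moreover have "real k * cost (real (Suc m) * z) \<le> (real k - 1) * cost (real m * z) + cost (real (m + k) * z)"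
    using cost_discrete_convex[of z m k] assms k by simp
  moreover have "growth_cost z (Suc m) n = growth_cost z m n + 2 * cost (real (Suc m) * z)
     + (real k - 1) * cost (real (Suc m) * z) - real k * cost (real m * z)"
    using k by (simp add: growth_cost_def n of_nat_diff min_def max_def algebra_simps)
  ultimately show ?thesis by (simp add: n algebra_simps)
qed

lemma growth_cost_add:
  assumes "z > 0" "m \<ge> 1" "n \<ge> 1"
  shows "growth_cost z (m + s) n \<le> growth_cost z m n + real s * cost (real n * z)"
proof (induction s)
  case (Suc s)
  have "growth_cost z (Suc (m + s)) n \<le> growth_cost z (m + s) n + cost (real n * z)"
    using assms by (intro growth_cost_Suc) auto
  then show ?case using Suc by (simp add: algebra_simps)
qed simp

lemma growth_cost_add2:
  assumes "z > 0" "m \<ge> 1" "n \<ge> 1"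
  shows "growth_cost z (m + s) (n + t) \<le> growth_cost z m n + real s * cost (real n * z) + real t * cost (real m * z)"
proof -
  have "growth_cost z (m + s) (n + t) \<le> growth_cost z (m + s) n + real t * cost (real (m + s) * z)"
    using growth_cost_add[of z n "m + s" t] assms by (simp add: growth_cost_commute)
  also have "real t * cost (real (m + s) * z) \<le> real t * cost (real m * z)"
    using assms by (intro mult_left_mono cost_antimono) auto
  finally show ?thesis using growth_cost_add[OF assms, of s] by simp
qed

lemma growth_cost_le:
  assumes "z > 0" "m \<ge> 1" "n \<ge> 1"
  shows "growth_cost z m n \<le> real (m + n) * cost z"
proof -
  have c: "cost (real j * z) \<le> cost z" if "j \<ge> 1" for j
    using that assms mult_right_mono[of 1 "real j" z] by (intro cost_antimono) auto
  have "(\<Sum>j=1..min m n. cost (real j * z)) \<le> (\<Sum>j=1..min m n. cost z)"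
    by (intro sum_mono c) auto
  then have "growth_cost z m n \<le> 2 * (real (min m n) * cost z) + real (max m n - min m n) * cost z"
    unfolding growth_cost_def using c[of "min m n"] assms by (intro add_mono mult_left_mono) auto
  also have "\<dots> = real (2 * min m n + (max m n - min m n)) * cost z"
    by (simp add: algebra_simps)
  also have "2 * min m n + (max m n - min m n) = m + n" by simp
  finally show ?thesis .
qed

section \<open>Independent sites\<close>

text \<open>Locality is stated on configurations rather than through sub-sigma-algebras; for finite
  \<open>J\<close> it already yields measurability. One implication suffices, because agreement on
  \<open>J\<close> is symmetric.\<close>

definition depends :: "site set \<Rightarrow> (site \<Rightarrow> bool) set \<Rightarrow> bool" where
  "depends J A \<longleftrightarrow> (\<forall>\<omega> \<omega>'. (\<forall>x\<in>J. \<omega> x = \<omega>' x) \<longrightarrow> \<omega> \<in> A \<longrightarrow> \<omega>' \<in> A)"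

definition cylinder :: "site set \<Rightarrow> site set \<Rightarrow> (site \<Rightarrow> bool) set" where
  "cylinder J S = {\<omega>. \<forall>x\<in>J. \<omega> x \<longleftrightarrow> x \<in> S}"

definition hit :: "site set \<Rightarrow> (site \<Rightarrow> bool) set" where
  "hit X = {\<omega>. \<exists>x\<in>X. \<omega> x}"

lemma dependsI:
  assumes "\<And>\<omega> \<omega>'. (\<And>x. x \<in> J \<Longrightarrow> \<omega> x = \<omega>' x) \<Longrightarrow> \<omega> \<in> A \<Longrightarrow> \<omega>' \<in> A"
  shows "depends J A"
  unfolding depends_def
proof (intro allI impI)
  fix \<omega> \<omega>' assume "\<forall>x\<in>J. \<omega> x = \<omega>' x" "\<omega> \<in> A"
  then show "\<omega>' \<in> A" by (intro assms[of \<omega> \<omega>']) auto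
qed

lemma dependsD:
  assumes "depends J A" "\<And>x. x \<in> J \<Longrightarrow> \<omega> x = \<omega>' x"
  shows "\<omega> \<in> A \<longleftrightarrow> \<omega>' \<in> A"
proof -
  have "\<forall>x\<in>J. \<omega> x = \<omega>' x" "\<forall>x\<in>J. \<omega>' x = \<omega> x" using assms(2) by auto
  then show ?thesis using assms(1)[unfolded depends_def] by blast
qed

lemma depends_mono:
  assumes "depends J A" "J \<subseteq> K"
  shows "depends K A"
proof (rule dependsI)
  fix \<omega> \<omega>' assume eq: "\<And>x. x \<in> K \<Longrightarrow> \<omega> x = \<omega>' x" and w: "\<omega> \<in> A"
  have "\<omega> \<in> A \<longleftrightarrow> \<omega>' \<in> A" by (rule dependsD[OF assms(1)]) (use eq assms(2) in auto)
  then show "\<omega>' \<in> A" using w by simp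
qed

lemma depends_Int:
  assumes "depends J A" "depends K B"
  shows "depends (J \<union> K) (A \<inter> B)"
proof (rule dependsI)
  fix \<omega> \<omega>' assume eq: "\<And>x. x \<in> J \<union> K \<Longrightarrow> \<omega> x = \<omega>' x" and w: "\<omega> \<in> A \<inter> B"
  have "\<omega> \<in> A \<longleftrightarrow> \<omega>' \<in> A" "\<omega> \<in> B \<longleftrightarrow> \<omega>' \<in> B"
    using dependsD[OF assms(1)] dependsD[OF assms(2)] eq by blast+
  then show "\<omega>' \<in> A \<inter> B" using w by simp
qed

lemma depends_Union:
  assumes "\<And>i. i \<in> I \<Longrightarrow> depends (J i) (A i)"
  shows "depends (\<Union>i\<in>I. J i) (\<Union>i\<in>I. A i)"
  unfolding depends_def
proof (intro allI impI)
  fix \<omega> \<omega>' assume eq: "\<forall>x\<in>(\<Union>i\<in>I. J i). \<omega> x = \<omega>' x" and "\<omega> \<in> (\<Union>i\<in>I. A i)"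
  then obtain i where i: "i \<in> I" "\<omega> \<in> A i" by blast
  have "\<omega> \<in> A i \<longleftrightarrow> \<omega>' \<in> A i"
    by (rule dependsD[OF assms[OF i(1)]]) (use eq i in blast)
  then show "\<omega>' \<in> (\<Union>i\<in>I. A i)" using i by blast
qed

lemma depends_Compl:
  assumes "depends J A"
  shows "depends J (- A)"
proof (rule dependsI)
  fix \<omega> \<omega>' assume eq: "\<And>x. x \<in> J \<Longrightarrow> \<omega> x = \<omega>' x" and w: "\<omega> \<in> - A"
  have "\<omega> \<in> A \<longleftrightarrow> \<omega>' \<in> A" by (rule dependsD[OF assms]) (rule eq)
  then show "\<omega>' \<in> - A" using w by simp
qed

lemma depends_hit: "depends X (hit X)"
  unfolding depends_def hit_def by auto

lemma depends_cylinder: "depends J (cylinder J S)"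
  unfolding depends_def cylinder_def by auto

lemma depends_UNIV: "depends J UNIV"
  unfolding depends_def by auto

lemma depends_comp:
  assumes "depends J A"
  shows "depends (\<pi> ` J) {\<omega>. \<omega> \<circ> \<pi> \<in> A}"
proof (rule dependsI)
  fix \<omega> \<omega>' assume eq: "\<And>x. x \<in> \<pi> ` J \<Longrightarrow> \<omega> x = \<omega>' x" and w: "\<omega> \<in> {\<omega>. \<omega> \<circ> \<pi> \<in> A}"
  have "\<omega> \<circ> \<pi> \<in> A \<longleftrightarrow> \<omega>' \<circ> \<pi> \<in> A"
    by (rule dependsD[OF assms]) (simp add: eq)
  then show "\<omega>' \<in> {\<omega>. \<omega> \<circ> \<pi> \<in> A}" using w by simp
qed

locale bernoulli_sites =
  fixes p :: real
  assumes p_pos: "0 < p" and p_less_1: "p < 1"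
begin

abbreviation Pr :: "(site \<Rightarrow> bool) set \<Rightarrow> real" where
  "Pr \<equiv> measure (lbp_measure p)"

lemma space_lbp: "space (lbp_measure p) = UNIV"
  by (simp add: lbp_measure_def space_PiM PiE_UNIV_domain)

sublocale prob_space "lbp_measure p"
  unfolding lbp_measure_def by (rule prob_space_PiM) (rule measure_pmf.prob_space_axioms)

lemma cylinder_eq:
  "cylinder J S = {\<omega> \<in> space (lbp_measure p). \<forall>i\<in>J. \<omega> i \<in> {i \<in> S}}"
  by (auto simp: cylinder_def space_lbp)

lemma cylinder_sets: "finite J \<Longrightarrow> cylinder J S \<in> sets (lbp_measure p)"
  unfolding cylinder_eq lbp_measure_def
  by (intro sets.sets_Collect_finite_All) (auto intro!: sets_Collect_single')


lemma prob_cylinder: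
  assumes "finite J" "S \<subseteq> J"
  shows "Pr (cylinder J S) = p ^ card S * (1 - p) ^ card (J - S)"
proof -
  interpret product_prob_space "\<lambda>_::site. measure_pmf (bernoulli_pmf p)" UNIV
    by unfold_locales
  have "emeasure (lbp_measure p) (cylinder J S) = (\<Prod>i\<in>J. emeasure (measure_pmf (bernoulli_pmf p)) {i \<in> S})"
    unfolding cylinder_eq lbp_measure_def
    by (rule emeasure_PiM_Collect) (use assms in auto)
  also have "\<dots> = (\<Prod>i\<in>J. ennreal (if i \<in> S then p else 1 - p))"
    using p_pos p_less_1 by (intro prod.cong) (auto simp: emeasure_pmf_single)
  also have "\<dots> = ennreal (\<Prod>i\<in>J. if i \<in> S then p else 1 - p)"
    using p_pos p_less_1 by (intro prod_ennreal) auto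
  also have "(\<Prod>i\<in>J. if i \<in> S then p else 1 - p) = (\<Prod>i\<in>S. p) * (\<Prod>i\<in>J - S. 1 - p)"
  proof -
    have "J \<inter> S = S" "J \<inter> - S = J - S" using assms by auto
    then show ?thesis using assms by (subst prod.If_cases) auto
  qed
  finally have "emeasure (lbp_measure p) (cylinder J S) = ennreal (p ^ card S * (1 - p) ^ card (J - S))"
    by simp
  then show ?thesis
    using p_pos p_less_1 by (simp add: measure_def)
qed

text \<open>The occupied part of \<open>J\<close> decides membership. For finite \<open>J\<close>
  the event is thus a finite disjoint union of cylinders, and independence and symmetry reduce to
  counting sites.\<close>

lemma depends_decompose:
  assumes "depends J A"
  shows "A = (\<Union>S\<in>{S \<in> Pow J. (\<lambda>x. x \<in> S) \<in> A}. cylinder J S)"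
proof (intro equalityI subsetI)
  fix \<omega> assume "\<omega> \<in> A"
  moreover have "\<omega> \<in> A \<longleftrightarrow> (\<lambda>x. x \<in> {x \<in> J. \<omega> x}) \<in> A"
    by (rule dependsD[OF assms]) auto
  ultimately have "{x \<in> J. \<omega> x} \<in> {S \<in> Pow J. (\<lambda>x. x \<in> S) \<in> A}" by auto
  moreover have "\<omega> \<in> cylinder J {x \<in> J. \<omega> x}" by (auto simp: cylinder_def)
  ultimately show "\<omega> \<in> (\<Union>S\<in>{S \<in> Pow J. (\<lambda>x. x \<in> S) \<in> A}. cylinder J S)" by blast
next
  fix \<omega> assume "\<omega> \<in> (\<Union>S\<in>{S \<in> Pow J. (\<lambda>x. x \<in> S) \<in> A}. cylinder J S)"
  then obtain S where S: "S \<subseteq> J" "(\<lambda>x. x \<in> S) \<in> A" "\<omega> \<in> cylinder J S" by auto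
  have "\<omega> \<in> A \<longleftrightarrow> (\<lambda>x. x \<in> S) \<in> A"
    by (rule dependsD[OF assms]) (use S in \<open>auto simp: cylinder_def\<close>)
  then show "\<omega> \<in> A" using S by simp
qed

lemma depends_sets:
  assumes "finite J" "depends J A"
  shows "A \<in> sets (lbp_measure p)"
  by (subst depends_decompose[OF assms(2)], intro sets.finite_UN) (use assms in \<open>auto intro: cylinder_sets\<close>)

lemma cylinder_disjoint:
  "S \<subseteq> J \<Longrightarrow> S' \<subseteq> J \<Longrightarrow> S \<noteq> S' \<Longrightarrow> cylinder J S \<inter> cylinder J S' = {}"
  unfolding cylinder_def by blast

lemma prob_decompose:
  assumes "finite J" "depends J A" "B \<in> sets (lbp_measure p)"
  shows "Pr (A \<inter> B) = (\<Sum>S\<in>{S \<in> Pow J. (\<lambda>x. x \<in> S) \<in> A}. Pr (cylinder J S \<inter> B))"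
proof -
  have "A \<inter> B = (\<Union>S\<in>{S \<in> Pow J. (\<lambda>x. x \<in> S) \<in> A}. cylinder J S \<inter> B)"
    by (subst depends_decompose[OF assms(2)]) auto
  also have "Pr \<dots> = (\<Sum>S\<in>{S \<in> Pow J. (\<lambda>x. x \<in> S) \<in> A}. Pr (cylinder J S \<inter> B))"
  proof (rule finite_measure_finite_Union)
    show "disjoint_family_on (\<lambda>S. cylinder J S \<inter> B) {S \<in> Pow J. (\<lambda>x. x \<in> S) \<in> A}"
      using cylinder_disjoint unfolding disjoint_family_on_def by blast
  qed (use assms in \<open>auto intro!: cylinder_sets\<close>)
  finally show ?thesis .
qed

lemma prob_eq_sum:
  assumes "finite J" "depends J A"
  shows "Pr A = (\<Sum>S\<in>{S \<in> Pow J. (\<lambda>x. x \<in> S) \<in> A}. p ^ card S * (1 - p) ^ card (J - S))"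
proof -
  have "Pr (A \<inter> UNIV) = (\<Sum>S\<in>{S \<in> Pow J. (\<lambda>x. x \<in> S) \<in> A}. Pr (cylinder J S \<inter> UNIV))"
    by (rule prob_decompose[OF assms]) (use sets.top[of "lbp_measure p"] space_lbp in simp)
  also have "\<dots> = (\<Sum>S\<in>{S \<in> Pow J. (\<lambda>x. x \<in> S) \<in> A}. p ^ card S * (1 - p) ^ card (J - S))"
    using assms by (intro sum.cong) (auto simp: prob_cylinder)
  finally show ?thesis by simp
qed

lemma prob_cylinder_Int:
  assumes "finite J" "finite K" "J \<inter> K = {}" "S \<subseteq> J" "S' \<subseteq> K"
  shows "Pr (cylinder J S \<inter> cylinder K S') = Pr (cylinder J S) * Pr (cylinder K S')"
proof -
  have "cylinder J S \<inter> cylinder K S' = cylinder (J \<union> K) (S \<union> S')"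
    using assms unfolding cylinder_def by blast
  moreover have "card (S \<union> S') = card S + card S'"
    using assms by (intro card_Un_disjoint) (auto intro: finite_subset)
  moreover have "card ((J \<union> K) - (S \<union> S')) = card (J - S) + card (K - S')"
  proof -
    have "(J \<union> K) - (S \<union> S') = (J - S) \<union> (K - S')" using assms by auto
    then show ?thesis using assms by (simp, intro card_Un_disjoint) auto
  qed
  moreover have "Pr (cylinder (J \<union> K) (S \<union> S')) = p ^ card (S \<union> S') * (1 - p) ^ card ((J \<union> K) - (S \<union> S'))"
    by (rule prob_cylinder) (use assms in auto)
  ultimately show ?thesis
    using assms by (simp add: prob_cylinder power_add)
qed

lemma prob_indep:
  assumes "finite J" "finite K" "J \<inter> K = {}" "depends J A" "depends K B"
  shows "Pr (A \<inter> B) = Pr A * Pr B"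
proof -
  let ?I = "{S \<in> Pow J. (\<lambda>x. x \<in> S) \<in> A}" and ?K = "{S \<in> Pow K. (\<lambda>x. x \<in> S) \<in> B}"
  have cyl: "Pr (cylinder J S \<inter> B) = Pr (cylinder J S) * Pr B" if "S \<in> ?I" for S
  proof -
    have "Pr (B \<inter> cylinder J S) = (\<Sum>S'\<in>?K. Pr (cylinder K S' \<inter> cylinder J S))"
      by (rule prob_decompose) (use assms cylinder_sets in auto)
    also have "\<dots> = (\<Sum>S'\<in>?K. Pr (cylinder J S) * Pr (cylinder K S'))"
      using assms that by (intro sum.cong refl) (subst Int_commute, intro prob_cylinder_Int, auto)
    also have "\<dots> = Pr (cylinder J S) * (\<Sum>S'\<in>?K. Pr (cylinder K S'))"
      by (rule sum_distrib_left[symmetric])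
    also have "(\<Sum>S'\<in>?K. Pr (cylinder K S')) = Pr B"
      unfolding prob_eq_sum[OF assms(2,5)] using assms by (intro sum.cong) (auto simp: prob_cylinder)
    finally show ?thesis by (simp add: Int_commute)
  qed
  have "Pr (A \<inter> B) = (\<Sum>S\<in>?I. Pr (cylinder J S \<inter> B))"
    by (rule prob_decompose) (use assms depends_sets in auto)
  also have "\<dots> = (\<Sum>S\<in>?I. Pr (cylinder J S)) * Pr B"
    unfolding sum_distrib_right by (intro sum.cong cyl) auto
  also have "(\<Sum>S\<in>?I. Pr (cylinder J S)) = Pr A"
    unfolding prob_eq_sum[OF assms(1,4)] using assms by (intro sum.cong) (auto simp: prob_cylinder)
  finally show ?thesis .
qed

lemma prob_avoid: "finite X \<Longrightarrow> Pr (- hit X) = (1 - p) ^ card X"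
proof -
  assume "finite X"
  moreover have "- hit X = cylinder X {}" by (auto simp: hit_def cylinder_def)
  ultimately show ?thesis using prob_cylinder[of X "{}"] by simp
qed

lemma prob_hit: "finite X \<Longrightarrow> Pr (hit X) = 1 - (1 - p) ^ card X"
  using prob_compl[of "- hit X"] prob_avoid[of X] depends_sets[OF _ depends_Compl[OF depends_hit]] space_lbp
  by (simp add: Compl_eq_Diff_UNIV[symmetric])

text \<open>Needed for the exchange of the two coordinates, which reduces growth by rows to growth
  by columns.\<close>

lemma prob_image_bij:
  assumes "finite J" "depends J A" "bij \<pi>"
  shows "Pr {\<omega>. \<omega> \<circ> \<pi> \<in> A} = Pr A"
proof -
  have inj: "inj \<pi>" using assms bij_is_inj by blast
  have dep: "depends (\<pi> ` J) {\<omega>. \<omega> \<circ> \<pi> \<in> A}" by (rule depends_comp[OF assms(2)])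
  have bb: "bij_betw ((`) \<pi>) {S \<in> Pow J. (\<lambda>x. x \<in> S) \<in> A}
      {S \<in> Pow (\<pi> ` J). (\<lambda>x. x \<in> S) \<in> {\<omega>. \<omega> \<circ> \<pi> \<in> A}}"
  proof (rule bij_betwI')
    fix S T assume "S \<in> {S \<in> Pow J. (\<lambda>x. x \<in> S) \<in> A}" "T \<in> {S \<in> Pow J. (\<lambda>x. x \<in> S) \<in> A}"
    show "\<pi> ` S = \<pi> ` T \<longleftrightarrow> S = T" using inj by (simp add: inj_image_eq_iff)
  next
    fix S assume "S \<in> {S \<in> Pow J. (\<lambda>x. x \<in> S) \<in> A}"
    then show "\<pi> ` S \<in> {S \<in> Pow (\<pi> ` J). (\<lambda>x. x \<in> S) \<in> {\<omega>. \<omega> \<circ> \<pi> \<in> A}}"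
      using inj by (auto simp: comp_def inj_image_mem_iff)
  next
    fix T assume T: "T \<in> {S \<in> Pow (\<pi> ` J). (\<lambda>x. x \<in> S) \<in> {\<omega>. \<omega> \<circ> \<pi> \<in> A}}"
    then obtain S where S: "S \<subseteq> J" "T = \<pi> ` S" by (auto simp: subset_image_iff)
    then show "\<exists>S\<in>{S \<in> Pow J. (\<lambda>x. x \<in> S) \<in> A}. T = \<pi> ` S"
      using T inj by (auto simp: comp_def inj_image_mem_iff)
  qed
  have "Pr {\<omega>. \<omega> \<circ> \<pi> \<in> A}
      = (\<Sum>S\<in>{S \<in> Pow J. (\<lambda>x. x \<in> S) \<in> A}. p ^ card (\<pi> ` S) * (1 - p) ^ card (\<pi> ` J - \<pi> ` S))"
    unfolding prob_eq_sum[OF finite_imageI[OF assms(1)] dep]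
    by (rule sum.reindex_bij_betw[OF bb, symmetric])
  also have "\<dots> = Pr A"
    unfolding prob_eq_sum[OF assms(1,2)]
  proof (rule sum.cong[OF refl])
    fix S
    have "card (\<pi> ` S) = card S" "card (\<pi> ` J - \<pi> ` S) = card (J - S)"
      using card_image[OF inj_on_subset[OF inj subset_UNIV]] image_set_diff[OF inj, symmetric] by auto
    then show "p ^ card (\<pi> ` S) * (1 - p) ^ card (\<pi> ` J - \<pi> ` S) = p ^ card S * (1 - p) ^ card (J - S)"
      by simp
  qed
  finally show ?thesis .
qed

section \<open>Runs of lines without two consecutive misses\<close>

text \<open>No two consecutive sets among \<open>X 0, \<dots>, X (l - 1)\<close> are empty, where those with index in \<open>T\<close> count as
  hit.\<close>

definition nogap :: "(nat \<Rightarrow> site set) \<Rightarrow> nat \<Rightarrow> nat set \<Rightarrow> (site \<Rightarrow> bool) set" where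
  "nogap X l T = {\<omega>. \<forall>i. Suc i < l \<longrightarrow> i \<in> T \<or> Suc i \<in> T \<or> \<omega> \<in> hit (X i) \<or> \<omega> \<in> hit (X (Suc i))}"

lemma depends_nogap: "depends (\<Union>i<l. X i) (nogap X l T)"
proof -
  have *: "\<omega>' \<in> hit (X i)" if "\<forall>x\<in>(\<Union>i<l. X i). \<omega> x = \<omega>' x" "i < l" "\<omega> \<in> hit (X i)" for \<omega> \<omega>' i
    using that unfolding hit_def by blast
  show ?thesis
    unfolding depends_def
  proof (intro allI impI)
    fix \<omega> \<omega>' assume eq: "\<forall>x\<in>(\<Union>i<l. X i). \<omega> x = \<omega>' x" and "\<omega> \<in> nogap X l T"
    then have "\<forall>i. Suc i < l \<longrightarrow> i \<in> T \<or> Suc i \<in> T \<or> \<omega> \<in> hit (X i) \<or> \<omega> \<in> hit (X (Suc i))"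
      by (simp add: nogap_def)
    then show "\<omega>' \<in> nogap X l T"
      unfolding nogap_def using *[OF eq] Suc_lessD by blast
  qed
qed

abbreviation u :: "nat \<Rightarrow> real" where "u n \<equiv> 1 - (1 - p) ^ n"

lemma u_bounds: "0 \<le> u n" "u n \<le> 1" "n \<ge> 1 \<Longrightarrow> 0 < u n" "u n < 1"
  using p_pos p_less_1 by (auto simp: power_le_one power_less_one_iff)

text \<open>Conditioning on the last line gives P(l) \<le> u P(l - 1) + (1 - u) u P(l - 2), whose
  characteristic root is \<open>bet u\<close>. A line in \<open>T\<close> counts as hit for free;
  dropping it, possibly with its neighbour, costs at most \<open>bet ^ 2\<close>, hence the exponent
  2 * card. The extra 1 covers the start l \<le> 1. The bound is multiplied out so that no negative
  powers appear.\<close>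

lemma prob_nogap:
  assumes "\<And>i. i < l \<Longrightarrow> finite (X i) \<and> card (X i) = n" "n \<ge> 1"
    and "\<And>i j. i < l \<Longrightarrow> j < l \<Longrightarrow> i \<noteq> j \<Longrightarrow> X i \<inter> X j = {}"
  shows "Pr (nogap X l T) * bet (u n) ^ (2 * card (T \<inter> {..<l}) + 1) \<le> bet (u n) ^ l"
  using assms(1,3)
proof (induction l rule: less_induct)
  case (less l)
  define b where "b = bet (u n)"
  have b: "0 < b" "b \<le> 1" "b ^ 2 = u n * b + u n * (1 - u n)"
    using u_bounds[of n] assms(2) bet_pos[of "u n"] bet_le_1[of "u n"] bet_square[of "u n"] by (auto simp: b_def)
  define t where "t = (\<lambda>l. card (T \<inter> {..<l}))"
  have t_Suc: "t (Suc k) = (if k \<in> T then Suc (t k) else t k)" for k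
  proof -
    have "T \<inter> {..<Suc k} = (if k \<in> T then insert k (T \<inter> {..<k}) else T \<inter> {..<k})"
      by (auto simp: less_Suc_eq)
    then show ?thesis by (simp add: t_def)
  qed
  have fin: "finite (\<Union>i<k. X i)" if "k \<le> l" for k
    using less.prems(1) that by auto
  have IH: "Pr (nogap X k T) * b ^ (2 * t k + 1) \<le> b ^ k" if "k < l" for k
    using less.IH[OF that] less.prems that unfolding b_def t_def by auto
  have sets: "nogap X k T \<in> sets (lbp_measure p)" if "k \<le> l" for k
    by (rule depends_sets[OF fin[OF that] depends_nogap])
  have "Pr (nogap X l T) * b ^ (2 * t l + 1) \<le> b ^ l"
  proof (cases "l \<le> 1")
    case True
    then have "b ^ (2 * t l + 1) \<le> b ^ l"
      using b by (intro power_decreasing) auto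
    moreover have "Pr (nogap X l T) * b ^ (2 * t l + 1) \<le> 1 * b ^ (2 * t l + 1)"
      using b by (intro mult_right_mono) auto
    ultimately show ?thesis by simp
  next
    case False
    define k where "k = l - 2"
    have l: "l = Suc (Suc k)" using False by (simp add: k_def)
    have mono1: "nogap X l T \<subseteq> nogap X (Suc k) T" and mono2: "nogap X l T \<subseteq> nogap X k T"
      unfolding nogap_def l using less_SucI by blast+
    have m1: "Pr (nogap X l T) \<le> Pr (nogap X (Suc k) T)"
      by (rule finite_measure_mono[OF mono1 sets]) (simp add: l)
    have m2: "Pr (nogap X l T) \<le> Pr (nogap X k T)"
      by (rule finite_measure_mono[OF mono2 sets]) (simp add: l)
    consider "Suc k \<in> T" | "Suc k \<notin> T" "k \<in> T" | "Suc k \<notin> T" "k \<notin> T" by blast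
    then show ?thesis
    proof cases
      case 1
      then have "t l = Suc (t (Suc k))" using t_Suc[of "Suc k"] l by simp
      then have "Pr (nogap X l T) * b ^ (2 * t l + 1) = Pr (nogap X l T) * b ^ (2 * t (Suc k) + 1) * b ^ 2"
        by (simp add: power2_eq_square)
      also have "\<dots> \<le> Pr (nogap X (Suc k) T) * b ^ (2 * t (Suc k) + 1) * b ^ 2"
        using m1 b(1) by (intro mult_right_mono) auto
      also have "\<dots> \<le> b ^ Suc k * b ^ 2"
        using IH[of "Suc k"] b(1) by (intro mult_right_mono) (auto simp: l)
      also have "\<dots> \<le> b ^ l" using b(1,2) power_decreasing[of l "Suc k + 2" b] unfolding l by (simp add: power2_eq_square mult.assoc)
      finally show ?thesis .
    next
      case 2
      then have "t l = Suc (t k)" using t_Suc[of "Suc k"] t_Suc[of k] l by simp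
      then have "Pr (nogap X l T) * b ^ (2 * t l + 1) = Pr (nogap X l T) * b ^ (2 * t k + 1) * b ^ 2"
        by (simp add: power2_eq_square)
      also have "\<dots> \<le> Pr (nogap X k T) * b ^ (2 * t k + 1) * b ^ 2"
        using m2 b(1) by (intro mult_right_mono) auto
      also have "\<dots> \<le> b ^ k * b ^ 2"
        using IH[of k] b(1) by (intro mult_right_mono) (auto simp: l)
      also have "\<dots> = b ^ l" unfolding l by (simp add: power2_eq_square)
      finally show ?thesis .
    next
      case 3
      then have t: "t l = t k" "t (Suc k) = t k" using t_Suc[of "Suc k"] t_Suc[of k] l by auto
      let ?A = "hit (X (Suc k))" and ?B = "hit (X k)"
      have X: "finite (X (Suc k))" "card (X (Suc k)) = n" "finite (X k)" "card (X k) = n"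
        using less.prems(1) l by auto
      have dis: "X i \<inter> X j = {}" if "i < l" "j < l" "i \<noteq> j" for i j
        using less.prems(2) that by blast
      have dA: "X (Suc k) \<inter> (\<Union>i<Suc k. X i) = {}"
        using dis[of "Suc k"] unfolding l by (simp add: Int_UN_distrib)
      have dB: "X k \<inter> (\<Union>i<k. X i) = {}"
        using dis[of k] unfolding l by (simp add: Int_UN_distrib)
      have dC: "X (Suc k) \<inter> (X k \<union> (\<Union>i<k. X i)) = {}"
        using dA by (simp add: lessThan_Suc)
      have i1: "Pr (?A \<inter> nogap X (Suc k) T) = u n * Pr (nogap X (Suc k) T)"
        using prob_indep[OF X(1) fin[of "Suc k"] dA depends_hit depends_nogap] X prob_hit[of "X (Suc k)"] l by simp
      have i2: "Pr (?B \<inter> nogap X k T) = u n * Pr (nogap X k T)"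
        using prob_indep[OF X(3) fin[of k] dB depends_hit depends_nogap] X prob_hit[of "X k"] l by simp
      have i3: "Pr (- ?A \<inter> (?B \<inter> nogap X k T)) = (1 - u n) * (u n * Pr (nogap X k T))"
        using prob_indep[OF X(1) _ dC depends_Compl[OF depends_hit] depends_Int[OF depends_hit depends_nogap]]
          X i2 fin[of k] prob_avoid[of "X (Suc k)"] l by simp
      have s: "?A \<in> sets (lbp_measure p)" "?B \<in> sets (lbp_measure p)"
        using X depends_sets depends_hit by auto
      have "nogap X l T \<subseteq> (?A \<inter> nogap X (Suc k) T) \<union> (- ?A \<inter> (?B \<inter> nogap X k T))"
      proof
        fix \<omega> assume w: "\<omega> \<in> nogap X l T"
        have "\<omega> \<in> ?B" if "\<omega> \<notin> ?A"
          using w 3 that unfolding nogap_def l by auto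
        then show "\<omega> \<in> (?A \<inter> nogap X (Suc k) T) \<union> (- ?A \<inter> (?B \<inter> nogap X k T))"
          using w mono1 mono2 by blast
      qed
      then have "Pr (nogap X l T) \<le> Pr ((?A \<inter> nogap X (Suc k) T) \<union> (- ?A \<inter> (?B \<inter> nogap X k T)))"
        using s sets[of k] sets[of "Suc k"] sets.compl_sets[OF s(1)] space_lbp
        by (intro finite_measure_mono) (auto simp: l Compl_eq_Diff_UNIV)
      also have "\<dots> \<le> Pr (?A \<inter> nogap X (Suc k) T) + Pr (- ?A \<inter> (?B \<inter> nogap X k T))"
        using s sets[of k] sets[of "Suc k"] sets.compl_sets[OF s(1)] space_lbp
        by (intro measure_Un_le) (auto simp: l Compl_eq_Diff_UNIV)
      finally have "Pr (nogap X l T) \<le> u n * Pr (nogap X (Suc k) T) + (1 - u n) * (u n * Pr (nogap X k T))"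
        by (simp only: i1 i3)
      then have "Pr (nogap X l T) * b ^ (2 * t k + 1)
          \<le> (u n * Pr (nogap X (Suc k) T) + (1 - u n) * (u n * Pr (nogap X k T))) * b ^ (2 * t k + 1)"
        using b by (intro mult_right_mono) auto
      also have "\<dots> = u n * (Pr (nogap X (Suc k) T) * b ^ (2 * t k + 1))
          + (1 - u n) * u n * (Pr (nogap X k T) * b ^ (2 * t k + 1))"
        by (simp only: distrib_right mult.assoc)
      also have "\<dots> \<le> u n * b ^ Suc k + (1 - u n) * u n * b ^ k"
        using IH[of k] IH[of "Suc k"] t u_bounds[of n] unfolding l
        by (intro add_mono mult_left_mono) auto
      also have "\<dots> = b ^ k * (u n * b + u n * (1 - u n))"
        by (simp add: algebra_simps)
      also have "\<dots> = b ^ l" unfolding b(3)[symmetric] l by (simp add: power2_eq_square)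
      finally show ?thesis unfolding t .
    qed
  qed
  then show ?case unfolding b_def t_def .
qed

end

section \<open>Growth of the active set\<close>

text \<open>The dynamics without time: activation is monotone, so the order of updates does not
  matter. Rule \<open>two\<close> may ignore whether the site is empty, since an occupied site next
  to an active one activates anyway.\<close>

inductive_set cl :: "(site \<Rightarrow> bool) \<Rightarrow> site set \<Rightarrow> site set" for \<omega> :: "site \<Rightarrow> bool" and R :: "site set" where
  base: "x \<in> R \<Longrightarrow> x \<in> cl \<omega> R"
| occ: "\<omega> x \<Longrightarrow> y \<in> cl \<omega> R \<Longrightarrow> l1dist x y \<le> 2 \<Longrightarrow> x \<in> cl \<omega> R"
| two: "y \<in> cl \<omega> R \<Longrightarrow> y' \<in> cl \<omega> R \<Longrightarrow> y \<noteq> y' \<Longrightarrow> l1dist x y \<le> 1 \<Longrightarrow> l1dist x y' \<le> 1 \<Longrightarrow> x \<in> cl \<omega> R"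

lemma cl_trans:
  assumes "R \<subseteq> cl \<omega> S"
  shows "cl \<omega> R \<subseteq> cl \<omega> S"
proof
  fix x assume "x \<in> cl \<omega> R"
  then show "x \<in> cl \<omega> S"
    by (induction rule: cl.induct) (use assms in \<open>auto intro: cl.occ cl.two\<close>)
qed

lemma finite_l1_ball: "finite {y. l1dist x y \<le> k \<and> P y}"
proof (rule finite_subset)
  show "{y. l1dist x y \<le> k \<and> P y} \<subseteq> {fst x - k..fst x + k} \<times> {snd x - k..snd x + k}"
    by (auto simp: l1dist_def)
qed auto

lemma lbp_config_Suc: "lbp_config \<omega> (Suc t) = lbp_step (lbp_config \<omega> t)"
  by (simp add: lbp_config_def)

lemma lbp_config_0: "lbp_config \<omega> 0 = lbp_init \<omega>"
  by (simp add: lbp_config_def)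

lemma lbp_config_Active_mono:
  assumes "lbp_config \<omega> t x = Active" "t \<le> t'"
  shows "lbp_config \<omega> t' x = Active"
  using assms(2)
  by (induction t' rule: dec_induct) (use assms(1) in \<open>auto simp: lbp_config_Suc lbp_step_def\<close>)

lemma lbp_config_Empty: "\<omega> x \<Longrightarrow> lbp_config \<omega> t x \<noteq> Empty"
  by (induction t) (auto simp: lbp_config_0 lbp_init_def lbp_config_Suc lbp_step_def split: lbp_state.splits)

lemma lbp_config_Occupied: "lbp_config \<omega> t x = Occupied \<Longrightarrow> \<omega> x"
  by (induction t) (auto simp: lbp_config_0 lbp_init_def lbp_config_Suc lbp_step_def split: lbp_state.splits if_splits)

lemma cl_imp_Active:
  assumes "\<omega> (0, 0)" "x \<in> cl \<omega> {(0, 0)}"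
  shows "\<exists>t. lbp_config \<omega> t x = Active"
  using assms(2)
proof (induction rule: cl.induct)
  case (base x)
  then have "lbp_config \<omega> 0 x = Active" using assms by (simp add: lbp_config_0 lbp_init_def)
  then show ?case by blast
next
  case (occ x y)
  then obtain t where t: "lbp_config \<omega> t y = Active" by blast
  have "\<exists>z. l1dist x z \<le> 2 \<and> lbp_config \<omega> t z = Active"
    using occ t by blast
  then have "lbp_config \<omega> (Suc t) x = Active"
    using lbp_config_Empty[of \<omega> x t] occ by (auto simp: lbp_config_Suc lbp_step_def split: lbp_state.splits)
  then show ?case by blast
next
  case (two y y' x)
  then obtain t t' where t: "lbp_config \<omega> t y = Active" "lbp_config \<omega> t' y' = Active" by blast
  \<comment> \<open>The two neighbours may become active at different times; both are active at the
    later one.\<close>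
  define T where "T = max t t'"
  have T: "lbp_config \<omega> T y = Active" "lbp_config \<omega> T y' = Active"
    using t lbp_config_Active_mono by (auto simp: T_def)
  have "card {y, y'} \<le> card {z. l1dist x z \<le> 1 \<and> lbp_config \<omega> T z = Active}"
    using two T by (intro card_mono finite_l1_ball) auto
  then have c: "2 \<le> card {z. l1dist x z \<le> 1 \<and> lbp_config \<omega> T z = Active}"
    using two by simp
  have "\<exists>z. l1dist x z \<le> 2 \<and> lbp_config \<omega> T z = Active"
    using two T by (intro exI[of _ y]) auto
  then have "lbp_config \<omega> (Suc T) x = Active"
    using c by (auto simp: lbp_config_Suc lbp_step_def split: lbp_state.splits)
  then show ?case by blast
qed

lemma indefinite_growthI:
  assumes "\<omega> (0, 0)" "cl \<omega> {(0, 0)} = UNIV"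
  shows "indefinite_growth \<omega>"
  using cl_imp_Active[of \<omega>] assms unfolding indefinite_growth_def by blast

text \<open>The counterpart of \<open>cl\<close> for upper bounds: neither rule leads out of a
  trapping set.\<close>

lemma Active_subset:
  assumes "(0, 0) \<in> R"
    and occ: "\<And>x y. x \<notin> R \<Longrightarrow> \<omega> x \<Longrightarrow> y \<in> R \<Longrightarrow> \<not> l1dist x y \<le> 2"
    and two: "\<And>x y y'. x \<notin> R \<Longrightarrow> y \<in> R \<Longrightarrow> y' \<in> R \<Longrightarrow> l1dist x y \<le> 1 \<Longrightarrow> l1dist x y' \<le> 1 \<Longrightarrow> y = y'"
  shows "lbp_config \<omega> t x = Active \<Longrightarrow> x \<in> R"
proof (induction t arbitrary: x)
  case 0
  then show ?case using assms(1) by (auto simp: lbp_config_0 lbp_init_def split: if_splits)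
next
  case (Suc t)
  show ?case
  proof (rule ccontr)
    assume x: "x \<notin> R"
    then have "lbp_config \<omega> t x \<noteq> Active" using Suc.IH by blast
    then consider "lbp_config \<omega> t x = Occupied" | "lbp_config \<omega> t x = Empty"
      using lbp_state.exhaust by blast
    then show False
    proof cases
      case 1
      then have "\<exists>y. l1dist x y \<le> 2 \<and> lbp_config \<omega> t y = Active"
        using Suc.prems by (auto simp: lbp_config_Suc lbp_step_def split: if_splits)
      then show False using occ[OF x lbp_config_Occupied[OF 1]] Suc.IH by blast
    next
      case 2
      let ?S = "{y. l1dist x y \<le> 1 \<and> lbp_config \<omega> t y = Active}"
      have "2 \<le> card ?S"
        using Suc.prems 2 by (auto simp: lbp_config_Suc lbp_step_def split: if_splits)
      moreover have "card ?S \<le> Suc 0"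
        unfolding card_le_Suc0_iff_eq[OF finite_l1_ball]
        using two[OF x] Suc.IH by blast
      ultimately show False by simp
    qed
  qed
qed

section \<open>Filling lines next to an active segment, up to the whole plane\<close>

lemma cl_column_fill:
  fixes x x' y0 y1 y2 :: int
  assumes col: "\<And>y. y1 \<le> y \<Longrightarrow> y \<le> y2 \<Longrightarrow> (x, y) \<in> cl \<omega> R"
    and adj: "\<bar>x' - x\<bar> = 1" and y0: "y1 \<le> y0" "y0 \<le> y2" "(x', y0) \<in> cl \<omega> R"
    and y: "y1 \<le> y" "y \<le> y2"
  shows "(x', y) \<in> cl \<omega> R"
proof (cases "y0 \<le> y")
  case True
  then have "y \<le> y2 \<longrightarrow> (x', y) \<in> cl \<omega> R"
  proof (induction y rule: int_ge_induct)
    case (step i)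
    show ?case
    proof
      assume "i + 1 \<le> y2"
      then have "(x', i) \<in> cl \<omega> R" "(x, i + 1) \<in> cl \<omega> R" using step col y0 by auto
      then show "(x', i + 1) \<in> cl \<omega> R" by (rule cl.two) (use adj in \<open>auto simp: l1dist_def\<close>)
    qed
  qed (use y0 in auto)
  then show ?thesis using y by simp
next
  case False
  then have "y \<le> y0" by simp
  then have "y1 \<le> y \<longrightarrow> (x', y) \<in> cl \<omega> R"
  proof (induction y rule: int_le_induct)
    case (step i)
    show ?case
    proof
      assume "y1 \<le> i - 1"
      then have "(x', i) \<in> cl \<omega> R" "(x, i - 1) \<in> cl \<omega> R" using step col y0 by auto
      then show "(x', i - 1) \<in> cl \<omega> R" by (rule cl.two) (use adj in \<open>auto simp: l1dist_def\<close>)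
    qed
  qed (use y0 in auto)
  then show ?thesis using y by simp
qed

lemma cl_column_hit:
  fixes x d y0 y1 y2 :: int
  assumes col: "\<And>y. y1 \<le> y \<Longrightarrow> y \<le> y2 \<Longrightarrow> (x, y) \<in> cl \<omega> R"
    and d: "\<bar>d\<bar> = 1" and y0: "y1 \<le> y0" "y0 \<le> y2" and w: "\<omega> (x + d, y0)"
    and y: "y1 \<le> y" "y \<le> y2"
  shows "(x + d, y) \<in> cl \<omega> R"
proof (rule cl_column_fill[OF col _ y0 _ y])
  show "(x + d, y0) \<in> cl \<omega> R"
    by (rule cl.occ[OF w col[OF y0]]) (use d in \<open>auto simp: l1dist_def\<close>)
qed (use d in auto)

lemma cl_column_hit2:
  fixes x d y0 y1 y2 :: int
  assumes col: "\<And>y. y1 \<le> y \<Longrightarrow> y \<le> y2 \<Longrightarrow> (x, y) \<in> cl \<omega> R"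
    and d: "\<bar>d\<bar> = 1" and y0: "y1 \<le> y0" "y0 \<le> y2" and w: "\<omega> (x + 2 * d, y0)"
    and y: "y1 \<le> y" "y \<le> y2"
  shows "(x + d, y) \<in> cl \<omega> R \<and> (x + 2 * d, y) \<in> cl \<omega> R"
proof -
  have 2: "(x + 2 * d, y0) \<in> cl \<omega> R"
    by (rule cl.occ[OF w col[OF y0]]) (use d in \<open>auto simp: l1dist_def\<close>)
  have 1: "(x + d, y0) \<in> cl \<omega> R"
    by (rule cl.two[OF 2 col[OF y0]]) (use d in \<open>auto simp: l1dist_def\<close>)
  have c1: "(x + d, y) \<in> cl \<omega> R" if "y1 \<le> y" "y \<le> y2" for y
    by (rule cl_column_fill[OF col _ y0 1 that]) (use d in auto)
  have "(x + 2 * d, y) \<in> cl \<omega> R"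
    by (rule cl_column_fill[OF c1 _ y0 2 y]) (use d in auto)
  then show ?thesis using c1[OF y] by simp
qed

lemma l1dist_swap: "l1dist (prod.swap x) (prod.swap y) = l1dist x y"
  by (simp add: l1dist_def)

lemma cl_swap:
  assumes "x \<in> cl (\<omega> \<circ> prod.swap) R"
  shows "prod.swap x \<in> cl \<omega> (prod.swap ` R)"
  using assms
proof (induction rule: cl.induct)
  case (base x)
  then show ?case by (intro cl.base imageI)
next
  case (occ x y)
  show ?case
    by (rule cl.occ[OF _ occ.IH]) (use occ in \<open>auto simp: l1dist_swap simp del: swap_swap\<close>)
next
  case (two y y' x)
  show ?case
    by (rule cl.two[OF two.IH]) (use two in \<open>auto simp: l1dist_swap inj_eq\<close>)
qed

lemma cl_swap_iff: "prod.swap x \<in> cl \<omega> (prod.swap ` R) \<longleftrightarrow> x \<in> cl (\<omega> \<circ> prod.swap) R"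
proof
  assume "prod.swap x \<in> cl \<omega> (prod.swap ` R)"
  moreover have "\<omega> = (\<omega> \<circ> prod.swap) \<circ> prod.swap" by (simp add: fun_eq_iff)
  ultimately have "prod.swap (prod.swap x) \<in> cl (\<omega> \<circ> prod.swap) (prod.swap ` (prod.swap ` R))"
    using cl_swap by metis
  then show "x \<in> cl (\<omega> \<circ> prod.swap) R" by (simp add: image_image)
qed (rule cl_swap)

lemma cl_row_hit:
  fixes y d x0 x1 x2 :: int
  assumes row: "\<And>x. x1 \<le> x \<Longrightarrow> x \<le> x2 \<Longrightarrow> (x, y) \<in> cl \<omega> R"
    and d: "\<bar>d\<bar> = 1" and x0: "x1 \<le> x0" "x0 \<le> x2" and w: "\<omega> (x0, y + d)"
    and x: "x1 \<le> x" "x \<le> x2"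
  shows "(x, y + d) \<in> cl \<omega> R"
proof -
  let ?\<omega> = "\<omega> \<circ> prod.swap" and ?R = "prod.swap ` R"
  have iff: "(a, b) \<in> cl \<omega> R \<longleftrightarrow> (b, a) \<in> cl ?\<omega> ?R" for a b
    using cl_swap_iff[of "(b, a)" \<omega> ?R] by (simp add: image_image)
  show ?thesis unfolding iff
    by (rule cl_column_hit[where ?y1.0 = x1 and ?y2.0 = x2 and ?y0.0 = x0]) (use row w d x0 x in \<open>auto simp: iff\<close>)
qed

definition quad :: "nat \<Rightarrow> nat \<Rightarrow> site set" where
  "quad a b = {0..<int a} \<times> {0..<int b}"

definition vline :: "nat \<Rightarrow> nat \<Rightarrow> nat \<Rightarrow> site set" where
  "vline a b c = {int a} \<times> {int b..<int c}"

lemma vline_finite: "finite (vline a b c)" and vline_card: "card (vline a b c) = c - b"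
  unfolding vline_def by (simp_all add: card_cartesian_product)

lemma swap_quad: "prod.swap ` quad a b = quad b a"
  unfolding quad_def by (simp add: product_swap)

lemma quad_mono: "a \<le> a' \<Longrightarrow> b \<le> b' \<Longrightarrow> quad a b \<subseteq> quad a' b'"
  unfolding quad_def by auto

lemma quad_column1:
  assumes "quad a b \<subseteq> cl \<omega> R" "1 \<le> a" "\<omega> \<in> hit (vline a c b)"
  shows "quad (a + 1) b \<subseteq> cl \<omega> R"
proof -
  obtain y0 where y0: "int c \<le> y0" "y0 < int b" "\<omega> (int a, y0)"
    using assms(3) by (auto simp: hit_def vline_def)
  have col: "(int a - 1, y) \<in> cl \<omega> R" if "0 \<le> y" "y \<le> int b - 1" for y
    using assms(1,2) that by (auto simp: quad_def)
  have "(int a - 1 + 1, y) \<in> cl \<omega> R" if "0 \<le> y" "y \<le> int b - 1" for y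
    by (rule cl_column_hit[OF col _ _ _ _ that, where ?y0.0 = y0]) (use y0 in auto)
  then have c: "(int a, y) \<in> cl \<omega> R" if "0 \<le> y" "y \<le> int b - 1" for y
    using that by simp
  have "quad (a + 1) b - quad a b \<subseteq> cl \<omega> R"
  proof
    fix z assume z: "z \<in> quad (a + 1) b - quad a b"
    then obtain x y where "z = (x, y)" "x = int a" "0 \<le> y" "y \<le> int b - 1"
      by (cases z) (auto simp: quad_def)
    then show "z \<in> cl \<omega> R" using c[of y] by auto
  qed
  then show ?thesis using assms(1) by blast
qed

lemma quad_column2:
  assumes "quad a b \<subseteq> cl \<omega> R" "1 \<le> a" "\<omega> \<in> hit (vline (a + 1) c b)"
  shows "quad (a + 2) b \<subseteq> cl \<omega> R"
proof -
  obtain y0 where y0: "int c \<le> y0" "y0 < int b" "\<omega> (int a - 1 + 2 * 1, y0)"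
    using assms(3) by (auto simp: hit_def vline_def add.commute)
  have col: "(int a - 1, y) \<in> cl \<omega> R" if "0 \<le> y" "y \<le> int b - 1" for y
    using assms(1,2) that by (auto simp: quad_def)
  have c: "(int a - 1 + 1, y) \<in> cl \<omega> R \<and> (int a - 1 + 2 * 1, y) \<in> cl \<omega> R" if "0 \<le> y" "y \<le> int b - 1" for y
    by (rule cl_column_hit2[OF col _ _ _ _ that, where ?y0.0 = y0]) (use y0 in auto)
  have "quad (a + 2) b - quad a b \<subseteq> cl \<omega> R"
  proof
    fix z assume z: "z \<in> quad (a + 2) b - quad a b"
    then obtain x y where "z = (x, y)" "int a \<le> x" "x < int a + 2" "0 \<le> y" "y \<le> int b - 1"
      by (cases z) (auto simp: quad_def)
    moreover from this have "x = int a \<or> x = int a + 1" by linarith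
    ultimately show "z \<in> cl \<omega> R" using c[of y] by (auto simp: add.commute)
  qed
  then show ?thesis using assms(1) by blast
qed

text \<open>Spreading to the left and downwards makes every site with both coordinates below N
  active; only after that can columns to the right be entered at negative heights, and rows above
  likewise. Every required segment has a negative coordinate, and its length grows with k, so that
  the failure probabilities are summable.\<close>

lemma fill_plane:
  fixes N :: nat
  assumes q: "quad N N \<subseteq> cl \<omega> R" and N: "N \<ge> 1"
    and left: "\<And>k. \<omega> \<in> hit ({- int k - 1} \<times> {- int k..<int N})"
    and bottom: "\<And>k. \<omega> \<in> hit ({- int k - 1..<int N} \<times> {- int k - 1})"
    and right: "\<And>k. \<omega> \<in> hit ({int (N + k)} \<times> {- int (N + k)..<0})"
    and top: "\<And>k. \<omega> \<in> hit ({- int (N + k)..<0} \<times> {int (N + k)})"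
  shows "cl \<omega> R = UNIV"
proof -
  have 1: "{- int k..<int N} \<times> {- int k..<int N} \<subseteq> cl \<omega> R" for k
  proof (induction k)
    case 0
    then show ?case using q by (simp add: quad_def)
  next
    case (Suc k)
    obtain y0 where y0: "- int k \<le> y0" "y0 < int N" "\<omega> (- int k + - 1, y0)"
      using left[of k] by (auto simp: hit_def)
    have c1: "(- int k + - 1, y) \<in> cl \<omega> R" if "- int k \<le> y" "y \<le> int N - 1" for y
      by (rule cl_column_hit[OF _ _ _ _ _ that, where ?y0.0 = y0]) (use y0 Suc N in auto)
    have c2: "(x, - int k) \<in> cl \<omega> R" if "- int k - 1 \<le> x" "x \<le> int N - 1" for x
      using Suc c1[of "- int k"] that N by (cases "x = - int k - 1") auto
    obtain x0 where x0: "- int k - 1 \<le> x0" "x0 < int N" "\<omega> (x0, - int k + - 1)"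
      using bottom[of k] by (auto simp: hit_def)
    have c3: "(x, - int k + - 1) \<in> cl \<omega> R" if "- int k - 1 \<le> x" "x \<le> int N - 1" for x
      by (rule cl_row_hit[OF c2 _ _ _ _ that, where ?x0.0 = x0]) (use x0 in auto)
    show ?case
    proof
      fix z assume z: "z \<in> {- int (Suc k)..<int N} \<times> {- int (Suc k)..<int N}"
      obtain x y where xy: "z = (x, y)" by (cases z)
      show "z \<in> cl \<omega> R"
      proof (cases "y = - int k - 1")
        case True
        then show ?thesis using c3[of x] z xy by auto
      next
        case False
        then show ?thesis using c1[of y] Suc z xy by (cases "x = - int k - 1") auto
      qed
    qed
  qed
  have 2: "x < int (N + k) \<Longrightarrow> y < int (N + k) \<Longrightarrow> (x, y) \<in> cl \<omega> R" for k x y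
  proof (induction k arbitrary: x y)
    case 0
    have "(x, y) \<in> {- int (nat (max (- x) (- y)))..<int N} \<times> {- int (nat (max (- x) (- y)))..<int N}"
      using 0 by auto
    then show ?case using 1 by blast
  next
    case (Suc k)
    obtain y0 where y0: "- int (N + k) \<le> y0" "y0 < 0" "\<omega> (int (N + k) - 1 + 1, y0)"
      using right[of k] by (auto simp: hit_def)
    have c1: "(int (N + k) - 1 + 1, y) \<in> cl \<omega> R" if "y < int (N + k)" for y
      by (rule cl_column_hit[where ?y0.0 = y0 and ?y1.0 = "min y y0" and ?y2.0 = "int (N + k) - 1"])
        (use y0 Suc that N in auto)
    have c2: "(x, int (N + k) - 1) \<in> cl \<omega> R" if "x \<le> int (N + k)" for x
      using Suc.IH[of x "int (N + k) - 1"] c1[of "int (N + k) - 1"] that N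
      by (cases "x = int (N + k)") auto
    obtain x0 where x0: "- int (N + k) \<le> x0" "x0 < 0" "\<omega> (x0, int (N + k) - 1 + 1)"
      using top[of k] by (auto simp: hit_def)
    have c3: "(x, int (N + k) - 1 + 1) \<in> cl \<omega> R" if "x \<le> int (N + k)" for x
      by (rule cl_row_hit[where ?x0.0 = x0 and ?x1.0 = "min x x0" and ?x2.0 = "int (N + k)"])
        (use x0 c2 that N in auto)
    show ?case
      using Suc.prems Suc.IH[of x y] c1[of y] c3[of x] by (cases "x = int (N + k)"; cases "y = int (N + k)") auto
  qed
  have "(x, y) \<in> cl \<omega> R" for x y
  proof (rule 2)
    show "x < int (N + nat (max x y + 1))" "y < int (N + nat (max x y + 1))"
      using N by linarith+
  qed
  then show ?thesis by auto
qed

section \<open>Rectangles enclosing the active set\<close>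

text \<open>A rectangle \<open>(x1, x2, y1, y2)\<close> stands for the sites of \<open>[x1, x2] \<times> [y1, y2]\<close>.\<close>

type_synonym rect = "int \<times> int \<times> int \<times> int"

fun rbox :: "rect \<Rightarrow> site set" where
  "rbox (x1, x2, y1, y2) = {x1..x2} \<times> {y1..y2}"

fun bhull :: "rect \<Rightarrow> site \<Rightarrow> rect" where
  "bhull (x1, x2, y1, y2) (a, b) = (min x1 a, max x2 a, min y1 b, max y2 b)"

text \<open>Occupied sites near the rectangle are absorbed one at a time. Only an upper bound on the
  active set is needed, so the whole bounding box is taken.\<close>

definition grow :: "(site \<Rightarrow> bool) \<Rightarrow> rect \<Rightarrow> rect \<Rightarrow> bool" where
  "grow \<omega> r r' \<longleftrightarrow> (\<exists>s. \<omega> s \<and> s \<notin> rbox r \<and> (\<exists>y\<in>rbox r. l1dist s y \<le> 2) \<and> r' = bhull r s)"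

abbreviation grows :: "(site \<Rightarrow> bool) \<Rightarrow> rect \<Rightarrow> rect \<Rightarrow> bool" where
  "grows \<omega> \<equiv> (grow \<omega>)\<^sup>*\<^sup>*"

fun perim :: "rect \<Rightarrow> int" where
  "perim (x1, x2, y1, y2) = (x2 - x1) + (y2 - y1)"

lemma rbox_bhull: "rbox r \<subseteq> rbox (bhull r s)" "rbox r \<noteq> {} \<Longrightarrow> s \<in> rbox (bhull r s)"
  by (cases r; cases s; auto)+

lemma grow_perim: "grow \<omega> r r' \<Longrightarrow> perim r < perim r'"
  unfolding grow_def by (cases r) (auto simp: min_def max_def)

lemma grow_rbox: "grow \<omega> r r' \<Longrightarrow> rbox r \<subseteq> rbox r'"
  unfolding grow_def using rbox_bhull by blast

lemma grows_rbox: "grows \<omega> r r' \<Longrightarrow> rbox r \<subseteq> rbox r'"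
  by (induction rule: rtranclp_induct) (use grow_rbox in blast)+

text \<open>A rectangle without an outer occupied site within distance 2 is closed under both rules,
  since an outer site has at most one neighbour in it. The site \<open>(x2 + 1, 0)\<close> then
  never becomes active.\<close>

lemma indefinite_growth_grow:
  assumes "indefinite_growth \<omega>" "(0, 0) \<in> rbox r"
  shows "\<exists>r'. grow \<omega> r r'"
proof (rule ccontr)
  assume no: "\<nexists>r'. grow \<omega> r r'"
  obtain x1 x2 y1 y2 where r: "r = (x1, x2, y1, y2)" by (cases r)
  have "x \<in> rbox r" if "lbp_config \<omega> t x = Active" for t x
  proof (rule Active_subset[OF assms(2) _ _ that])
    fix x y assume "x \<notin> rbox r" "\<omega> x" "y \<in> rbox r"
    then show "\<not> l1dist x y \<le> 2" using no unfolding grow_def by blast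
  next
    fix x y y' assume "x \<notin> rbox r" "y \<in> rbox r" "y' \<in> rbox r" "l1dist x y \<le> 1" "l1dist x y' \<le> 1"
    then show "y = y'"
      by (cases x; cases y; cases y') (auto simp: r l1dist_def; linarith)
  qed
  then have "(x2 + 1, 0) \<in> rbox r"
    using assms(1) unfolding indefinite_growth_def by blast
  then show False by (simp add: r)
qed

lemma indefinite_growth_grows:
  assumes "indefinite_growth \<omega>"
  shows "\<exists>r. grows \<omega> (0, 0, 0, 0) r \<and> int n \<le> perim r"
proof (induction n)
  case 0
  have "grows \<omega> (0, 0, 0, 0) (0, 0, 0, 0) \<and> int 0 \<le> perim (0, 0, 0, 0)" by simp
  then show ?case by blast
next
  case (Suc n)
  then obtain r where r: "grows \<omega> (0, 0, 0, 0) r" "int n \<le> perim r" by blast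
  have "(0, 0) \<in> rbox r" using grows_rbox[OF r(1)] by auto
  then obtain r' where r': "grow \<omega> r r'" using indefinite_growth_grow[OF assms] by blast
  then show ?case using r grow_perim[OF r'] by (intro exI[of _ r']) auto
qed

text \<open>A side moves by at most two lines at a time, and only onto the line of the absorbed
  site, so it never skips two lines in a row. The first conjunct is the invariant needed for the
  line on which the side currently stands. Signed positions \<open>e\<close> and
  \<open>\<pi>\<close> let one proof serve all four sides.\<close>

lemma grows_side:
  fixes e :: "rect \<Rightarrow> int" and \<pi> :: "site \<Rightarrow> int"
  assumes "grows \<omega> r r'" "rbox r \<noteq> {}"
    and e: "\<And>r s. e (bhull r s) = max (e r) (\<pi> s)"
    and near: "\<And>r s y. y \<in> rbox r \<Longrightarrow> l1dist s y \<le> 2 \<Longrightarrow> \<pi> s \<le> e r + 2"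
  shows "(e r' = e r \<or> (\<exists>s\<in>rbox r'. \<omega> s \<and> \<pi> s = e r')) \<and>
    (\<forall>x. e r < x \<and> x < e r' \<longrightarrow> (\<exists>s\<in>rbox r'. \<omega> s \<and> (\<pi> s = x \<or> \<pi> s = x + 1)))"
  using assms(1)
proof (induction rule: rtranclp_induct)
  case (step r' r'')
  then obtain s y where s: "\<omega> s" "y \<in> rbox r'" "l1dist s y \<le> 2" "r'' = bhull r' s"
    unfolding grow_def by blast
  have sub: "rbox r' \<subseteq> rbox r''" "s \<in> rbox r''" using rbox_bhull[of r' s] s by auto
  have e'': "e r'' = max (e r') (\<pi> s)" "\<pi> s \<le> e r' + 2" using e near s by auto
  show ?case
  proof (cases "\<pi> s \<le> e r'")
    case True
    then have e2: "e r'' = e r'" using e'' by simp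
    show ?thesis unfolding e2 using step.IH sub(1) by blast
  next
    case False
    then have e2: "e r'' = \<pi> s" using e'' by simp
    have "\<exists>s\<in>rbox r''. \<omega> s \<and> (\<pi> s = x \<or> \<pi> s = x + 1)" if x: "e r < x" "x < e r''" for x
    proof -
      consider "x < e r'" | "x + 1 = \<pi> s" | "x = e r'"
        using x e2 e''(2) by linarith
      then show ?thesis
      proof cases
        case 1
        then show ?thesis using step.IH sub x by blast
      next
        case 2
        then show ?thesis using s sub by auto
      next
        case 3
        then show ?thesis using step.IH sub x by (metis less_irrefl subsetD)
      qed
    qed
    moreover have "\<exists>s\<in>rbox r''. \<omega> s \<and> \<pi> s = e r''" using s(1) sub(2) e2 by auto
    ultimately show ?thesis by blast
  qed
qed auto

lemma grows_first:
  assumes "grows \<omega> r r'" "\<not> P r" "P r'"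
  shows "\<exists>r1 r2. grows \<omega> r r1 \<and> \<not> P r1 \<and> grow \<omega> r1 r2 \<and> P r2 \<and> grows \<omega> r2 r'"
  using assms
proof (induction rule: converse_rtranclp_induct)
  case (step r z)
  show ?case
  proof (cases "P z")
    case True
    then show ?thesis using step by blast
  next
    case False
    then show ?thesis using step by (meson converse_rtranclp_into_rtranclp)
  qed
qed simp

section \<open>The lower bound\<close>

context bernoulli_sites
begin

text \<open>With probability at least \<open>\<theta>\<close>, the sites of \<open>U - R\<close> make the active set grow from \<open>R\<close> to \<open>T\<close>.\<close>

definition can :: "site set \<Rightarrow> site set \<Rightarrow> site set \<Rightarrow> real \<Rightarrow> bool" where
  "can R T U \<theta> \<longleftrightarrow> (\<exists>A J. finite J \<and> J \<subseteq> U - R \<and> depends J A \<and> (\<forall>\<omega>\<in>A. T \<subseteq> cl \<omega> R) \<and> \<theta> \<le> Pr A)"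

lemma canI:
  assumes "finite J" "J \<subseteq> U - R" "depends J A" "\<And>\<omega>. \<omega> \<in> A \<Longrightarrow> T \<subseteq> cl \<omega> R" "\<theta> \<le> Pr A"
  shows "can R T U \<theta>"
  unfolding can_def by (intro exI[of _ A] exI[of _ J] conjI ballI) (fact assms)+

lemma can_mono: "can R T U \<theta> \<Longrightarrow> \<theta>' \<le> \<theta> \<Longrightarrow> can R T U \<theta>'"
  unfolding can_def by (meson order_trans)

lemma can_trivial: "T \<subseteq> R \<Longrightarrow> \<theta> \<le> 1 \<Longrightarrow> can R T U \<theta>"
  unfolding can_def
  by (rule exI[of _ UNIV], rule exI[of _ "{}"])
    (use depends_UNIV prob_space space_lbp in \<open>auto intro: cl.base\<close>)

lemma can_swap:
  assumes "can R T U \<theta>"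
  shows "can (prod.swap ` R) (prod.swap ` T) (prod.swap ` U) \<theta>"
proof -
  obtain A J where A: "finite J" "J \<subseteq> U - R" "depends J A" "\<forall>\<omega>\<in>A. T \<subseteq> cl \<omega> R" "\<theta> \<le> Pr A"
    using assms unfolding can_def by blast
  let ?A = "{\<omega>. \<omega> \<circ> prod.swap \<in> A}"
  have inj: "inj (prod.swap :: site \<Rightarrow> site)" by simp
  have "prod.swap ` J \<subseteq> prod.swap ` U - prod.swap ` R"
    using A(2) image_set_diff[OF inj, of U R] by blast
  moreover have "prod.swap ` T \<subseteq> cl \<omega> (prod.swap ` R)" if "\<omega> \<in> ?A" for \<omega>
    using A(4) that cl_swap[of _ \<omega> R] by blast
  moreover have "\<theta> \<le> Pr ?A"
    using prob_image_bij[OF A(1,3), of prod.swap] A(5) bij_swap by simp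
  ultimately show ?thesis
    using A(1) depends_comp[OF A(3)] by (intro canI[of "prod.swap ` J" _ _ ?A]) auto
qed

text \<open>The disjoint events \<open>E i\<close> are decided inside \<open>R' i\<close>, whereas
  the continuation from \<open>R' i\<close> uses only sites outside it. So the probabilities
  multiply within a case and add over the cases.\<close>

lemma can_combine:
  assumes fin: "finite I"
    and K: "\<And>i. i \<in> I \<Longrightarrow> finite (K i) \<and> K i \<subseteq> U \<inter> R' i - R \<and> depends (K i) (E i)"
    and sub: "\<And>i. i \<in> I \<Longrightarrow> R \<subseteq> R' i"
    and cl: "\<And>i \<omega>. i \<in> I \<Longrightarrow> \<omega> \<in> E i \<Longrightarrow> R' i \<subseteq> cl \<omega> R"
    and can: "\<And>i. i \<in> I \<Longrightarrow> can (R' i) T U (\<theta> i)"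
    and dis: "disjoint_family_on E I"
  shows "can R T U (\<Sum>i\<in>I. Pr (E i) * \<theta> i)"
proof -
  define good where "good = (\<lambda>i A J. finite J \<and> J \<subseteq> U - R' i \<and> depends J A \<and> (\<forall>\<omega>\<in>A. T \<subseteq> cl \<omega> (R' i)) \<and> \<theta> i \<le> Pr A)"
  have "\<forall>i\<in>I. \<exists>AJ. good i (fst AJ) (snd AJ)"
  proof
    fix i assume "i \<in> I"
    from can[OF this] have "\<exists>A J. good i A J" unfolding can_def good_def .
    then show "\<exists>AJ. good i (fst AJ) (snd AJ)" by auto
  qed
  from bchoice[OF this] obtain AJ where AJ: "\<forall>i\<in>I. good i (fst (AJ i)) (snd (AJ i))" ..
  define A J where "A = (\<lambda>i. fst (AJ i))" and "J = (\<lambda>i. snd (AJ i))"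
  have "good i (A i) (J i)" if "i \<in> I" for i
    using AJ that by (simp add: A_def J_def)
  then have A: "\<And>i. i \<in> I \<Longrightarrow> finite (J i)" "\<And>i. i \<in> I \<Longrightarrow> J i \<subseteq> U - R' i"
    "\<And>i. i \<in> I \<Longrightarrow> depends (J i) (A i)" "\<And>i \<omega>. i \<in> I \<Longrightarrow> \<omega> \<in> A i \<Longrightarrow> T \<subseteq> cl \<omega> (R' i)"
    "\<And>i. i \<in> I \<Longrightarrow> \<theta> i \<le> Pr (A i)"
    unfolding good_def by simp_all
  let ?A = "\<Union>i\<in>I. E i \<inter> A i" and ?J = "\<Union>i\<in>I. K i \<union> J i"
  have "finite ?J" using fin K A(1) by auto
  moreover have "?J \<subseteq> U - R" using K A(2) sub by fastforce
  moreover have "depends ?J ?A"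
    by (rule depends_Union, rule depends_Int) (use K A(3) in auto)
  moreover have "T \<subseteq> cl \<omega> R" if w: "\<omega> \<in> ?A" for \<omega>
  proof -
    obtain i where i: "i \<in> I" "\<omega> \<in> E i" "\<omega> \<in> A i" using w by blast
    show ?thesis using A(4)[OF i(1,3)] cl_trans[OF cl[OF i(1,2)]] by (rule order_trans)
  qed
  moreover have "(\<Sum>i\<in>I. Pr (E i) * \<theta> i) \<le> Pr ?A"
  proof -
    have "Pr ?A = (\<Sum>i\<in>I. Pr (E i \<inter> A i))"
    proof (rule finite_measure_finite_Union[OF fin])
      show "disjoint_family_on (\<lambda>i. E i \<inter> A i) I"
        unfolding disjoint_family_on_def
      proof (intro ballI impI)
        fix i j assume "i \<in> I" "j \<in> I" "i \<noteq> j"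
        then have "E i \<inter> E j = {}" using dis by (simp add: disjoint_family_on_def)
        then show "(E i \<inter> A i) \<inter> (E j \<inter> A j) = {}" by auto
      qed
      show "(\<lambda>i. E i \<inter> A i) ` I \<subseteq> sets (lbp_measure p)"
      proof (rule image_subsetI)
        fix i assume "i \<in> I"
        then show "E i \<inter> A i \<in> sets (lbp_measure p)"
          using depends_sets[of "K i" "E i"] depends_sets[of "J i" "A i"] K A(1,3) by (intro sets.Int) auto
      qed
    qed
    also have "\<dots> = (\<Sum>i\<in>I. Pr (E i) * Pr (A i))"
    proof (rule sum.cong[OF refl])
      fix i assume i: "i \<in> I"
      have "K i \<inter> J i = {}" using K[OF i] A(2)[OF i] by auto
      then show "Pr (E i \<inter> A i) = Pr (E i) * Pr (A i)"
        using K[OF i] A(1,3)[OF i] by (intro prob_indep[of "K i" "J i"]) auto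
    qed
    also have "\<dots> \<ge> (\<Sum>i\<in>I. Pr (E i) * \<theta> i)"
      using A(5) by (intro sum_mono mult_left_mono) auto
    finally show ?thesis .
  qed
  ultimately show ?thesis by (rule canI)
qed

lemma prob_two_columns:
  assumes "a \<noteq> a'"
  shows "Pr (- hit (vline a 0 b) \<inter> hit (vline a' 0 b)) = (1 - u b) * u b"
proof -
  have "vline a 0 b \<inter> vline a' 0 b = {}" using assms by (auto simp: vline_def)
  from prob_indep[OF vline_finite vline_finite this depends_Compl[OF depends_hit] depends_hit]
  show ?thesis by (simp add: prob_avoid prob_hit vline_finite vline_card)
qed

lemma can_two_columns:
  assumes ab: "1 \<le> a" and U: "quad (a + 2) b \<subseteq> U"
    and c1: "can (quad (a + 1) b) T U \<theta>1" and c2: "can (quad (a + 2) b) T U \<theta>2"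
  shows "can (quad a b) T U (u b * \<theta>1 + (1 - u b) * u b * \<theta>2)"
proof -
  let ?E1 = "hit (vline a 0 b)" and ?E2 = "- hit (vline a 0 b) \<inter> hit (vline (a + 1) 0 b)"
  let ?E = "\<lambda>i::nat. if i = 0 then ?E1 else ?E2"
  let ?K = "\<lambda>i::nat. if i = 0 then vline a 0 b else vline a 0 b \<union> vline (a + 1) 0 b"
  let ?R = "\<lambda>i::nat. if i = 0 then quad (a + 1) b else quad (a + 2) b"
  have g1: "quad (a + 1) b \<subseteq> cl \<omega> (quad a b)" if "\<omega> \<in> ?E1" for \<omega>
    by (rule quad_column1[OF _ _ that]) (use ab in \<open>auto intro: cl.base\<close>)
  have g2: "quad (a + 2) b \<subseteq> cl \<omega> (quad a b)" if "\<omega> \<in> ?E2" for \<omega>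
    by (rule quad_column2[where c = 0]) (use ab that in \<open>auto intro: cl.base\<close>)
  have "can (quad a b) T U (\<Sum>i\<in>{0, 1}. Pr (?E i) * (if i = 0 then \<theta>1 else \<theta>2))"
  proof (rule can_combine[where R' = ?R and K = ?K])
    fix i :: nat assume "i \<in> {0, 1}"
    moreover have "vline a 0 b \<union> vline (a + 1) 0 b \<subseteq> U"
      using U by (auto simp: quad_def vline_def)
    ultimately show "finite (?K i) \<and> ?K i \<subseteq> U \<inter> ?R i - quad a b \<and> depends (?K i) (?E i)"
      by (auto simp: vline_finite quad_def vline_def intro!: depends_hit depends_Int depends_Compl)
  qed (use g1 g2 c1 c2 quad_mono in \<open>auto simp: disjoint_family_on_def split: if_splits\<close>)
  then show ?thesis
    using prob_two_columns[of a "a + 1" b] by (simp add: prob_hit vline_finite vline_card)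
qed

text \<open>The two ways of \<open>can_two_columns\<close> reproduce the quadratic equation of
  \<open>bet\<close> exactly. The factor \<open>u b\<close> pays for a single remaining column,
  which has to be hit itself.\<close>

lemma can_columns:
  assumes "1 \<le> a" "1 \<le> b"
  shows "can (quad a b) (quad (a + K) b) (quad (a + K) b) (u b * bet (u b) ^ K)"
  using assms(1)
proof (induction K arbitrary: a rule: less_induct)
  case (less K)
  have ub: "0 \<le> u b" "u b \<le> 1" "0 < u b" using u_bounds assms(2) by auto
  have bt: "0 \<le> bet (u b)" "bet (u b) \<le> 1" "bet (u b) ^ 2 = u b * bet (u b) + u b * (1 - u b)"
    using bet_ge[of "u b"] bet_le_1[of "u b"] bet_square[of "u b"] ub by auto
  let ?E1 = "hit (vline a 0 b)"
  have g1: "quad (a + 1) b \<subseteq> cl \<omega> (quad a b)" if "\<omega> \<in> ?E1" for \<omega>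
    by (rule quad_column1[OF _ _ that]) (use less.prems in \<open>auto intro: cl.base\<close>)
  consider "K = 0" | "K = 1" | k where "K = Suc (Suc k)"
    by (metis One_nat_def not0_implies_Suc)
  then show ?case
  proof cases
    case 1
    then show ?thesis using ub by (intro can_trivial) auto
  next
    case 2
    have "can (quad a b) (quad (a + K) b) (quad (a + K) b) (\<Sum>i\<in>{0::nat}. Pr ?E1 * 1)"
      by (rule can_combine[where K = "\<lambda>_. vline a 0 b" and R' = "\<lambda>_. quad (a + 1) b"])
        (use 2 g1 in \<open>auto simp: vline_finite depends_hit disjoint_family_on_def quad_def vline_def intro!: can_trivial\<close>)
    then show ?thesis
      by (rule can_mono) (use 2 bt ub in \<open>simp add: prob_hit vline_finite vline_card mult_left_le\<close>)
  next
    case 3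
    have c1: "can (quad (a + 1) b) (quad (a + K) b) (quad (a + K) b) (u b * bet (u b) ^ Suc k)"
      using less.IH[of "Suc k" "a + 1"] 3 by simp
    have c2: "can (quad (a + 2) b) (quad (a + K) b) (quad (a + K) b) (u b * bet (u b) ^ k)"
      using less.IH[of k "a + 2"] 3 by simp
    have "can (quad a b) (quad (a + K) b) (quad (a + K) b)
        (u b * (u b * bet (u b) ^ Suc k) + (1 - u b) * u b * (u b * bet (u b) ^ k))"
      using less.prems 3 by (intro can_two_columns c1 c2 quad_mono) auto
    also have "u b * (u b * bet (u b) ^ Suc k) + (1 - u b) * u b * (u b * bet (u b) ^ k)
        = u b * bet (u b) ^ k * bet (u b) ^ 2"
      unfolding bt(3) by (simp add: algebra_simps)
    also have "\<dots> = u b * bet (u b) ^ K" using 3 by (simp add: power2_eq_square)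
    finally show ?thesis .
  qed
qed

text \<open>The width \<open>j\<close> is charged \<open>bet (u (j - 1))\<close> rather than \<open>bet (u j)\<close>, so that a step of one or two columns
  next to a side of length \<open>b \<ge> a\<close> only meets factors that are at most \<open>bet (u b)\<close>.\<close>

definition lowprod :: "nat \<Rightarrow> nat \<Rightarrow> real" where
  "lowprod N a = (\<Prod>j\<in>{a..N + 1}. bet (u (j - 1)))"

lemma bet_u: "j \<ge> 1 \<Longrightarrow> 0 < bet (u j)" "0 \<le> bet (u j)" "bet (u j) \<le> 1"
  using bet_pos[of "u j"] bet_ge[of "u j"] bet_le_1[of "u j"] u_bounds[of j] by auto

lemma bet_u_mono: "i \<le> j \<Longrightarrow> bet (u i) \<le> bet (u j)"
  using p_pos p_less_1 u_bounds by (intro bet_mono) (auto intro!: power_decreasing)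

lemma lowprod_Suc: "a \<le> N + 1 \<Longrightarrow> lowprod N a = bet (u (a - 1)) * lowprod N (Suc a)"
  unfolding lowprod_def by (subst prod.atLeast_Suc_atMost) auto

lemma lowprod_bounds: "0 \<le> lowprod N a" "lowprod N a \<le> 1"
  unfolding lowprod_def by (rule prod_nonneg prod_le_1; use bet_u in simp)+

lemma lowprod_split: "b + K \<le> N + 2 \<Longrightarrow> lowprod N b = (\<Prod>j\<in>{b..<b + K}. bet (u (j - 1))) * lowprod N (b + K)"
proof (induction K)
  case (Suc K)
  then show ?case using lowprod_Suc[of "b + K" N] by simp
qed simp

text \<open>With y = \<open>bet (u a)\<close>, the index shift gives the bound y^2 for the two
  factors of widths a + 1 and a. As y \<le> \<open>bet (u b)\<close> lies below the root for the
  longer side, y^2 is at most u b * y + u b * (1 - u b).\<close>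

lemma lowprod_step:
  assumes "2 \<le> a" "a \<le> b" "a \<le> N"
  shows "lowprod N a \<le> u b * lowprod N (a + 1) + (1 - u b) * u b * lowprod N (a + 2)"
proof -
  let ?x = "bet (u (a - 1))" and ?y = "bet (u a)"
  have "?x * ?y \<le> ?y * ?y" using bet_u_mono[of "a - 1" a] bet_u by (intro mult_right_mono) auto
  also have "\<dots> \<le> u b * ?y + u b * (1 - u b)"
  proof -
    have xy: "?y \<le> bet (u b)" "0 \<le> ?y" "u b \<le> bet (u b)"
      using bet_u_mono[OF assms(2)] bet_u bet_ge u_bounds by auto
    have "0 \<le> (bet (u b) - ?y) * (bet (u b) + ?y - u b)"
      using xy by (intro mult_nonneg_nonneg) auto
    then have "?y * ?y - u b * ?y \<le> bet (u b) ^ 2 - u b * bet (u b)"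
      by (simp add: algebra_simps power2_eq_square)
    then show ?thesis using bet_square[of "u b"] u_bounds[of b] by simp
  qed
  finally have "?x * ?y * lowprod N (a + 2) \<le> (u b * ?y + u b * (1 - u b)) * lowprod N (a + 2)"
    using lowprod_bounds by (intro mult_right_mono) auto
  moreover have "lowprod N a = ?x * ?y * lowprod N (a + 2)" "lowprod N (a + 1) = ?y * lowprod N (a + 2)"
    using lowprod_Suc[of a N] lowprod_Suc[of "Suc a" N] assms by auto
  ultimately show ?thesis by (simp only: algebra_simps)
qed

text \<open>The gain still to be collected: each unit by which the longer side grows between
  \<open>n0\<close> and \<open>n1\<close> is worth a factor exp \<epsilon>. Truncated subtraction
  makes it 1 beyond \<open>n1\<close>.\<close>

definition bonus :: "nat \<Rightarrow> nat \<Rightarrow> real \<Rightarrow> nat \<Rightarrow> real" where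
  "bonus n0 n1 \<epsilon> k = exp (\<epsilon> * real (n1 - max n0 k))"

definition lowval :: "nat \<Rightarrow> nat \<Rightarrow> nat \<Rightarrow> real \<Rightarrow> nat \<Rightarrow> nat \<Rightarrow> real" where
  "lowval N n0 n1 \<epsilon> a b = lowprod N a * lowprod N b * bonus n0 n1 \<epsilon> (max a b)"

abbreviation quadrant :: "site set" where "quadrant \<equiv> {0..} \<times> {0..}"

text \<open>The gain over the diagonal growth comes from a third event near the diagonal: both columns next
  to the rectangle are empty, but \<open>K\<close> rows grow within the width \<open>a\<close>, and then some site of the second
  column is occupied next to these rows.\<close>

lemma can_quad_step:
  assumes ab: "2 \<le> a" "a \<le> b" "a < N" "b \<le> N + 1" and N: "n1 + K \<le> N" and K: "2 \<le> K" and eps: "0 \<le> \<epsilon>"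
    and jump: "b \<le> a + 1 \<Longrightarrow> n0 \<le> b + 2 \<Longrightarrow> b < n1 \<Longrightarrow>
      1 \<le> exp (- 2 * \<epsilon>) + (1 - u b) ^ 2 * (u a * bet (u a) ^ K) * u K * exp (- \<epsilon> * real K)
          / (\<Prod>j\<in>{b..<b + K}. bet (u (j - 1)))"
    and IH: "\<And>a' b'. a + b < a' + b' \<Longrightarrow> 2 \<le> a' \<Longrightarrow> 2 \<le> b' \<Longrightarrow> a' \<le> N + 1 \<Longrightarrow> b' \<le> N + 1 \<Longrightarrow>
      can (quad a' b') (quad N N) quadrant (lowval N n0 n1 \<epsilon> a' b')"
  shows "can (quad a b) (quad N N) quadrant (lowval N n0 n1 \<epsilon> a b)"
proof -
  let ?V = "lowval N n0 n1 \<epsilon>"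
  let ?E1 = "hit (vline a 0 b)" and ?E2 = "- hit (vline a 0 b) \<inter> hit (vline (a + 1) 0 b)"
  have g1: "quad (a + 1) b \<subseteq> cl \<omega> (quad a b)" if "\<omega> \<in> ?E1" for \<omega>
    by (rule quad_column1[OF _ _ that]) (use ab in \<open>auto intro: cl.base\<close>)
  have g2: "quad (a + 2) b \<subseteq> cl \<omega> (quad a b)" if "\<omega> \<in> ?E2" for \<omega>
    by (rule quad_column2[where c = 0]) (use ab that in \<open>auto intro: cl.base\<close>)
  have c1: "can (quad (a + 1) b) (quad N N) quadrant (?V (a + 1) b)"
    and c2: "can (quad (a + 2) b) (quad N N) quadrant (?V (a + 2) b)"
    using IH[of "a + 1" b] IH[of "a + 2" b] ab by auto
  have P1: "Pr ?E1 = u b" and P2: "Pr ?E2 = (1 - u b) * u b"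
    using prob_two_columns[of a "a + 1" b] by (simp_all add: prob_hit vline_finite vline_card)
  have ub: "0 \<le> u b" "u b \<le> 1" using u_bounds by auto
  have low: "0 \<le> lowprod N x" for x using lowprod_bounds by simp
  let ?D = "\<lambda>k. bonus n0 n1 \<epsilon> k"
  have main: "u b * ?V (a + 1) b + (1 - u b) * u b * ?V (a + 2) b \<ge> t * (lowprod N a * lowprod N b * ?D (max a b))"
    if t: "0 \<le> t" "t * ?D (max a b) \<le> ?D (max (a + 1) b)" "t * ?D (max a b) \<le> ?D (max (a + 2) b)" for t
  proof -
    have "t * (lowprod N a * lowprod N b * ?D (max a b)) = (t * ?D (max a b) * lowprod N b) * lowprod N a"
      by simp
    also have "\<dots> \<le> (t * ?D (max a b) * lowprod N b) * (u b * lowprod N (a + 1) + (1 - u b) * u b * lowprod N (a + 2))"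
      using t low by (intro mult_left_mono lowprod_step mult_nonneg_nonneg) (use ab in \<open>auto simp: bonus_def\<close>)
    also have "\<dots> = u b * (lowprod N (a + 1) * lowprod N b * (t * ?D (max a b)))
        + (1 - u b) * u b * (lowprod N (a + 2) * lowprod N b * (t * ?D (max a b)))"
      by (simp add: algebra_simps)
    also have "\<dots> \<le> u b * ?V (a + 1) b + (1 - u b) * u b * ?V (a + 2) b"
      unfolding lowval_def using t ub low by (intro add_mono mult_left_mono) auto
    finally show ?thesis .
  qed
  show ?thesis
  proof (cases "b \<le> a + 1 \<and> n0 \<le> b + 2 \<and> b < n1")
    case False
    \<comment> \<open>In this case the bonus does not change: either a + 2 \<le> b and the longer
      side stays the same, or it stays below \<open>n0\<close>, or it has reached
      \<open>n1\<close>.\<close>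
    have "max n0 (max (a + 1) b) = max n0 (max a b) \<and> max n0 (max (a + 2) b) = max n0 (max a b)
        \<or> n1 \<le> max a b"
      using False ab by auto
    then have "1 * ?D (max a b) \<le> ?D (max (a + 1) b)" "1 * ?D (max a b) \<le> ?D (max (a + 2) b)"
      by (auto simp: bonus_def)
    then have "?V a b \<le> u b * ?V (a + 1) b + (1 - u b) * u b * ?V (a + 2) b"
      using main[of 1] by (simp add: lowval_def)
    moreover have "can (quad a b) (quad N N) quadrant (u b * ?V (a + 1) b + (1 - u b) * u b * ?V (a + 2) b)"
      by (rule can_two_columns[OF _ _ c1 c2]) (use ab in \<open>auto simp: quad_def\<close>)
    ultimately show ?thesis by (rule can_mono[rotated])
  next
    case True
    have "can (quad b a) (quad (b + K) a) (quad (b + K) a) (u a * bet (u a) ^ K)"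
      by (rule can_columns) (use ab in auto)
    from can_swap[OF this] have "can (quad a b) (quad a (b + K)) (quad a (b + K)) (u a * bet (u a) ^ K)"
      by (simp only: swap_quad)
    then obtain A J where A: "finite J" "J \<subseteq> quad a (b + K) - quad a b" "depends J A"
      "\<And>\<omega>. \<omega> \<in> A \<Longrightarrow> quad a (b + K) \<subseteq> cl \<omega> (quad a b)" "u a * bet (u a) ^ K \<le> Pr A"
      unfolding can_def by blast
    let ?C1 = "vline a 0 b" and ?C2 = "vline (a + 1) 0 b" and ?C3 = "vline (a + 1) b (b + K)"
    let ?E3 = "- hit ?C1 \<inter> (- hit ?C2 \<inter> (hit ?C3 \<inter> A))"
    let ?K3 = "?C1 \<union> (?C2 \<union> (?C3 \<union> J))"
    have d3: "depends ?K3 ?E3"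
      by (intro depends_Int depends_Compl depends_hit A(3))
    have P3: "Pr ?E3 = (1 - u b) * ((1 - u b) * (u K * Pr A))"
    proof -
      have "Pr (hit ?C3 \<inter> A) = u K * Pr A"
        by (subst prob_indep[OF vline_finite A(1) _ depends_hit A(3)])
          (use A(2) in \<open>auto simp: prob_hit vline_finite vline_card quad_def vline_def\<close>)
      moreover have "Pr (- hit ?C2 \<inter> (hit ?C3 \<inter> A)) = (1 - u b) * Pr (hit ?C3 \<inter> A)"
        by (subst prob_indep[OF vline_finite _ _ depends_Compl[OF depends_hit] depends_Int[OF depends_hit A(3)]])
          (use A(1,2) in \<open>auto simp: prob_avoid vline_finite vline_card quad_def vline_def\<close>)
      moreover have "Pr ?E3 = (1 - u b) * Pr (- hit ?C2 \<inter> (hit ?C3 \<inter> A))"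
        by (subst prob_indep[OF vline_finite _ _ depends_Compl[OF depends_hit]
              depends_Int[OF depends_Compl[OF depends_hit] depends_Int[OF depends_hit A(3)]]])
          (use A(1,2) in \<open>auto simp: prob_avoid vline_finite vline_card quad_def vline_def\<close>)
      ultimately show ?thesis by simp
    qed
    have g3: "quad (a + 2) (b + K) \<subseteq> cl \<omega> (quad a b)" if "\<omega> \<in> ?E3" for \<omega>
      by (rule quad_column2[where c = b]) (use ab that A(4) in auto)
    have c3: "can (quad (a + 2) (b + K)) (quad N N) quadrant (?V (a + 2) (b + K))"
      using IH[of "a + 2" "b + K"] ab True N by auto
    have J: "J \<subseteq> quadrant" "J \<subseteq> quad (a + 2) (b + K)" "J \<inter> quad a b = {}"
      using A(2) by (auto simp: quad_def)
    let ?E = "\<lambda>i::nat. if i = 0 then ?E1 else if i = 1 then ?E2 else ?E3"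
    let ?K = "\<lambda>i::nat. if i = 0 then ?C1 else if i = 1 then ?C1 \<union> ?C2 else ?K3"
    let ?R = "\<lambda>i::nat. if i = 0 then quad (a + 1) b else if i = 1 then quad (a + 2) b else quad (a + 2) (b + K)"
    let ?W = "\<lambda>i::nat. if i = 0 then ?V (a + 1) b else if i = 1 then ?V (a + 2) b else ?V (a + 2) (b + K)"
    have "can (quad a b) (quad N N) quadrant (\<Sum>i\<in>{0, 1, 2}. Pr (?E i) * ?W i)"
    proof (rule can_combine[where R' = ?R and K = ?K])
      fix i :: nat assume i: "i \<in> {0, 1, 2}"
      have "?C1 \<subseteq> quadrant \<inter> quad (a + 1) b - quad a b" "?C1 \<union> ?C2 \<subseteq> quadrant \<inter> quad (a + 2) b - quad a b"
        "?C1 \<union> (?C2 \<union> ?C3) \<subseteq> quadrant \<inter> quad (a + 2) (b + K) - quad a b"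
        by (auto simp: quad_def vline_def)
      then show "finite (?K i) \<and> ?K i \<subseteq> quadrant \<inter> ?R i - quad a b \<and> depends (?K i) (?E i)"
        using i d3 J A(1) vline_finite depends_hit[of ?C1] depends_Int[OF depends_Compl[OF depends_hit] depends_hit]
        by (elim insertE emptyE) auto
    next
      show "disjoint_family_on ?E {0, 1, 2}" unfolding disjoint_family_on_def by auto
    next
      fix i :: nat assume "i \<in> {0, 1, 2}"
      then show "quad a b \<subseteq> ?R i"
        using quad_mono[of a "a + 1" b b] quad_mono[of a "a + 2" b b] quad_mono[of a "a + 2" b "b + K"]
        by (elim insertE emptyE) simp_all
      show "can (?R i) (quad N N) quadrant (?W i)" using c1 c2 c3 by simp
      fix \<omega> assume "\<omega> \<in> ?E i"
      then show "?R i \<subseteq> cl \<omega> (quad a b)"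
        using g1[of \<omega>] g2[of \<omega>] g3[of \<omega>] by (auto split: if_splits)
    qed simp
    then have "can (quad a b) (quad N N) quadrant
        (u b * ?V (a + 1) b + (1 - u b) * u b * ?V (a + 2) b + Pr ?E3 * ?V (a + 2) (b + K))"
      using P1 P2 by (simp add: add.assoc)
    then show ?thesis
    proof (rule can_mono)
      \<comment> \<open>The two ordinary ways lengthen the longer side by at most 2 and so keep at
        least the share \<open>?t\<close> of the bonus; the jump must supply the rest. Dividing by
        \<open>?B\<close> refunds the K rows, which \<open>lowprod N b\<close> had charged.\<close>
      let ?t = "exp (- 2 * \<epsilon>)" and ?B = "\<Prod>j\<in>{b..<b + K}. bet (u (j - 1))"
      let ?L = "lowprod N a * lowprod N b * ?D (max a b)"
      have D: "exp (- \<epsilon> * real k) * ?D m \<le> ?D m'" if "m' \<le> m + k" for m m' k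
      proof -
        have "real (n1 - max n0 m) - real k \<le> real (n1 - max n0 m')" using that by linarith
        then have "\<epsilon> * (real (n1 - max n0 m) - real k) \<le> \<epsilon> * real (n1 - max n0 m')"
          using eps by (rule mult_left_mono)
        then show ?thesis unfolding bonus_def exp_add[symmetric] by (simp add: algebra_simps)
      qed
      have t: "?t = exp (- \<epsilon> * real 2)" by (simp add: mult.commute)
      have m1: "?t * ?L \<le> u b * ?V (a + 1) b + (1 - u b) * u b * ?V (a + 2) b"
        unfolding t by (rule main) (use D[of "max (a + 1) b" "max a b" 2] D[of "max (a + 2) b" "max a b" 2] ab in auto)
      have Bp: "0 < ?B" using ab bet_u by (intro prod_pos) auto
      define e3 where "e3 = (1 - u b) ^ 2 * (u a * bet (u a) ^ K) * u K"
      have e3: "0 \<le> e3" unfolding e3_def using u_bounds bet_u by simp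
      have Pe3: "e3 \<le> Pr ?E3"
      proof -
        have "e3 = (1 - u b) * ((1 - u b) * (u K * (u a * bet (u a) ^ K)))"
          by (simp add: e3_def power2_eq_square)
        also have "\<dots> \<le> Pr ?E3" unfolding P3
          using A(5) u_bounds[of b] u_bounds[of K] by (intro mult_left_mono) auto
        finally show ?thesis .
      qed
      have La: "lowprod N a \<le> lowprod N (a + 2)"
      proof -
        have "lowprod N a = bet (u (a - 1)) * bet (u a) * lowprod N (a + 2)"
          using lowprod_Suc[of a N] lowprod_Suc[of "Suc a" N] ab by simp
        also have "\<dots> \<le> 1 * lowprod N (a + 2)"
          using bet_u low by (intro mult_right_mono mult_le_one) auto
        finally show ?thesis by simp
      qed
      have Lb: "lowprod N b / ?B = lowprod N (b + K)"
      proof -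
        have "lowprod N b = ?B * lowprod N (b + K)"
          by (rule lowprod_split) (use True N in auto)
        then show ?thesis using Bp by (metis nonzero_mult_div_cancel_left less_irrefl)
      qed
      have "e3 * exp (- \<epsilon> * real K) / ?B * ?L
          = e3 * ((exp (- \<epsilon> * real K) * ?D (max a b)) * (lowprod N a * (lowprod N b / ?B)))"
        by simp
      also have "\<dots> \<le> e3 * (?D (max (a + 2) (b + K)) * (lowprod N (a + 2) * lowprod N (b + K)))"
        unfolding Lb using D[of "max (a + 2) (b + K)" "max a b" K] e3 La low ab K True
        by (intro mult_left_mono mult_mono) (auto simp: bonus_def)
      also have "\<dots> = e3 * ?V (a + 2) (b + K)"
        by (simp add: lowval_def)
      also have "\<dots> \<le> Pr ?E3 * ?V (a + 2) (b + K)"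
        using Pe3 low by (intro mult_right_mono) (auto simp: lowval_def bonus_def)
      finally have m2: "e3 * exp (- \<epsilon> * real K) / ?B * ?L \<le> Pr ?E3 * ?V (a + 2) (b + K)" .
      have "1 \<le> ?t + e3 * exp (- \<epsilon> * real K) / ?B"
        using jump True unfolding e3_def by blast
      then have "1 * ?L \<le> (?t + e3 * exp (- \<epsilon> * real K) / ?B) * ?L"
        using low by (intro mult_right_mono) (auto simp: bonus_def)
      also have "\<dots> = ?t * ?L + e3 * exp (- \<epsilon> * real K) / ?B * ?L" by (rule distrib_right)
      also have "\<dots> \<le> u b * ?V (a + 1) b + (1 - u b) * u b * ?V (a + 2) b + Pr ?E3 * ?V (a + 2) (b + K)"
        using m1 m2 by (rule add_mono)
      finally show "?V a b \<le> u b * ?V (a + 1) b + (1 - u b) * u b * ?V (a + 2) b + Pr ?E3 * ?V (a + 2) (b + K)"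
        by (simp add: lowval_def)
    qed
  qed
qed

lemma can_quad:
  assumes N: "n1 + K \<le> N" and K: "2 \<le> K" and eps: "0 \<le> \<epsilon>"
    and jump: "\<And>a b. a \<le> b \<Longrightarrow> b \<le> a + 1 \<Longrightarrow> n0 \<le> b + 2 \<Longrightarrow> b < n1 \<Longrightarrow>
      1 \<le> exp (- 2 * \<epsilon>) + (1 - u b) ^ 2 * (u a * bet (u a) ^ K) * u K * exp (- \<epsilon> * real K)
          / (\<Prod>j\<in>{b..<b + K}. bet (u (j - 1)))"
    and ab: "2 \<le> a" "2 \<le> b" "a \<le> N + 1" "b \<le> N + 1"
  shows "can (quad a b) (quad N N) quadrant (lowval N n0 n1 \<epsilon> a b)"
  using ab
proof (induction "2 * N + 2 - (a + b)" arbitrary: a b rule: less_induct)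
  case less
  note IH = less.hyps
  note ab = less.prems
  have IH': "can (quad a' b') (quad N N) quadrant (lowval N n0 n1 \<epsilon> a' b')"
    if "a + b < a' + b'" "2 \<le> a'" "2 \<le> b'" "a' \<le> N + 1" "b' \<le> N + 1" for a' b'
    by (rule IH) (use that in auto)
  consider "N \<le> a" "N \<le> b" | "a \<le> b" "a < N" | "b \<le> a" "b < N" by linarith
  then show ?case
  proof cases
    case 1
    have "lowval N n0 n1 \<epsilon> a b \<le> 1 * 1 * 1"
      unfolding lowval_def using lowprod_bounds 1 N by (intro mult_mono) (auto simp: bonus_def)
    then show ?thesis using quad_mono[OF 1] by (intro can_trivial) auto
  next
    case 2
    show ?thesis
      by (rule can_quad_step[OF _ _ _ _ N K eps]) (use 2 ab jump IH' in auto)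
  next
    case 3
    have "can (quad b a) (quad N N) quadrant (lowval N n0 n1 \<epsilon> b a)"
      by (rule can_quad_step[OF _ _ _ _ N K eps]) (use 3 ab jump IH' in auto)
    from can_swap[OF this] show ?thesis
      by (simp add: swap_quad product_swap lowval_def max.commute mult_ac)
  qed
qed

section \<open>Measurability, and the passage from a large square to the plane\<close>

lemma lbp_step_cong:
  assumes "\<And>y. l1dist x y \<le> 2 \<Longrightarrow> \<sigma> y = \<sigma>' y"
  shows "lbp_step \<sigma> x = lbp_step \<sigma>' x"
proof -
  have "\<sigma> x = \<sigma>' x" using assms[of x] by (simp add: l1dist_def)
  moreover have "{y. l1dist x y \<le> 1 \<and> \<sigma> y = Active} = {y. l1dist x y \<le> 1 \<and> \<sigma>' y = Active}"
    using assms by force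
  moreover have "l1dist x y \<le> 2 \<and> \<sigma> y = Active \<longleftrightarrow> l1dist x y \<le> 2 \<and> \<sigma>' y = Active" for y
    using assms[of y] by auto
  ultimately show ?thesis unfolding lbp_step_def by (simp only:)
qed

text \<open>Finite speed of propagation: the state of a site at a fixed time is decided by finitely
  many sites, which makes indefinite growth measurable.\<close>

lemma lbp_config_local:
  "\<exists>J. finite J \<and> (\<forall>\<omega> \<omega>'. (\<forall>y\<in>J. \<omega> y = \<omega>' y) \<longrightarrow> lbp_config \<omega> t x = lbp_config \<omega>' t x)"
proof (induction t arbitrary: x)
  case 0
  show ?case by (rule exI[of _ "{x}"]) (simp add: lbp_config_0 lbp_init_def)
next
  case (Suc t)
  then obtain J where J: "\<And>x. finite (J x)"
    "\<And>x \<omega> \<omega>'. (\<forall>y\<in>J x. \<omega> y = \<omega>' y) \<Longrightarrow> lbp_config \<omega> t x = lbp_config \<omega>' t x"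
    by metis
  let ?B = "{y. l1dist x y \<le> 2 \<and> True}"
  have "lbp_config \<omega> (Suc t) x = lbp_config \<omega>' (Suc t) x" if eq: "\<forall>y\<in>(\<Union>y\<in>?B. J y). \<omega> y = \<omega>' y" for \<omega> \<omega>'
    unfolding lbp_config_Suc
  proof (rule lbp_step_cong)
    fix y assume "l1dist x y \<le> 2"
    then show "lbp_config \<omega> t y = lbp_config \<omega>' t y" using eq by (intro J(2)) blast
  qed
  moreover have "finite (\<Union>y\<in>?B. J y)" by (intro finite_UN_I finite_l1_ball J(1))
  ultimately show ?case by blast
qed

lemma indefinite_growth_sets: "{\<omega>. indefinite_growth \<omega>} \<in> sets (lbp_measure p)"
proof -
  have "{\<omega>. lbp_config \<omega> t x = Active} \<in> sets (lbp_measure p)" for t x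
  proof -
    obtain J where J: "finite J" "\<And>\<omega> \<omega>'. (\<forall>y\<in>J. \<omega> y = \<omega>' y) \<Longrightarrow> lbp_config \<omega> t x = lbp_config \<omega>' t x"
      using lbp_config_local[of t x] by blast
    have "depends J {\<omega>. lbp_config \<omega> t x = Active}"
    proof (rule dependsI)
      fix \<omega> \<omega>' assume "\<And>y. y \<in> J \<Longrightarrow> \<omega> y = \<omega>' y" "\<omega> \<in> {\<omega>. lbp_config \<omega> t x = Active}"
      then show "\<omega>' \<in> {\<omega>. lbp_config \<omega> t x = Active}" using J(2)[of \<omega> \<omega>'] by simp
    qed
    then show ?thesis by (rule depends_sets[OF J(1)])
  qed
  moreover have "{\<omega>. indefinite_growth \<omega>} = (\<Inter>x. \<Union>t. {\<omega>. lbp_config \<omega> t x = Active})"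
    by (auto simp: indefinite_growth_def)
  moreover have "UNIV \<in> sets (lbp_measure p)"
    using sets.top[of "lbp_measure p"] by (simp only: space_lbp)
  ultimately show ?thesis
    by (simp only:) (intro sets.countable_INT'' sets.countable_UN; blast)
qed

lemma growth_prob_eq: "growth_prob p = Pr {\<omega>. indefinite_growth \<omega>}"
  by (simp add: growth_prob_def space_lbp)

text \<open>The origin and (1, 1) produce the initial 2 by 2 square at the price p^2. Once the
  square of side N is filled, the four families of segments fail with conditional probability at
  most 4 (1 - p)^N / p, which is at most 1 / 2 by the choice of N.\<close>

lemma growth_prob_ge:
  assumes can: "can (quad 2 2) (quad N N) quadrant \<theta>" and th: "0 \<le> \<theta>" and N: "1 \<le> N" "(1 - p) ^ N \<le> p / 8"
  shows "p ^ 2 * \<theta> / 2 \<le> growth_prob p"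
proof -
  obtain A J where A: "finite J" "J \<subseteq> quadrant - quad 2 2" "depends J A"
      "\<And>\<omega>. \<omega> \<in> A \<Longrightarrow> quad N N \<subseteq> cl \<omega> (quad 2 2)" "\<theta> \<le> Pr A"
    using can unfolding can_def by blast
  let ?o = "hit {(0, 0) :: site}" and ?d = "hit {(1, 1) :: site}"
  define X where "X = ?o \<inter> (?d \<inter> A)"
  have dX: "depends ({(0, 0)} \<union> ({(1, 1)} \<union> J)) X"
    unfolding X_def by (intro depends_Int depends_hit A(3))
  have J: "(0, 0) \<notin> J" "(1, 1) \<notin> J" using A(2) by (auto simp: quad_def)
  have "Pr (?d \<inter> A) = p * Pr A"
    by (subst prob_indep[OF _ A(1) _ depends_hit A(3)]) (use J prob_hit[of "{(1, 1)}"] in auto)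
  moreover have "Pr X = p * Pr (?d \<inter> A)"
    unfolding X_def by (subst prob_indep[OF _ _ _ depends_hit depends_Int[OF depends_hit A(3)]])
      (use J A(1) prob_hit[of "{(0, 0)}"] in auto)
  ultimately have PX: "Pr X = p ^ 2 * Pr A" by (simp add: power2_eq_square)
  have sX: "X \<in> sets (lbp_measure p)" by (rule depends_sets[OF _ dX]) (use A in auto)
  \<comment> \<open>The segments used after the square has been filled avoid the quadrant, hence are independent of \<open>X\<close>.\<close>
  define S :: "nat \<Rightarrow> nat \<Rightarrow> site set" where "S = (\<lambda>k i.
     if i = 0 then {- int k - 1} \<times> {- int k..<int N}
     else if i = 1 then {- int k - 1..<int N} \<times> {- int k - 1}
     else if i = 2 then {int (N + k)} \<times> {- int (N + k)..<0}
     else {- int (N + k)..<0} \<times> {int (N + k)})"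
  have Sf: "finite (S k i)" and Sc: "N + k \<le> card (S k i)" and Sq: "S k i \<inter> quadrant = {}" for k i
    by (auto simp: S_def card_cartesian_product)
  let ?Z = "\<lambda>k. \<Union>i<(4::nat). X \<inter> - hit (S k i)"
  have sZ: "?Z k \<in> sets (lbp_measure p)" for k
    using sX depends_sets[OF Sf depends_Compl[OF depends_hit]] by (intro sets.finite_UN) auto
  have PZ: "Pr (?Z k) \<le> 4 * Pr X * (1 - p) ^ N * (1 - p) ^ k" for k
  proof -
    have "Pr (?Z k) \<le> (\<Sum>i<(4::nat). Pr (X \<inter> - hit (S k i)))"
      using sX depends_sets[OF Sf depends_Compl[OF depends_hit]]
      by (intro finite_measure_subadditive_finite) auto
    also have "\<dots> \<le> (\<Sum>i<(4::nat). Pr X * (1 - p) ^ (N + k))"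
    proof (rule sum_mono)
      fix i :: nat
      have "Pr (X \<inter> - hit (S k i)) = Pr X * Pr (- hit (S k i))"
      proof (rule prob_indep[OF _ Sf _ dX depends_Compl[OF depends_hit]])
        have "{(0, 0)} \<union> ({(1, 1)} \<union> J) \<subseteq> quadrant" using A(2) by auto
        then show "({(0, 0)} \<union> ({(1, 1)} \<union> J)) \<inter> S k i = {}" using Sq by blast
      qed (use A in auto)
      also have "\<dots> \<le> Pr X * (1 - p) ^ (N + k)"
        unfolding prob_avoid[OF Sf] using Sc p_pos p_less_1
        by (intro mult_left_mono power_decreasing) auto
      finally show "Pr (X \<inter> - hit (S k i)) \<le> Pr X * (1 - p) ^ (N + k)" .
    qed
    finally show ?thesis by (simp add: power_add mult_ac)
  qed
  have geo: "(\<lambda>k. 4 * Pr X * (1 - p) ^ N * (1 - p) ^ k) sums (4 * Pr X * (1 - p) ^ N * (1 / (1 - (1 - p))))"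
    using p_pos p_less_1 by (intro sums_mult geometric_sums) auto
  have sm: "summable (\<lambda>k. Pr (?Z k))"
    by (rule summable_comparison_test'[OF sums_summable[OF geo], of 0]) (use PZ in auto)
  have "Pr (\<Union>k. ?Z k) \<le> (\<Sum>k. Pr (?Z k))"
    by (rule finite_measure_subadditive_countably) (use sZ sm in auto)
  also have "\<dots> \<le> 4 * Pr X * (1 - p) ^ N * (1 / (1 - (1 - p)))"
    unfolding sums_unique[OF geo] by (rule suminf_le[OF PZ sm sums_summable[OF geo]])
  also have "\<dots> = (4 * Pr X) * ((1 - p) ^ N / p)" by simp
  also have "\<dots> \<le> (4 * Pr X) * (1 / 8)"
    using N(2) p_pos by (intro mult_left_mono) (auto simp: field_simps)
  finally have bad: "Pr (\<Union>k. ?Z k) \<le> Pr X / 2" by simp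
  have "X - (\<Union>k. ?Z k) \<subseteq> {\<omega>. indefinite_growth \<omega>}"
  proof
    fix \<omega> assume w: "\<omega> \<in> X - (\<Union>k. ?Z k)"
    then have h: "\<omega> \<in> hit (S k i)" if "i < 4" for k i using that by blast
    have o: "\<omega> (0, 0)" "\<omega> (1, 1)" "\<omega> \<in> A" using w by (auto simp: X_def hit_def)
    have "quad 2 2 \<subseteq> cl \<omega> {(0, 0)}"
    proof -
      have 0: "(0, 0) \<in> cl \<omega> {(0, 0)}" by (rule cl.base) simp
      have 1: "(1, 1) \<in> cl \<omega> {(0, 0)}" by (rule cl.occ[OF o(2) 0]) (simp add: l1dist_def)
      have 2: "(0, 1) \<in> cl \<omega> {(0, 0)}" "(1, 0) \<in> cl \<omega> {(0, 0)}"
        by (rule cl.two[OF 0 1]; simp add: l1dist_def)+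
      have "quad 2 2 \<subseteq> {(0, 0), (0, 1), (1, 0), (1, 1)}" by (auto simp: quad_def)
      then show ?thesis using 0 1 2 by blast
    qed
    then have q: "quad N N \<subseteq> cl \<omega> {(0, 0)}" using A(4)[OF o(3)] cl_trans by blast
    have "cl \<omega> {(0, 0)} = UNIV"
    proof (rule fill_plane[OF q N(1)])
      fix k
      show "\<omega> \<in> hit ({- int k - 1} \<times> {- int k..<int N})" using h[of 0 k] by (simp add: S_def)
      show "\<omega> \<in> hit ({- int k - 1..<int N} \<times> {- int k - 1})" using h[of 1 k] by (simp add: S_def)
      show "\<omega> \<in> hit ({int (N + k)} \<times> {- int (N + k)..<0})" using h[of 2 k] by (simp add: S_def)
      show "\<omega> \<in> hit ({- int (N + k)..<0} \<times> {int (N + k)})" using h[of 3 k] by (simp add: S_def)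
    qed
    then show "\<omega> \<in> {\<omega>. indefinite_growth \<omega>}" using indefinite_growthI[of \<omega>] o by blast
  qed
  then have "Pr (X - (\<Union>k. ?Z k)) \<le> growth_prob p"
    unfolding growth_prob_eq by (rule finite_measure_mono[OF _ indefinite_growth_sets])
  moreover have "Pr (X - (\<Union>k. ?Z k)) = Pr X - Pr (\<Union>k. ?Z k)"
  proof (rule finite_measure_Diff[OF sX])
    show "(\<Union>k. ?Z k) \<in> sets (lbp_measure p)" using sZ by (intro sets.countable_UN) blast
  qed blast
  ultimately have "Pr X / 2 \<le> growth_prob p" using bad by simp
  moreover have "p ^ 2 * \<theta> / 2 \<le> Pr X / 2" using A(5) by (simp add: PX mult_left_mono)
  ultimately show ?thesis by simp
qed

section \<open>Choice of the constants for the lower bound\<close>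

definition z :: real where "z = - ln (1 - p)"

lemma z_ge: "p \<le> z"
  using ln_le_minus_one[of "1 - p"] p_less_1 by (simp add: z_def)

lemma z_pos: "0 < z"
  using z_ge p_pos by simp

lemma z_le: "z \<le> p / (1 - p)"
proof -
  have "z = ln (1 / (1 - p))" using p_less_1 by (simp add: z_def ln_div)
  also have "\<dots> \<le> 1 / (1 - p) - 1" using p_less_1 by (intro ln_le_minus_one) simp
  also have "\<dots> = p / (1 - p)" using p_less_1 by (simp add: field_simps)
  finally show ?thesis .
qed

lemma exp_z: "exp (- (real n * z)) = (1 - p) ^ n"
  using p_less_1 by (simp add: z_def exp_of_nat_mult)

lemma bet_u_exp: "n \<ge> 1 \<Longrightarrow> bet (u n) = exp (- cost (real n * z))"
  using exp_neg_cost[of "real n * z"] z_pos by (simp add: exp_z)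

lemma lowprod_2_ge: "exp (- (pi ^ 2 / 18) / p) \<le> lowprod N 2"
proof -
  have "lowprod N 2 = (\<Prod>j\<in>{1..N}. bet (u j))"
    unfolding lowprod_def
    by (rule prod.reindex_bij_witness[of _ Suc "\<lambda>j. j - 1"]) auto
  also have "\<dots> = (\<Prod>j\<in>{1..N}. exp (- cost (real j * z)))"
    by (intro prod.cong refl bet_u_exp) auto
  also have "\<dots> = exp (- (\<Sum>j=1..N. cost (real j * z)))"
    by (simp add: exp_sum sum_negf[symmetric])
  finally have 1: "lowprod N 2 = exp (- (\<Sum>j=1..N. cost (real j * z)))" .
  have "(\<Sum>j=1..N. cost (real j * z)) \<le> (pi ^ 2 / 18) / z"
    using cost_sum_le[OF z_pos, of N] z_pos by (simp add: field_simps)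
  also have "\<dots> \<le> (pi ^ 2 / 18) / p"
    using z_ge p_pos by (intro divide_left_mono) auto
  finally show ?thesis unfolding 1 by simp
qed

text \<open>The exponent \<open>cost\<close> has Lipschitz constant 1 beyond the fixed point, and a
  \<ge> 1 / p puts a z there.\<close>

lemma bet_u_shift:
  assumes "1 / p \<le> real a"
  shows "bet (u (a + i)) \<le> bet (u a) * exp (real i * z)"
proof -
  have a: "1 \<le> a" using assms p_pos by (cases a) auto
  have "x0 \<le> real a * z"
  proof -
    have "1 \<le> real a * p" using assms p_pos by (simp add: field_simps)
    also have "\<dots> \<le> real a * z" using z_ge by (intro mult_left_mono) auto
    finally show ?thesis using x0_le_1 by simp
  qed
  then have "cost (real a * z) - cost (real (a + i) * z) \<le> real (a + i) * z - real a * z"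
    using z_pos by (intro cost_Lipschitz) auto
  then show ?thesis
    using a by (simp add: bet_u_exp algebra_simps flip: exp_add)
qed

lemma growth_prob_lower:
  assumes small: "p \<le> 1 / 16" and c1: "c1 = exp (- 20) / 4"
  shows "p ^ 2 / 2 * exp (- 2 * (pi ^ 2 / 18) / p) * exp (c1 / (8 * sqrt p)) \<le> growth_prob p"
proof -
  define r where "r = sqrt p"
  have r: "0 < r" "r ^ 2 = p" "r \<le> 1 / 4"
    using p_pos small real_sqrt_le_mono[OF small] by (auto simp: r_def real_sqrt_divide)
  \<comment> \<open>This K keeps K^2 z \<le> 8, so that K neighbouring rows have the same price up
    to a constant, while \<open>u K\<close> is at least sqrt p / 2.\<close>
  define K where "K = nat \<lceil>1 / r\<rceil>"
  \<comment> \<open>The summand 3 makes up for the slack in n0 \<le> b + 2 and b \<le> a + 1, so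
    that a \<ge> 1 / p throughout the window. The upper end \<open>n1\<close> keeps b z bounded, so
    that two empty columns have probability bounded away from 0.\<close>
  define n0 where "n0 = nat \<lceil>1 / p\<rceil> + 3"
  define n1 where "n1 = 2 * n0"
  define \<epsilon> where "\<epsilon> = c1 * r / 8"
  have "exp (- 20) \<le> (1 :: real)" by simp
  then have c1b: "0 < c1" "c1 \<le> 1" unfolding c1 by (simp, linarith)
  have K: "1 / r \<le> real K" "real K \<le> 2 / r" "2 \<le> K"
  proof -
    have 4: "4 \<le> 1 / r" using r by (simp add: field_simps)
    show k: "1 / r \<le> real K" unfolding K_def by linarith
    have "real K \<le> 1 / r + 1" unfolding K_def using 4 by linarith
    also have "\<dots> \<le> 2 / r" using 4 by simp
    finally show "real K \<le> 2 / r" .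
    show "2 \<le> K" using k 4 by linarith
  qed
  have n0: "1 / p \<le> real n0 - 3" unfolding n0_def by linarith
  have n1: "real n1 \<le> 3 / p"
  proof -
    have 16: "16 \<le> 1 / p" using small p_pos by (simp add: field_simps)
    then have "real n0 \<le> 1 / p + 4" unfolding n0_def by linarith
    with 16 have "real n1 \<le> 3 * (1 / p)" unfolding n1_def by simp
    then show ?thesis by simp
  qed
  have z2: "z \<le> 2 * p"
  proof -
    have "z \<le> p / (1 - p)" by (rule z_le)
    also have "\<dots> \<le> p / (1 / 2)" using small p_pos by (intro divide_left_mono) auto
    finally show ?thesis by simp
  qed
  have eps: "0 \<le> \<epsilon>" using c1b r by (simp add: \<epsilon>_def)
  have jump: "1 \<le> exp (- 2 * \<epsilon>) + (1 - u b) ^ 2 * (u a * bet (u a) ^ K) * u K * exp (- \<epsilon> * real K)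
          / (\<Prod>j\<in>{b..<b + K}. bet (u (j - 1)))"
    if ab: "a \<le> b" "b \<le> a + 1" "n0 \<le> b + 2" "b < n1" for a b
  proof -
    let ?B = "\<Prod>j\<in>{b..<b + K}. bet (u (j - 1))"
    have a: "1 / p \<le> real a" using n0 ab by linarith
    then have a1: "1 \<le> a" using p_pos by (cases a) auto
    have "16 \<le> 1 / p" using small p_pos by (simp add: field_simps)
    then have b2: "2 \<le> b" using a ab by linarith
    have Bp: "0 < ?B" using b2 bet_u by (intro prod_pos) auto
    have ap: "0 < bet (u a)" using bet_u(1)[OF a1] .
    have "?B \<le> (\<Prod>j\<in>{b..<b + K}. bet (u a) * exp (real K * z))"
    proof (rule prod_mono)
      fix j assume j: "j \<in> {b..<b + K}"
      have "bet (u (j - 1)) \<le> bet (u (a + (j - b)))"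
        using j ab by (intro bet_u_mono) auto
      also have "\<dots> \<le> bet (u a) * exp (real (j - b) * z)" by (rule bet_u_shift[OF a])
      also have "\<dots> \<le> bet (u a) * exp (real K * z)"
        using j ap z_pos by (intro mult_left_mono) (auto intro!: mult_right_mono)
      finally show "0 \<le> bet (u (j - 1)) \<and> bet (u (j - 1)) \<le> bet (u a) * exp (real K * z)"
        using bet_u by simp
    qed
    also have "\<dots> = bet (u a) ^ K * exp (real K * (real K * z))"
      by (simp add: power_mult_distrib exp_of_nat_mult)
    also have "\<dots> \<le> bet (u a) ^ K * exp 8"
    proof (rule mult_left_mono)
      have "real K * (real K * z) \<le> (2 / r) * ((2 / r) * (2 * p))"
        using K z2 z_pos r p_pos by (intro mult_mono) auto
      also have "\<dots> = 8" using r by (simp add: power2_eq_square flip: r(2))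
      finally show "exp (real K * (real K * z)) \<le> exp 8" by simp
    qed (use ap in simp)
    finally have B: "exp (- 8) * ?B \<le> bet (u a) ^ K"
      by (simp add: exp_minus field_simps)
    have ub: "exp (- 12) \<le> (1 - u b) ^ 2"
    proof -
      have "real b * z \<le> (3 / p) * (2 * p)"
        using n1 ab z2 z_pos p_pos by (intro mult_mono) auto
      then have "real b * z \<le> 6" using p_pos by simp
      then have "exp (- 6) \<le> exp (- (real b * z))" by simp
      then have "exp (- 6) \<le> 1 - u b" unfolding exp_z by simp
      then have "exp (- 6) ^ 2 \<le> (1 - u b) ^ 2" by (rule power_mono) simp
      then show ?thesis by (simp flip: exp_of_nat_mult)
    qed
    have ua: "1 / 2 \<le> u a"
    proof -
      have "1 \<le> real a * p" using a p_pos by (simp add: field_simps)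
      also have "\<dots> \<le> real a * z" using z_ge by (intro mult_left_mono) auto
      finally have "(1 - p) ^ a \<le> exp (- 1)" unfolding exp_z[symmetric] by simp
      also have "exp (- 1) \<le> (1 / 2 :: real)" using exp_ge_add_one_self[of "1::real"] by (simp add: exp_minus field_simps)
      finally show ?thesis by simp
    qed
    have uK: "r / 2 \<le> u K"
    proof -
      have "r = (1 / r) * r ^ 2" by (simp add: power2_eq_square)
      also have "\<dots> \<le> real K * z" using K z_ge r p_pos by (intro mult_mono) auto
      finally have "(1 - p) ^ K \<le> exp (- r)" unfolding exp_z[symmetric] by simp
      also have "\<dots> \<le> 1 / (1 + r)" using exp_ge_add_one_self[of r] r by (simp add: exp_minus field_simps)
      also have "\<dots> \<le> 1 - r / 2" using r by (simp add: field_simps)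
      finally show ?thesis by simp
    qed
    have eK: "1 / 2 \<le> exp (- \<epsilon> * real K)"
    proof -
      have "\<epsilon> * real K \<le> (c1 * r / 8) * (2 / r)"
        unfolding \<epsilon>_def using K c1b r by (intro mult_left_mono) auto
      then have "\<epsilon> * real K \<le> 1 / 2" using r c1b by simp
      then show ?thesis using exp_ge_add_one_self[of "- \<epsilon> * real K"] by simp
    qed
    have "c1 * r / 4 \<le> c1 * r / 2" using c1b r by simp
    \<comment> \<open>The constant collects exp (- 12) for two empty columns, exp (- 8) for
      comparing the rows, and a factor 1 / 2 each from \<open>u a\<close>, \<open>u K\<close> and
      the bonus. The result c1 r / 2 is twice what is needed to offset 2 \<epsilon>.\<close>
    also have "c1 * r / 2 = (exp (- 12) * exp (- 8)) * r / 8"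
      by (simp add: c1 flip: exp_add)
    also have "\<dots> = exp (- 12) * (1 / 2 * exp (- 8)) * (r / 2) * (1 / 2)" by simp
    also have "\<dots> \<le> (1 - u b) ^ 2 * (u a * (bet (u a) ^ K / ?B)) * u K * exp (- \<epsilon> * real K)"
    proof (intro mult_mono ub ua uK eK)
      show "exp (- 8) \<le> bet (u a) ^ K / ?B" using B Bp by (simp add: field_simps)
    qed (use r ap Bp u_bounds[of a] u_bounds[of K] in auto)
    also have "\<dots> = (1 - u b) ^ 2 * (u a * bet (u a) ^ K) * u K * exp (- \<epsilon> * real K) / ?B" by simp
    finally have "c1 * r / 4 \<le> (1 - u b) ^ 2 * (u a * bet (u a) ^ K) * u K * exp (- \<epsilon> * real K) / ?B" .
    moreover have "1 - c1 * r / 4 \<le> exp (- 2 * \<epsilon>)"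
      using exp_ge_add_one_self[of "- 2 * \<epsilon>"] by (simp add: \<epsilon>_def)
    ultimately show ?thesis by linarith
  qed
  obtain N0 where N0: "(1 - p) ^ N0 < p / 8"
    using real_arch_pow_inv[of "p / 8" "1 - p"] p_pos by auto
  define N where "N = max N0 (n1 + K)"
  have N: "n1 + K \<le> N" "1 \<le> N" using K by (auto simp: N_def)
  have "(1 - p) ^ N \<le> (1 - p) ^ N0"
    using p_pos p_less_1 by (intro power_decreasing) (auto simp: N_def)
  then have N': "(1 - p) ^ N \<le> p / 8" using N0 by simp
  define \<theta> where "\<theta> = lowval N n0 n1 \<epsilon> 2 2"
  have "can (quad 2 2) (quad N N) quadrant \<theta>"
    unfolding \<theta>_def by (rule can_quad[OF N(1) K(3) eps jump]) (use N K in auto)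
  moreover have th: "exp (- 2 * (pi ^ 2 / 18) / p) * exp (c1 / (8 * sqrt p)) \<le> \<theta>"
  proof -
    have "exp (- (pi ^ 2 / 18) / p) * exp (- (pi ^ 2 / 18) / p) * exp (\<epsilon> * real (n1 - max n0 (max 2 2))) \<le> \<theta>"
      unfolding \<theta>_def lowval_def bonus_def using lowprod_2_ge lowprod_bounds
      by (intro mult_mono) auto
    moreover have "exp (- (pi ^ 2 / 18) / p) * exp (- (pi ^ 2 / 18) / p) = exp (- 2 * (pi ^ 2 / 18) / p)"
      by (simp flip: exp_add)
    moreover have "exp (c1 / (8 * sqrt p)) \<le> exp (\<epsilon> * real (n1 - max n0 (max 2 2)))"
    proof -
      have "c1 / (8 * sqrt p) = (c1 * r / 8) * (1 / p)"
        using r by (simp add: power2_eq_square flip: r(2) r_def)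
      also have "\<dots> \<le> (c1 * r / 8) * real n0"
        using n0 c1b r by (intro mult_left_mono) auto
      also have "\<dots> = \<epsilon> * real (n1 - max n0 (max 2 2))"
        by (simp add: \<epsilon>_def n1_def n0_def)
      finally show ?thesis by simp
    qed
    ultimately show ?thesis by (smt (verit) exp_ge_zero mult_left_mono)
  qed
  moreover have "0 \<le> \<theta>" using th by (smt (verit) exp_ge_zero mult_nonneg_nonneg)
  ultimately have "p ^ 2 * \<theta> / 2 \<le> growth_prob p" using growth_prob_ge N N' by blast
  moreover have "p ^ 2 / 2 * (exp (- 2 * (pi ^ 2 / 18) / p) * exp (c1 / (8 * sqrt p))) \<le> p ^ 2 / 2 * \<theta>"
    using th by (intro mult_left_mono) auto
  ultimately show ?thesis by (simp add: mult.assoc)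
qed

end

lemma eventually_growth_prob_lower:
  "\<forall>\<^sub>F p in at_right 0. exp ((- 2 * (pi ^ 2 / 18) + exp (- 20) / 64 * sqrt p) / p) \<le> growth_prob p"
proof -
  \<comment> \<open>The gain is exp (exp (- 20) / (32 sqrt p)). Half of its exponent pays for the
    prefactor p^2 / 2, the other half survives.\<close>
  have "\<forall>\<^sub>F p::real in at_right 0. 1 \<le> p ^ 2 / 2 * exp (exp (- 20) / 64 / sqrt p)"
    by real_asymp
  moreover have "\<forall>\<^sub>F p::real in at_right 0. 0 < p \<and> p < 1 / 16"
    by (simp add: eventually_at_right_less eventually_conj_iff) real_asymp
  ultimately show ?thesis
  proof eventually_elim
    case (elim p)
    interpret bernoulli_sites p by unfold_locales (use elim in auto)
    have sq: "sqrt p * sqrt p = p" using elim by simp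
    have "exp ((- 2 * (pi ^ 2 / 18) + exp (- 20) / 64 * sqrt p) / p)
        = exp (- 2 * (pi ^ 2 / 18) / p) * exp (exp (- 20) / 64 / sqrt p) * 1"
    proof -
      have "sqrt p / p = 1 / sqrt p" using sq elim by (simp add: field_simps)
      moreover have "(A + B * sqrt p) / p = A / p + B * (sqrt p / p)" for A B :: real
        by (simp add: add_divide_distrib)
      ultimately have "(A + B * sqrt p) / p = A / p + B / sqrt p" for A B :: real
        by simp
      from this[of "- 2 * (pi ^ 2 / 18)" "exp (- 20) / 64"]
      have "(- 2 * (pi ^ 2 / 18) + exp (- 20) / 64 * sqrt p) / p
          = - 2 * (pi ^ 2 / 18) / p + exp (- 20) / 64 / sqrt p" .
      then show ?thesis by (simp only: exp_add mult_1_right)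
    qed
    also have "\<dots> \<le> exp (- 2 * (pi ^ 2 / 18) / p) * exp (exp (- 20) / 64 / sqrt p)
        * (p ^ 2 / 2 * exp (exp (- 20) / 64 / sqrt p))"
      by (rule mult_left_mono[OF elim(1)]) simp
    also have "\<dots> = p ^ 2 / 2 * exp (- 2 * (pi ^ 2 / 18) / p)
        * (exp (exp (- 20) / 64 / sqrt p) * exp (exp (- 20) / 64 / sqrt p))"
      by (simp only: mult_ac)
    also have "exp (exp (- 20) / 64 / sqrt p) * exp (exp (- 20) / 64 / sqrt p) = exp ((exp (- 20) / 4) / (8 * sqrt p))"
      by (simp flip: exp_add)
    also have "p ^ 2 / 2 * exp (- 2 * (pi ^ 2 / 18) / p) * exp ((exp (- 20) / 4) / (8 * sqrt p)) \<le> growth_prob p"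
      by (rule growth_prob_lower) (use elim in auto)
    finally show ?case .
  qed
qed

section \<open>The upper bound\<close>

fun wid :: "rect \<Rightarrow> nat" where
  "wid (x1, x2, y1, y2) = nat (x2 - x1 + 1)"

fun hei :: "rect \<Rightarrow> nat" where
  "hei (x1, x2, y1, y2) = nat (y2 - y1 + 1)"

fun ext :: "rect \<Rightarrow> nat \<times> nat \<times> nat \<times> nat \<Rightarrow> rect" where
  "ext (x1, x2, y1, y2) (i, j, k, l) = (x1 - int i, x2 + int j, y1 - int k, y2 + int l)"

lemma grow_ext:
  assumes "grow \<omega> r r'" "rbox r \<noteq> {}"
  shows "wid r' \<le> wid r + 2" "hei r' \<le> hei r + 2"
proof -
  obtain x1 x2 y1 y2 where r: "r = (x1, x2, y1, y2)" by (cases r)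
  have v: "x1 \<le> x2" "y1 \<le> y2" using assms(2) by (auto simp: r)
  obtain s y where "y \<in> rbox r" "l1dist s y \<le> 2" "r' = bhull r s"
    using assms(1) unfolding grow_def by blast
  then show "wid r' \<le> wid r + 2" "hei r' \<le> hei r + 2"
    using v by (cases s; cases y; auto simp: r l1dist_def min_def max_def)+
qed

lemma rbox_subset_ext:
  assumes "rbox r \<subseteq> rbox r'" "rbox r \<noteq> {}"
  obtains i j k l where "r' = ext r (i, j, k, l)" "wid r' = wid r + (i + j)" "hei r' = hei r + (k + l)"
proof -
  obtain x1 x2 y1 y2 where r: "r = (x1, x2, y1, y2)" by (cases r)
  obtain x1' x2' y1' y2' where r': "r' = (x1', x2', y1', y2')" by (cases r')
  have v: "x1 \<le> x2" "y1 \<le> y2" using assms(2) by (auto simp: r)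
  then have "(x1, y1) \<in> rbox r'" "(x2, y2) \<in> rbox r'" using assms(1) by (auto simp: r)
  then have b: "x1' \<le> x1" "x2 \<le> x2'" "y1' \<le> y1" "y2 \<le> y2'" by (auto simp: r')
  show ?thesis
    by (rule that[of "nat (x1 - x1')" "nat (x2' - x2)" "nat (y1 - y1')" "nat (y2' - y2)"])
      (use b v in \<open>auto simp: r r'\<close>)
qed

lemma wid_ext: "rbox r \<noteq> {} \<Longrightarrow> wid (ext r (i, j, k, l)) = wid r + (i + j)"
  and hei_ext: "rbox r \<noteq> {} \<Longrightarrow> hei (ext r (i, j, k, l)) = hei r + (k + l)"
  and rbox_ext: "rbox r \<subseteq> rbox (ext r (i, j, k, l))"
  by (cases r; auto)+

lemma wid_pos: "rbox r \<noteq> {} \<Longrightarrow> 1 \<le> wid r" and hei_pos: "rbox r \<noteq> {} \<Longrightarrow> 1 \<le> hei r"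
  by (cases r; auto)+

text \<open>Lines beyond the side at \<open>a\<close> are numbered from 0, in accordance with
  \<open>nogap\<close>. Left and lower sides are read with negated coordinates.\<close>

definition side_hits :: "(site \<Rightarrow> int) \<Rightarrow> int \<Rightarrow> site set \<Rightarrow> nat set" where
  "side_hits \<pi> a S = {t. \<exists>s\<in>S. \<pi> s = a + 1 + int t}"

text \<open>A site projects to a single line, which lies beyond at most one of two opposite sides.
  So each corner site gives at most one free line per direction.\<close>

lemma side_hits_card:
  assumes "finite S" "b \<le> a"
  shows "card (side_hits (\<lambda>s. - \<pi> s) (- b) S \<inter> A) + card (side_hits \<pi> a S \<inter> B) \<le> card S"
proof -
  let ?L = "(\<lambda>t. b - 1 - int t) ` (side_hits (\<lambda>s. - \<pi> s) (- b) S \<inter> A)"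
  let ?R = "(\<lambda>t. a + 1 + int t) ` (side_hits \<pi> a S \<inter> B)"
  have L: "?L \<subseteq> \<pi> ` S \<inter> {..<b}" and R: "?R \<subseteq> \<pi> ` S \<inter> {a<..}"
    unfolding side_hits_def by force+
  have fL: "finite ?L" and fR: "finite ?R"
    using L R assms(1) by (meson finite_Int finite_imageI finite_subset)+
  have "card (side_hits (\<lambda>s. - \<pi> s) (- b) S \<inter> A) + card (side_hits \<pi> a S \<inter> B) = card ?L + card ?R"
    by (simp add: card_image inj_on_def)
  also have "\<dots> = card (?L \<union> ?R)"
    by (rule card_Un_disjoint[symmetric, OF fL fR]) (use L R assms(2) in force)
  also have "\<dots> \<le> card (\<pi> ` S)" using L R assms(1) by (intro card_mono) auto
  also have "\<dots> \<le> card S" using assms(1) by (rule card_image_le)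
  finally show ?thesis .
qed

fun lft :: "rect \<Rightarrow> nat \<Rightarrow> site set" where
  "lft (x1, x2, y1, y2) t = {x1 - 1 - int t} \<times> {y1..y2}"

fun rgt :: "rect \<Rightarrow> nat \<Rightarrow> site set" where
  "rgt (x1, x2, y1, y2) t = {x2 + 1 + int t} \<times> {y1..y2}"

fun dwn :: "rect \<Rightarrow> nat \<Rightarrow> site set" where
  "dwn (x1, x2, y1, y2) t = {x1..x2} \<times> {y1 - 1 - int t}"

fun upp :: "rect \<Rightarrow> nat \<Rightarrow> site set" where
  "upp (x1, x2, y1, y2) t = {x1..x2} \<times> {y2 + 1 + int t}"

fun corners :: "rect \<Rightarrow> nat \<times> nat \<times> nat \<times> nat \<Rightarrow> site set" where
  "corners (x1, x2, y1, y2) (i, j, k, l) =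
     ({x1 - int i..x1 - 1} \<union> {x2 + 1..x2 + int j}) \<times> ({y1 - int k..y1 - 1} \<union> {y2 + 1..y2 + int l})"

lemma corners_finite: "finite (corners r e)"
  by (cases r; cases e) auto

lemma corners_card:
  assumes "rbox r \<noteq> {}"
  shows "card (corners r (i, j, k, l)) = (i + j) * (k + l)"
proof -
  obtain x1 x2 y1 y2 where r: "r = (x1, x2, y1, y2)" by (cases r)
  have v: "x1 \<le> x2" "y1 \<le> y2" using assms by (auto simp: r)
  have "card ({x1 - int i..x1 - 1} \<union> {x2 + 1..x2 + int j}) = i + j"
    using v by (subst card_Un_disjoint) auto
  moreover have "card ({y1 - int k..y1 - 1} \<union> {y2 + 1..y2 + int l}) = k + l"
    using v by (subst card_Un_disjoint) auto
  ultimately show ?thesis by (simp add: r card_cartesian_product)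
qed

context bernoulli_sites
begin

text \<open>Given the set \<open>S\<close> of occupied sites in the corners, growth from \<open>r\<close> to \<open>ext r e\<close> forces the four
  families of lines, restricted to the sides of \<open>r\<close>, to have no gaps apart from the lines that meet \<open>S\<close>.\<close>

fun crossS :: "rect \<Rightarrow> nat \<times> nat \<times> nat \<times> nat \<Rightarrow> site set \<Rightarrow> (site \<Rightarrow> bool) set" where
  "crossS (x1, x2, y1, y2) (i, j, k, l) S =
     cylinder (corners (x1, x2, y1, y2) (i, j, k, l)) S
     \<inter> (nogap (lft (x1, x2, y1, y2)) i (side_hits (\<lambda>s. - fst s) (- x1) S)
     \<inter> (nogap (rgt (x1, x2, y1, y2)) j (side_hits fst x2 S)
     \<inter> (nogap (dwn (x1, x2, y1, y2)) k (side_hits (\<lambda>s. - snd s) (- y1) S)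
     \<inter> nogap (upp (x1, x2, y1, y2)) l (side_hits snd y2 S))))"

definition cross :: "rect \<Rightarrow> nat \<times> nat \<times> nat \<times> nat \<Rightarrow> (site \<Rightarrow> bool) set" where
  "cross r e = (\<Union>S\<in>Pow (corners r e). crossS r e S)"

text \<open>An occupied site on a new line either faces the side of the old rectangle or is a corner
  site, in which case its line counts as free.\<close>

lemma nogap_side:
  assumes gap: "\<And>x. e0 < x \<Longrightarrow> x < e0 + int l \<Longrightarrow> \<exists>s\<in>B. \<omega> s \<and> (\<pi> s = x \<or> \<pi> s = x + 1)"
    and cover: "\<And>s t. s \<in> B \<Longrightarrow> t < l \<Longrightarrow> \<pi> s = e0 + 1 + int t \<Longrightarrow> s \<in> X t \<or> s \<in> C"
  shows "\<omega> \<in> nogap X l (side_hits \<pi> e0 {s \<in> C. \<omega> s})"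
  unfolding nogap_def
proof (intro CollectI allI impI)
  fix t assume t: "Suc t < l"
  obtain s where s: "s \<in> B" "\<omega> s" "\<pi> s = e0 + 1 + int t \<or> \<pi> s = e0 + 1 + int (Suc t)"
    using gap[of "e0 + 1 + int t"] t by auto
  then obtain t' where t': "t' = t \<or> t' = Suc t" "\<pi> s = e0 + 1 + int t'" by blast
  have "s \<in> X t' \<or> s \<in> C" using cover[OF s(1) _ t'(2)] t' t by auto
  then have "t' \<in> side_hits \<pi> e0 {s \<in> C. \<omega> s} \<or> \<omega> \<in> hit (X t')"
    using s(2) t'(2) unfolding side_hits_def hit_def by blast
  then show "t \<in> side_hits \<pi> e0 {s \<in> C. \<omega> s} \<or> Suc t \<in> side_hits \<pi> e0 {s \<in> C. \<omega> s}
      \<or> \<omega> \<in> hit (X t) \<or> \<omega> \<in> hit (X (Suc t))"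
    using t'(1) by blast
qed

lemma grows_cross:
  assumes "grows \<omega> r (ext r (i, j, k, l))" "rbox r \<noteq> {}"
  shows "\<omega> \<in> cross r (i, j, k, l)"
proof -
  obtain x1 x2 y1 y2 where r: "r = (x1, x2, y1, y2)" by (cases r)
  let ?r' = "ext r (i, j, k, l)" and ?C = "corners r (i, j, k, l)"
  let ?S = "{s \<in> ?C. \<omega> s}"
  have xL: "\<exists>s\<in>rbox ?r'. \<omega> s \<and> (- fst s = x \<or> - fst s = x + 1)" if "- x1 < x" "x < - x1 + int i" for x
    using grows_side[OF assms, of "\<lambda>(a, b, c, d). - a" "\<lambda>s. - fst s"] that
    by (force simp: r l1dist_def)
  have xR: "\<exists>s\<in>rbox ?r'. \<omega> s \<and> (fst s = x \<or> fst s = x + 1)" if "x2 < x" "x < x2 + int j" for x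
    using grows_side[OF assms, of "\<lambda>(a, b, c, d). b" "\<lambda>s. fst s"] that
    by (force simp: r l1dist_def)
  have xD: "\<exists>s\<in>rbox ?r'. \<omega> s \<and> (- snd s = x \<or> - snd s = x + 1)" if "- y1 < x" "x < - y1 + int k" for x
    using grows_side[OF assms, of "\<lambda>(a, b, c, d). - c" "\<lambda>s. - snd s"] that
    by (force simp: r l1dist_def)
  have xU: "\<exists>s\<in>rbox ?r'. \<omega> s \<and> (snd s = x \<or> snd s = x + 1)" if "y2 < x" "x < y2 + int l" for x
    using grows_side[OF assms, of "\<lambda>(a, b, c, d). d" "\<lambda>s. snd s"] that
    by (force simp: r l1dist_def)
  have "\<omega> \<in> cylinder ?C ?S" by (auto simp: cylinder_def)
  moreover have "\<omega> \<in> nogap (lft r) i (side_hits (\<lambda>s. - fst s) (- x1) ?S)"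
    by (rule nogap_side[OF xL]) (auto simp: r)
  moreover have "\<omega> \<in> nogap (rgt r) j (side_hits fst x2 ?S)"
    by (rule nogap_side[OF xR]) (auto simp: r)
  moreover have "\<omega> \<in> nogap (dwn r) k (side_hits (\<lambda>s. - snd s) (- y1) ?S)"
    by (rule nogap_side[OF xD]) (auto simp: r)
  moreover have "\<omega> \<in> nogap (upp r) l (side_hits snd y2 ?S)"
    by (rule nogap_side[OF xU]) (auto simp: r)
  ultimately have "\<omega> \<in> crossS r (i, j, k, l) ?S" by (simp add: r)
  moreover have "?S \<in> Pow ?C" by auto
  ultimately show ?thesis unfolding cross_def by blast
qed

lemma crossS_depends:
  assumes "rbox r \<noteq> {}"
  shows "depends (rbox (ext r e) - rbox r) (crossS r e S)"
proof -
  obtain x1 x2 y1 y2 where r: "r = (x1, x2, y1, y2)" by (cases r)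
  have v: "x1 \<le> x2" "y1 \<le> y2" using assms by (auto simp: r)
  obtain i j k l where e: "e = (i, j, k, l)" by (cases e)
  have "depends (corners r e \<union> ((\<Union>t<i. lft r t) \<union> ((\<Union>t<j. rgt r t) \<union> ((\<Union>t<k. dwn r t) \<union> (\<Union>t<l. upp r t)))))
      (crossS r e S)"
    unfolding r e crossS.simps by (intro depends_Int depends_cylinder depends_nogap)
  then show ?thesis by (rule depends_mono) (use v in \<open>auto simp: r e\<close>)
qed

lemma cross_depends:
  assumes "rbox r \<noteq> {}"
  shows "depends (rbox (ext r e) - rbox r) (cross r e)"
proof -
  have "depends (\<Union>S\<in>Pow (corners r e). rbox (ext r e) - rbox r) (cross r e)"
    unfolding cross_def by (rule depends_Union) (rule crossS_depends[OF assms])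
  then show ?thesis by (rule depends_mono) auto
qed

text \<open>Opposite sides share at most n free lines, so the exponents 2 c + 1 and 2 c' + 1 add up
  to at most 2 (n + 1); with v \<le> a^2 this is n + 1 factors v.\<close>

lemma nogap_pair:
  fixes a v P P' :: real
  assumes a: "0 < a" "a \<le> 1" "0 \<le> v" "v \<le> a ^ 2" and P: "0 \<le> P" "0 \<le> P'"
    and "P * a ^ (2 * c + 1) \<le> a ^ i" "P' * a ^ (2 * c' + 1) \<le> a ^ j" and c: "c + c' \<le> n"
  shows "P * P' * v ^ (n + 1) \<le> a ^ (i + j)"
proof -
  have "v ^ (n + 1) \<le> (a ^ 2) ^ (n + 1)" using a by (intro power_mono) auto
  also have "\<dots> = a ^ (2 * (n + 1))" by (rule power_mult[symmetric])
  also have "\<dots> \<le> a ^ ((2 * c + 1) + (2 * c' + 1))" using a c by (intro power_decreasing) auto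
  finally have "P * P' * v ^ (n + 1) \<le> P * P' * a ^ ((2 * c + 1) + (2 * c' + 1))"
    using P by (intro mult_left_mono) auto
  also have "\<dots> = (P * a ^ (2 * c + 1)) * (P' * a ^ (2 * c' + 1))" by (simp add: power_add mult_ac)
  also have "\<dots> \<le> a ^ i * a ^ j" using assms by (intro mult_mono) auto
  finally show ?thesis by (simp add: power_add)
qed

lemma prob_crossS:
  assumes v: "rbox r \<noteq> {}" and S: "S \<subseteq> corners r (i, j, k, l)"
  shows "Pr (crossS r (i, j, k, l) S) * (u (hei r) * u (wid r)) ^ (card S + 1)
      \<le> p ^ card S * (bet (u (hei r)) ^ (i + j) * bet (u (wid r)) ^ (k + l))"
proof -
  obtain x1 x2 y1 y2 where r: "r = (x1, x2, y1, y2)" by (cases r)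
  have v': "x1 \<le> x2" "y1 \<le> y2" using v by (auto simp: r)
  let ?C = "corners r (i, j, k, l)" and ?n = "hei r" and ?m = "wid r"
  let ?TL = "side_hits (\<lambda>s. - fst s) (- x1) S" and ?TR = "side_hits fst x2 S"
  let ?TD = "side_hits (\<lambda>s. - snd s) (- y1) S" and ?TU = "side_hits snd y2 S"
  let ?L = "nogap (lft r) i ?TL" and ?R = "nogap (rgt r) j ?TR"
  let ?D = "nogap (dwn r) k ?TD" and ?U = "nogap (upp r) l ?TU"
  have nm: "1 \<le> ?n" "1 \<le> ?m" using v' by (auto simp: r)
  have fS: "finite S" using S corners_finite finite_subset by blast
  have fL: "finite (\<Union>t<i. lft r t)" and fR: "finite (\<Union>t<j. rgt r t)"
    and fD: "finite (\<Union>t<k. dwn r t)" and fU: "finite (\<Union>t<l. upp r t)"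
    by (auto simp: r)
  have PL: "Pr ?L * bet (u ?n) ^ (2 * card (?TL \<inter> {..<i}) + 1) \<le> bet (u ?n) ^ i"
    by (rule prob_nogap) (use nm in \<open>auto simp: r card_cartesian_product\<close>)
  have PR: "Pr ?R * bet (u ?n) ^ (2 * card (?TR \<inter> {..<j}) + 1) \<le> bet (u ?n) ^ j"
    by (rule prob_nogap) (use nm in \<open>auto simp: r card_cartesian_product\<close>)
  have PD: "Pr ?D * bet (u ?m) ^ (2 * card (?TD \<inter> {..<k}) + 1) \<le> bet (u ?m) ^ k"
    by (rule prob_nogap) (use nm in \<open>auto simp: r card_cartesian_product\<close>)
  have PU: "Pr ?U * bet (u ?m) ^ (2 * card (?TU \<inter> {..<l}) + 1) \<le> bet (u ?m) ^ l"
    by (rule prob_nogap) (use nm in \<open>auto simp: r card_cartesian_product\<close>)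
  have LR: "Pr ?L * Pr ?R * u ?n ^ (card S + 1) \<le> bet (u ?n) ^ (i + j)"
    by (rule nogap_pair[OF _ _ _ _ _ _ PL PR])
      (use bet_u nm u_bounds bet_square_ge side_hits_card[OF fS v'(1)] in auto)
  have DU: "Pr ?D * Pr ?U * u ?m ^ (card S + 1) \<le> bet (u ?m) ^ (k + l)"
    by (rule nogap_pair[OF _ _ _ _ _ _ PD PU])
      (use bet_u nm u_bounds bet_square_ge side_hits_card[OF fS v'(2)] in auto)
  have i1: "Pr (?D \<inter> ?U) = Pr ?D * Pr ?U"
    by (rule prob_indep[OF fD fU _ depends_nogap depends_nogap]) (use v' in \<open>auto simp: r\<close>)
  have i2: "Pr (?R \<inter> (?D \<inter> ?U)) = Pr ?R * Pr (?D \<inter> ?U)"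
    by (rule prob_indep[OF fR finite_UnI[OF fD fU] _ depends_nogap depends_Int[OF depends_nogap depends_nogap]])
      (use v' in \<open>auto simp: r\<close>)
  have i3: "Pr (?L \<inter> (?R \<inter> (?D \<inter> ?U))) = Pr ?L * Pr (?R \<inter> (?D \<inter> ?U))"
    by (rule prob_indep[OF fL finite_UnI[OF fR finite_UnI[OF fD fU]] _ depends_nogap
          depends_Int[OF depends_nogap depends_Int[OF depends_nogap depends_nogap]]])
      (use v' in \<open>auto simp: r\<close>)
  have i4: "Pr (cylinder ?C S \<inter> (?L \<inter> (?R \<inter> (?D \<inter> ?U)))) = Pr (cylinder ?C S) * Pr (?L \<inter> (?R \<inter> (?D \<inter> ?U)))"
    by (rule prob_indep[OF corners_finite finite_UnI[OF fL finite_UnI[OF fR finite_UnI[OF fD fU]]] _ depends_cylinder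
          depends_Int[OF depends_nogap depends_Int[OF depends_nogap depends_Int[OF depends_nogap depends_nogap]]]])
      (use v' in \<open>auto simp: r\<close>)
  have "crossS r (i, j, k, l) S = cylinder ?C S \<inter> (?L \<inter> (?R \<inter> (?D \<inter> ?U)))"
    by (simp add: r)
  then have P: "Pr (crossS r (i, j, k, l) S) = Pr (cylinder ?C S) * (Pr ?L * Pr ?R * (Pr ?D * Pr ?U))"
    by (simp only: i1 i2 i3 i4 mult.assoc)
  have "Pr (cylinder ?C S) = p ^ card S * (1 - p) ^ card (?C - S)"
    by (rule prob_cylinder[OF corners_finite S])
  also have "\<dots> \<le> p ^ card S * 1"
    using p_pos p_less_1 by (intro mult_left_mono power_le_one) auto
  finally have cyl: "Pr (cylinder ?C S) \<le> p ^ card S" by simp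
  have "Pr (crossS r (i, j, k, l) S) * (u ?n * u ?m) ^ (card S + 1)
      = Pr (cylinder ?C S) * ((Pr ?L * Pr ?R * u ?n ^ (card S + 1)) * (Pr ?D * Pr ?U * u ?m ^ (card S + 1)))"
    unfolding P power_mult_distrib by (simp only: mult_ac)
  also have "\<dots> \<le> p ^ card S * (bet (u ?n) ^ (i + j) * bet (u ?m) ^ (k + l))"
    using cyl LR DU u_bounds bet_u p_pos by (intro mult_mono mult_nonneg_nonneg zero_le_power) auto
  finally show ?thesis .
qed

lemma sum_Pow_power:
  fixes x :: real
  assumes "finite C"
  shows "(\<Sum>S\<in>Pow C. x ^ card S) = (1 + x) ^ card C"
  using prod_add[OF assms, of "\<lambda>_. x" "\<lambda>_. 1"] by (simp add: add.commute)

text \<open>Let w = \<open>u (hei r) * u (wid r)\<close>. Each occupied corner site has weight p and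
  saves at most a factor 1 / w. Summing over all subsets of the corners gives, by the binomial
  theorem, 1 + p / w to the number of corner sites.\<close>

lemma prob_cross:
  assumes v: "rbox r \<noteq> {}"
  shows "Pr (cross r (i, j, k, l)) \<le> bet (u (hei r)) ^ (i + j) * bet (u (wid r)) ^ (k + l) / (u (hei r) * u (wid r))
      * exp (real ((i + j) * (k + l)) * (p / (u (hei r) * u (wid r))))"
proof -
  let ?C = "corners r (i, j, k, l)"
  define w where "w = u (hei r) * u (wid r)"
  define Q where "Q = bet (u (hei r)) ^ (i + j) * bet (u (wid r)) ^ (k + l)"
  have w: "0 < w" unfolding w_def using u_bounds wid_pos[OF v] hei_pos[OF v] by simp
  have Q: "0 \<le> Q" unfolding Q_def using bet_u by simp
  have "Pr (cross r (i, j, k, l)) \<le> (\<Sum>S\<in>Pow ?C. Pr (crossS r (i, j, k, l) S))"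
    unfolding cross_def
  proof (rule finite_measure_subadditive_finite)
    have "finite (rbox (ext r (i, j, k, l)) - rbox r)" by (cases r) auto
    then show "crossS r (i, j, k, l) ` Pow ?C \<subseteq> sets (lbp_measure p)"
      using depends_sets crossS_depends[OF v] by blast
  qed (simp add: corners_finite)
  also have "\<dots> \<le> (\<Sum>S\<in>Pow ?C. Q / w * (p / w) ^ card S)"
  proof (rule sum_mono)
    fix S assume "S \<in> Pow ?C"
    then have "Pr (crossS r (i, j, k, l) S) * w ^ (card S + 1) \<le> p ^ card S * Q"
      using prob_crossS[OF v, of S i j k l] unfolding w_def Q_def by simp
    then have "Pr (crossS r (i, j, k, l) S) \<le> p ^ card S * Q / w ^ (card S + 1)"
      using w by (simp add: pos_le_divide_eq)
    then show "Pr (crossS r (i, j, k, l) S) \<le> Q / w * (p / w) ^ card S"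
      by (simp add: power_divide mult_ac)
  qed
  also have "\<dots> = Q / w * (1 + p / w) ^ ((i + j) * (k + l))"
    by (simp only: sum_distrib_left[symmetric] sum_Pow_power[OF corners_finite] corners_card[OF v])
  also have "\<dots> \<le> Q / w * exp (p / w) ^ ((i + j) * (k + l))"
    using w Q p_pos exp_ge_add_one_self[of "p / w"] by (intro mult_left_mono power_mono) auto
  also have "\<dots> = Q / w * exp (real ((i + j) * (k + l)) * (p / w))"
    by (simp only: exp_of_nat_mult)
  finally show ?thesis unfolding w_def Q_def .
qed

section \<open>Union bound along a chain of rectangles\<close>

definition reach :: "nat \<Rightarrow> rect \<Rightarrow> (site \<Rightarrow> bool) set" where
  "reach M r = {\<omega>. \<exists>r'. grows \<omega> r r' \<and> M \<le> max (wid r') (hei r')}"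

text \<open>The enclosing event \<open>A\<close> depends on finitely many sites off \<open>r\<close> only, so it is measurable and
  independent of what happened while \<open>r\<close> was filled.\<close>

definition bounded_reach :: "nat \<Rightarrow> rect \<Rightarrow> real \<Rightarrow> bool" where
  "bounded_reach M r \<beta> \<longleftrightarrow>
     (\<exists>A J. finite J \<and> J \<inter> rbox r = {} \<and> depends J A \<and> reach M r \<subseteq> A \<and> Pr A \<le> \<beta>)"

lemma bounded_reach_step:
  assumes F: "finite F"
    and cover: "\<And>\<omega>. \<omega> \<in> reach M r \<Longrightarrow> \<exists>e\<in>F. grows \<omega> r (ext r e) \<and> \<omega> \<in> reach M (ext r e)"
    and IH: "\<And>e. e \<in> F \<Longrightarrow> bounded_reach M (ext r e) (\<beta> e)"
    and v: "rbox r \<noteq> {}"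
    and \<gamma>: "(\<Sum>e\<in>F. Pr (cross r e) * \<beta> e) \<le> \<gamma>"
  shows "bounded_reach M r \<gamma>"
proof -
  define good where "good = (\<lambda>e A J. finite J \<and> J \<inter> rbox (ext r e) = {} \<and> depends J A
    \<and> reach M (ext r e) \<subseteq> A \<and> Pr A \<le> \<beta> e)"
  have "\<forall>e\<in>F. \<exists>AJ. good e (fst AJ) (snd AJ)"
  proof
    fix e assume "e \<in> F"
    from IH[OF this] have "\<exists>A J. good e A J" unfolding bounded_reach_def good_def .
    then show "\<exists>AJ. good e (fst AJ) (snd AJ)" by auto
  qed
  from bchoice[OF this] obtain AJ where AJ: "\<forall>e\<in>F. good e (fst (AJ e)) (snd (AJ e))" ..
  define A J where "A = (\<lambda>e. fst (AJ e))" and "J = (\<lambda>e. snd (AJ e))"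
  have "good e (A e) (J e)" if "e \<in> F" for e
    using AJ that by (simp add: A_def J_def)
  then have A: "\<And>e. e \<in> F \<Longrightarrow> finite (J e)" "\<And>e. e \<in> F \<Longrightarrow> J e \<inter> rbox (ext r e) = {}"
    "\<And>e. e \<in> F \<Longrightarrow> depends (J e) (A e)" "\<And>e. e \<in> F \<Longrightarrow> reach M (ext r e) \<subseteq> A e"
    "\<And>e. e \<in> F \<Longrightarrow> Pr (A e) \<le> \<beta> e"
    unfolding good_def by simp_all
  define K where "K = (\<lambda>e. rbox (ext r e) - rbox r)"
  have fK: "finite (K e)" for e by (cases r; cases e) (auto simp: K_def)
  have dK: "depends (K e) (cross r e)" for e unfolding K_def by (rule cross_depends[OF v])
  have ext: "rbox r \<subseteq> rbox (ext r e)" for e by (cases e) (auto dest: rbox_ext[THEN subsetD])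
  let ?A = "\<Union>e\<in>F. cross r e \<inter> A e" and ?J = "\<Union>e\<in>F. K e \<union> J e"
  have sets: "cross r e \<inter> A e \<in> sets (lbp_measure p)" if "e \<in> F" for e
    using depends_sets[OF fK dK] depends_sets[OF A(1,3)] that by (intro sets.Int) auto
  have "finite ?J" using F fK A(1) by auto
  moreover have "?J \<inter> rbox r = {}"
    using A(2) ext unfolding K_def by blast
  moreover have "depends ?J ?A"
    by (rule depends_Union, rule depends_Int) (use dK A(3) in auto)
  moreover have "reach M r \<subseteq> ?A"
  proof
    fix \<omega> assume "\<omega> \<in> reach M r"
    then obtain e where e: "e \<in> F" "grows \<omega> r (ext r e)" "\<omega> \<in> reach M (ext r e)" using cover by blast
    then have "\<omega> \<in> cross r e" using grows_cross v by (cases e) auto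
    then show "\<omega> \<in> ?A" using e A(4) by blast
  qed
  moreover have "Pr ?A \<le> \<gamma>"
  proof -
    have "Pr ?A \<le> (\<Sum>e\<in>F. Pr (cross r e \<inter> A e))"
      using sets by (intro finite_measure_subadditive_finite F) auto
    also have "\<dots> = (\<Sum>e\<in>F. Pr (cross r e) * Pr (A e))"
    proof (rule sum.cong[OF refl])
      fix e assume e: "e \<in> F"
      have "K e \<inter> J e = {}" using A(2)[OF e] unfolding K_def by blast
      then show "Pr (cross r e \<inter> A e) = Pr (cross r e) * Pr (A e)"
        by (rule prob_indep[OF fK A(1)[OF e] _ dK A(3)[OF e]])
    qed
    also have "\<dots> \<le> (\<Sum>e\<in>F. Pr (cross r e) * \<beta> e)"
      using A(5) by (intro sum_mono mult_left_mono) auto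
    finally show ?thesis using \<gamma> by simp
  qed
  ultimately show ?thesis unfolding bounded_reach_def
    by (intro exI[of _ ?A] exI[of _ ?J] conjI)
qed

text \<open>The induction runs over the first rectangle whose width or height has grown by a factor \<open>1 + \<delta>\<close>: the
  corners are then negligible, and the number of steps is small enough to afford a union bound.\<close>

lemma bounded_reach_induct:
  fixes B :: "nat \<Rightarrow> nat \<Rightarrow> real" and \<delta> :: real and L M0 :: nat
  assumes \<delta>: "0 < \<delta>" "\<delta> \<le> 1 / 4" and L: "4 \<le> L"
    and base: "\<And>m n. L \<le> max m n \<Longrightarrow> m \<le> 2 * L \<Longrightarrow> n \<le> 2 * L \<Longrightarrow> 1 \<le> m \<Longrightarrow> 1 \<le> n \<Longrightarrow> 1 \<le> B m n"
    and step: "\<And>m n s t. 1 \<le> m \<Longrightarrow> 1 \<le> n \<Longrightarrow> m < L \<Longrightarrow> n < L \<Longrightarrow> M0 \<le> max m n \<Longrightarrow>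
      real s \<le> \<delta> * m + 2 \<Longrightarrow> real t \<le> \<delta> * n + 2 \<Longrightarrow> \<delta> * m \<le> real s \<or> \<delta> * n \<le> real t \<Longrightarrow>
      real (L + 1) ^ 4 * (bet (u n) ^ s * bet (u m) ^ t / (u n * u m) * exp (real (s * t) * (p / (u n * u m)))
        * B (m + s) (n + t)) \<le> B m n"
    and nonneg: "\<And>m n. 0 \<le> B m n"
    and r: "rbox r \<noteq> {}" "M0 \<le> max (wid r) (hei r)" "wid r \<le> 2 * L" "hei r \<le> 2 * L"
  shows "bounded_reach (2 * L) r (B (wid r) (hei r))"
  using r
proof (induction "4 * L - (wid r + hei r)" arbitrary: r rule: less_induct)
  case less
  note IH = less.hyps and r = less.prems
  define m n where "m = wid r" and "n = hei r"
  have mn: "1 \<le> m" "1 \<le> n" using wid_pos hei_pos r by (auto simp: m_def n_def)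
  show ?case
  proof (cases "L \<le> max m n")
    case True
    then have "1 \<le> B m n" using base mn r by (auto simp: m_def n_def)
    then show ?thesis unfolding bounded_reach_def
      by (intro exI[of _ UNIV] exI[of _ "{}"])
        (use depends_UNIV prob_space space_lbp in \<open>auto simp: m_def n_def\<close>)
  next
    case False
    then have mL: "m < L" "n < L" by auto
    \<comment> \<open>\<open>P\<close> marks the first rectangle to be observed. One growth step
      adds at most 2 to a side, so the increments overshoot the threshold by at most 2. All four
      displacements are then at most L, whence the count (L + 1)^4.\<close>
    define P where "P = (\<lambda>r'. real m + \<delta> * m \<le> real (wid r') \<or> real n + \<delta> * n \<le> real (hei r'))"
    define ok where "ok = (\<lambda>(i::nat, j::nat, k::nat, l::nat). real (i + j) \<le> \<delta> * m + 2 \<and> real (k + l) \<le> \<delta> * n + 2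
       \<and> (\<delta> * m \<le> real (i + j) \<or> \<delta> * n \<le> real (k + l)))"
    define F where "F = {e \<in> {..L} \<times> {..L} \<times> {..L} \<times> {..L}. ok e}"
    have small: "\<delta> * real a + 2 \<le> real L" if "a < L" for a
    proof -
      have "\<delta> * real a \<le> 1 / 4 * real L" using that \<delta> by (intro mult_mono) auto
      then show ?thesis using L by linarith
    qed
    have dm: "0 < \<delta> * real m" "0 < \<delta> * real n" using \<delta> mn by auto
    have cardF: "real (card F) \<le> real (L + 1) ^ 4"
    proof -
      have "card F \<le> card ({..L} \<times> {..L} \<times> {..L} \<times> {..L})"
        unfolding F_def by (intro card_mono) auto
      also have "\<dots> = (L + 1) ^ 4" by (simp add: card_cartesian_product eval_nat_numeral algebra_simps)
      finally show ?thesis by (metis of_nat_le_iff of_nat_power)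
    qed
    have le_B: "real (L + 1) ^ 4 * (Pr (cross r e) * B (wid (ext r e)) (hei (ext r e))) \<le> B m n"
      if e: "e \<in> F" for e
    proof -
      obtain i j k l where ijkl: "e = (i, j, k, l)" by (cases e)
      have o: "real (i + j) \<le> \<delta> * m + 2" "real (k + l) \<le> \<delta> * n + 2" "\<delta> * m \<le> real (i + j) \<or> \<delta> * n \<le> real (k + l)"
        using e by (auto simp: F_def ok_def ijkl)
      have "Pr (cross r e) * B (wid (ext r e)) (hei (ext r e))
          \<le> bet (u n) ^ (i + j) * bet (u m) ^ (k + l) / (u n * u m)
            * exp (real ((i + j) * (k + l)) * (p / (u n * u m))) * B (m + (i + j)) (n + (k + l))"
        unfolding ijkl wid_ext[OF r(1)] hei_ext[OF r(1)] m_def n_def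
        by (rule mult_right_mono[OF prob_cross[OF r(1)] nonneg])
      then have "real (L + 1) ^ 4 * (Pr (cross r e) * B (wid (ext r e)) (hei (ext r e)))
          \<le> real (L + 1) ^ 4 * (bet (u n) ^ (i + j) * bet (u m) ^ (k + l) / (u n * u m)
            * exp (real ((i + j) * (k + l)) * (p / (u n * u m))) * B (m + (i + j)) (n + (k + l)))"
        by (intro mult_left_mono) auto
      also have "\<dots> \<le> B m n"
        by (rule step) (use mn mL o r in \<open>auto simp: m_def n_def\<close>)
      finally show ?thesis .
    qed
    show ?thesis
    proof (rule bounded_reach_step)
      show "finite F" unfolding F_def by auto
      show "rbox r \<noteq> {}" by (rule r)
      fix \<omega> assume "\<omega> \<in> reach (2 * L) r"
      then obtain r' where r': "grows \<omega> r r'" "2 * L \<le> max (wid r') (hei r')"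
        by (auto simp: reach_def)
      have "P r'"
      proof -
        have "real m + \<delta> * m \<le> 2 * real L" "real n + \<delta> * n \<le> 2 * real L"
          using small[OF mL(1)] small[OF mL(2)] mL by auto
        moreover have "2 * real L \<le> real (wid r') \<or> 2 * real L \<le> real (hei r')"
          using r'(2) by (auto simp: le_max_iff_disj)
        ultimately show ?thesis unfolding P_def by linarith
      qed
      moreover have "\<not> P r" using dm by (simp add: P_def m_def n_def)
      ultimately obtain r1 r2 where r12: "grows \<omega> r r1" "\<not> P r1" "grow \<omega> r1 r2" "P r2" "grows \<omega> r2 r'"
        using grows_first[OF r'(1), of P] by blast
      have r2: "grows \<omega> r r2" using r12 by simp
      have ne1: "rbox r1 \<noteq> {}" using grows_rbox[OF r12(1)] r by auto
      obtain i j k l where e: "r2 = ext r (i, j, k, l)" "wid r2 = wid r + (i + j)" "hei r2 = hei r + (k + l)"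
        using rbox_subset_ext[OF grows_rbox[OF r2] r(1)] by metis
      have d: "real (i + j) \<le> \<delta> * m + 2" "real (k + l) \<le> \<delta> * n + 2"
        using grow_ext[OF r12(3) ne1] r12(2) e(2,3) unfolding P_def m_def n_def by linarith+
      moreover have "\<delta> * m \<le> real (i + j) \<or> \<delta> * n \<le> real (k + l)"
        using r12(4) e(2,3) unfolding P_def m_def n_def by auto
      moreover have "i \<le> L" "j \<le> L" "k \<le> L" "l \<le> L"
        using d small[OF mL(1)] small[OF mL(2)] by linarith+
      ultimately have "(i, j, k, l) \<in> F" by (simp add: F_def ok_def)
      moreover have "\<omega> \<in> reach (2 * L) r2" unfolding reach_def using r12(5) r'(2) by blast
      ultimately show "\<exists>e\<in>F. grows \<omega> r (ext r e) \<and> \<omega> \<in> reach (2 * L) (ext r e)"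
        using r2 e(1) by blast
    next
      fix e assume e: "e \<in> F"
      obtain i j k l where ijkl: "e = (i, j, k, l)" by (cases e)
      have o: "real (i + j) \<le> \<delta> * m + 2" "real (k + l) \<le> \<delta> * n + 2" "\<delta> * m \<le> real (i + j) \<or> \<delta> * n \<le> real (k + l)"
        using e by (auto simp: F_def ok_def ijkl)
      have w: "wid (ext r e) = m + (i + j)" "hei (ext r e) = n + (k + l)"
        unfolding ijkl m_def n_def using wid_ext[OF r(1)] hei_ext[OF r(1)] by auto
      have "real (m + (i + j)) \<le> real (2 * L)" "real (n + (k + l)) \<le> real (2 * L)"
        using o(1,2) small[OF mL(1)] small[OF mL(2)] mL by auto
      then have le: "m + (i + j) \<le> 2 * L" "n + (k + l) \<le> 2 * L" by (simp_all only: of_nat_le_iff)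
      have pos: "0 < i + j \<or> 0 < k + l" using o(3) dm by (cases "i + j"; cases "k + l") auto
      show "bounded_reach (2 * L) (ext r e) (B (wid (ext r e)) (hei (ext r e)))"
      proof (rule IH)
        show "4 * L - (wid (ext r e) + hei (ext r e)) < 4 * L - (wid r + hei r)"
          unfolding w m_def[symmetric] n_def[symmetric] using pos mL by linarith
        show "rbox (ext r e) \<noteq> {}" using rbox_ext[of r i j k l] r(1) ijkl by auto
        show "M0 \<le> max (wid (ext r e)) (hei (ext r e))" unfolding w using r(2) by (auto simp: m_def n_def)
      qed (use w le in auto)
    next
      have "(\<Sum>e\<in>F. Pr (cross r e) * B (wid (ext r e)) (hei (ext r e))) \<le> (\<Sum>e\<in>F. B m n / real (L + 1) ^ 4)"
        using le_B by (intro sum_mono) (simp add: pos_le_divide_eq mult.commute)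
      also have "\<dots> = (real (card F) / real (L + 1) ^ 4) * B m n" by simp
      also have "\<dots> \<le> 1 * B m n"
        using cardF nonneg by (intro mult_right_mono) (auto simp: divide_le_eq_1)
      finally show "(\<Sum>e\<in>F. Pr (cross r e) * B (wid (ext r e)) (hei (ext r e))) \<le> B (wid r) (hei r)"
        by (simp add: m_def n_def)
    qed
  qed
qed

text \<open>Growth up to the first rectangle with a side of length at least \<open>M0\<close> is not
  charged. There are at most (M0 + 1)^4 such rectangles; their sides are at most M0 + 1, as one step
  adds at most 2 to sides shorter than \<open>M0\<close>.\<close>

lemma growth_prob_le:
  fixes B :: "nat \<Rightarrow> nat \<Rightarrow> real"
  assumes M0: "2 \<le> M0" "M0 + 1 \<le> 2 * L"
    and bd: "\<And>r. rbox r \<noteq> {} \<Longrightarrow> M0 \<le> max (wid r) (hei r) \<Longrightarrow> wid r \<le> 2 * L \<Longrightarrow> hei r \<le> 2 * L \<Longrightarrow>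
      bounded_reach (2 * L) r (B (wid r) (hei r))"
    and D: "\<And>m n. 1 \<le> m \<Longrightarrow> 1 \<le> n \<Longrightarrow> m \<le> M0 + 1 \<Longrightarrow> n \<le> M0 + 1 \<Longrightarrow> B m n \<le> D"
  shows "growth_prob p \<le> real (M0 + 1) ^ 4 * D"
proof -
  define r0 :: rect where "r0 = (0, 0, 0, 0)"
  have r0: "rbox r0 \<noteq> {}" "wid r0 = 1" "hei r0 = 1" by (auto simp: r0_def)
  define F where "F = {e \<in> {..M0} \<times> {..M0} \<times> {..M0} \<times> {..M0}.
     M0 \<le> max (wid (ext r0 e)) (hei (ext r0 e)) \<and> wid (ext r0 e) \<le> M0 + 1 \<and> hei (ext r0 e) \<le> M0 + 1}"
  have finF: "finite F" unfolding F_def by auto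
  have ne: "rbox (ext r0 e) \<noteq> {}" for e by (cases e) (auto simp: r0_def)
  have "\<exists>A. A \<in> sets (lbp_measure p) \<and> reach (2 * L) (ext r0 e) \<subseteq> A \<and> Pr A \<le> D" if e: "e \<in> F" for e
  proof -
    have "bounded_reach (2 * L) (ext r0 e) (B (wid (ext r0 e)) (hei (ext r0 e)))"
      using e M0 by (intro bd ne) (auto simp: F_def)
    moreover have "B (wid (ext r0 e)) (hei (ext r0 e)) \<le> D"
      using e wid_pos[OF ne] hei_pos[OF ne] by (intro D) (auto simp: F_def)
    ultimately show ?thesis unfolding bounded_reach_def by (meson depends_sets order_trans)
  qed
  then have "\<forall>e\<in>F. \<exists>A. A \<in> sets (lbp_measure p) \<and> reach (2 * L) (ext r0 e) \<subseteq> A \<and> Pr A \<le> D" by blast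
  from bchoice[OF this] obtain A where A: "\<forall>e\<in>F. A e \<in> sets (lbp_measure p) \<and> reach (2 * L) (ext r0 e) \<subseteq> A e \<and> Pr (A e) \<le> D" ..
  have "{\<omega>. indefinite_growth \<omega>} \<subseteq> (\<Union>e\<in>F. A e)"
  proof
    fix \<omega> assume "\<omega> \<in> {\<omega>. indefinite_growth \<omega>}"
    then obtain r' where r': "grows \<omega> r0 r'" "int (4 * L) \<le> perim r'"
      using indefinite_growth_grows[of \<omega> "4 * L"] unfolding r0_def by blast
    have big: "2 * L \<le> max (wid r') (hei r')"
      using r'(2) by (cases r') (auto simp: le_max_iff_disj)
    define P where "P = (\<lambda>r. M0 \<le> max (wid r) (hei r))"
    have "P r'" using big M0 by (simp add: P_def)
    moreover have "\<not> P r0" using r0 M0 by (simp add: P_def)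
    ultimately obtain r1 r2 where r12: "grows \<omega> r0 r1" "\<not> P r1" "grow \<omega> r1 r2" "P r2" "grows \<omega> r2 r'"
      using grows_first[OF r'(1), of P] by blast
    have r2: "grows \<omega> r0 r2" using r12 by simp
    have ne1: "rbox r1 \<noteq> {}" using grows_rbox[OF r12(1)] r0 by auto
    obtain i j k l where e: "r2 = ext r0 (i, j, k, l)" "wid r2 = wid r0 + (i + j)" "hei r2 = hei r0 + (k + l)"
      using rbox_subset_ext[OF grows_rbox[OF r2] r0(1)] by metis
    have d: "wid r2 \<le> M0 + 1" "hei r2 \<le> M0 + 1"
      using grow_ext[OF r12(3) ne1] r12(2) unfolding P_def by auto
    then have "i \<le> M0" "j \<le> M0" "k \<le> M0" "l \<le> M0" using e(2,3) r0 by auto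
    then have "(i, j, k, l) \<in> F" using d r12(4) e(1) by (simp add: F_def P_def)
    moreover have "\<omega> \<in> reach (2 * L) (ext r0 (i, j, k, l))"
      using r12(5) big unfolding reach_def e(1) by blast
    ultimately show "\<omega> \<in> (\<Union>e\<in>F. A e)" using A by blast
  qed
  then have "growth_prob p \<le> Pr (\<Union>e\<in>F. A e)"
    unfolding growth_prob_eq using A finF by (intro finite_measure_mono) auto
  also have "\<dots> \<le> (\<Sum>e\<in>F. Pr (A e))"
    using A finF by (intro finite_measure_subadditive_finite) auto
  also have "\<dots> \<le> (\<Sum>e\<in>F. D)" using A by (intro sum_mono) auto
  also have "\<dots> = real (card F) * D" by simp
  also have "\<dots> \<le> real (M0 + 1) ^ 4 * D"
  proof (rule mult_right_mono)
    have "card F \<le> card ({..M0} \<times> {..M0} \<times> {..M0} \<times> {..M0})"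
      unfolding F_def by (intro card_mono) auto
    also have "\<dots> = (M0 + 1) ^ 4" by (simp add: card_cartesian_product eval_nat_numeral algebra_simps)
    finally show "real (card F) \<le> real (M0 + 1) ^ 4" by (metis of_nat_le_iff of_nat_power)
    have "F \<noteq> {}"
    proof -
      have "(M0, 0, 0, 0) \<in> F" 
        using wid_ext[OF r0(1), of M0 0 0 0] hei_ext[OF r0(1), of M0 0 0 0] r0(2,3) by (simp add: F_def)
      then show ?thesis by blast
    qed
    then obtain e where "e \<in> F" by blast
    then show "0 \<le> D" using A measure_nonneg order_trans by blast
  qed
  finally show ?thesis .
qed

section \<open>Estimates of the total cost and of the errors per step\<close>

lemma u_ge_p: "n \<ge> 1 \<Longrightarrow> p \<le> u n"
  using power_decreasing[of 1 n "1 - p"] p_pos p_less_1 by simp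

lemma u_ge_linear: "p * real n / (1 + p * real n) \<le> u n"
proof -
  define x where "x = p * real n"
  have x: "0 \<le> x" using p_pos by (simp add: x_def)
  have "x \<le> real n * z" using z_ge mult_right_mono[of p z "real n"] by (simp add: x_def mult.commute)
  then have "(1 - p) ^ n \<le> exp (- x)" unfolding exp_z[symmetric] by simp
  also have "\<dots> \<le> 1 / (1 + x)" using exp_ge_add_one_self[of x] x by (simp add: exp_minus field_simps)
  finally have "1 - 1 / (1 + x) \<le> u n" by simp
  moreover have "1 - 1 / (1 + x) = x / (1 + x)" using x by (simp add: field_simps)
  ultimately show ?thesis by (simp add: x_def)
qed

text \<open>\<open>bet p \<ge> p\<close> bounds \<open>cost z\<close>, and
  \<open>bet p ^ 2 \<le> 2 * p\<close> bounds the tail beyond \<open>cost z\<close> by order p.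
  After division by z, the first cell of the Riemann sum loses only O(ln (1 / p)).\<close>

lemma cost_area_z_le:
  assumes "p \<le> 1 / 16"
  shows "cost_area z \<le> z * (ln (1 / p) + 8)" and "0 \<le> cost_area z" and "cost z \<le> ln (1 / p)"
proof -
  have "z \<le> p / (1 - p)" by (rule z_le)
  also have "\<dots> \<le> p / (1 / 2)" using assms p_pos by (intro divide_left_mono) auto
  finally have z2: "z \<le> 2 * p" by simp
  then have zx: "z \<le> x0" using assms x0_ge by simp
  have e1: "exp (- z) = 1 - p" using exp_z[of 1] by simp
  have b: "exp (- cost z) = bet p" using exp_neg_cost[OF z_pos] by (simp add: e1)
  have bp: "p \<le> bet p" "bet p \<le> 1" using bet_ge bet_le_1 p_pos p_less_1 by auto
  have "- cost z = ln (bet p)" using b by (metis ln_exp)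
  also have "\<dots> \<ge> ln p" using bp p_pos by simp
  finally show c: "cost z \<le> ln (1 / p)" using p_pos by (simp add: ln_div)
  have sl: "slope (cost z) = exp z * bet p"
    using cost_cost[OF z_pos] by (simp add: slope_def exp_diff b[symmetric] exp_minus field_simps)
  have "bet p ^ 2 = p * bet p + p * (1 - p)" using bet_square p_pos p_less_1 by simp
  also have "\<dots> \<le> p * 1 + p * 1" using bp p_pos p_less_1 by (intro add_mono mult_left_mono) auto
  finally have b2: "bet p ^ 2 \<le> 2 * p" by simp
  have "exp z \<le> 2"
  proof -
    have "exp z = inverse (exp (- z))" by (simp add: exp_minus)
    also have "\<dots> = 1 / (1 - p)" unfolding e1 by (simp add: inverse_eq_divide)
    also have "\<dots> \<le> 1 / (1 / 2)" using assms by (intro divide_left_mono) auto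
    finally show ?thesis by simp
  qed
  then have "exp z ^ 2 \<le> 2 ^ 2" by (intro power_mono) auto
  then have "exp z ^ 2 * bet p ^ 2 \<le> 4 * (2 * p)" using b2 by (intro mult_mono) auto
  then have "cost_tail (cost z) \<le> 8 * p"
    using cost_tail_le[OF cost_ge_x0[OF z_pos zx]] unfolding sl power_mult_distrib by simp
  then have t: "cost_tail (cost z) \<le> 8 * z" using z_ge by simp
  have a: "cost_area z = z * cost z + cost_tail (cost z)" using zx by (simp add: cost_area_def)
  have "z * cost z \<le> z * ln (1 / p)" using c z_pos by simp
  then show "cost_area z \<le> z * (ln (1 / p) + 8)" using a t by (simp add: algebra_simps)
  have "0 \<le> z * cost z" using z_pos cost_pos[OF z_pos] by simp
  then show "0 \<le> cost_area z" using cost_area_ge_rectangle[OF z_pos] by simp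
qed

lemma pi_square_le: "pi ^ 2 / 18 \<le> 1"
proof -
  have "pi ^ 2 \<le> (3.2::real) ^ 2" using pi_approx by (intro power_mono) auto
  then show ?thesis by (simp add: power2_eq_square)
qed

text \<open>A rectangle with a side of length \<open>L\<close> has paid for the whole integral,
  whatever its shape. If the shorter side k is at least L / 2, the missing tail is tiny. Otherwise
  more than L / 2 lines were added at the price \<open>cost (real k * z)\<close> each, which
  outweighs a tail of order \<open>slope ^ 2\<close>; if even (k + 1) z is below \<open>x0\<close>,
  each of these lines costs at least 1 / 3.\<close>

lemma growth_cost_ge:
  assumes p16: "p \<le> 1 / 16" and l3: "3 \<le> ln (1 / p)" and L: "4 * ln (1 / p) / p \<le> real L"
    and mn: "1 \<le> m" "1 \<le> n" "L \<le> max m n"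
  shows "2 / z * (pi ^ 2 / 18 - cost_area z) - 1 \<le> growth_cost z m n"
proof -
  define l where "l = ln (1 / p)"
  define k M where "k = min m n" and "M = max m n"
  define S where "S = (\<Sum>j=1..k. cost (real j * z))"
  let ?x = "real (Suc k) * z"
  have kM: "1 \<le> k" "L \<le> M" using mn by (auto simp: k_def M_def)
  have gc: "growth_cost z m n = 2 * S + real (M - k) * cost (real k * z)"
    by (simp add: growth_cost_def k_def M_def S_def)
  have l: "3 \<le> l" "4 * l / p \<le> real L" using l3 L by (auto simp: l_def)
  have lp: "exp (- l) = p" using p_pos by (simp add: l_def ln_div)
  have ck: "0 < cost (real k * z)" using z_pos kM by (intro cost_pos) auto
  have lpp: "3 / p \<le> l / p" using l p_pos by (intro divide_right_mono) auto
  have Ll: "4 * (l / p) \<le> real L" using l(2) by simp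
  show ?thesis
  proof (cases "x0 \<le> ?x")
    case True
    define q where "q = slope ?x ^ 2"
    have q: "0 \<le> q" by (simp add: q_def)
    have Tq: "cost_tail ?x \<le> q" using cost_tail_le[OF True] by (simp add: q_def)
    have "pi ^ 2 / 18 - cost_tail ?x - cost_area z \<le> z * S"
      unfolding S_def by (rule cost_sum_ge[OF z_pos True])
    then have "pi ^ 2 / 18 - cost_area z - q \<le> z * S" using Tq by simp
    then have "2 / z * (pi ^ 2 / 18 - cost_area z - q) \<le> 2 / z * (z * S)"
      using z_pos by (intro mult_left_mono) auto
    then have S: "2 / z * (pi ^ 2 / 18 - cost_area z) - 2 * q / z \<le> 2 * S"
      using z_pos by (simp add: algebra_simps add_divide_distrib)
    have qz: "2 * q / z \<le> 2 * q / p" using q z_ge p_pos by (intro divide_left_mono) auto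
    have "2 * q / p \<le> real (M - k) * cost (real k * z) + 1"
    proof (cases "L \<le> 2 * k")
      case True2: True
      have "slope ?x \<le> 3 / 2 * exp (- ?x)" by (rule slope_le[OF True])
      also have "\<dots> \<le> 3 / 2 * exp (- (2 * l))"
      proof -
        have "2 * (l / p) \<le> real (Suc k)" using Ll True2 by linarith
        then have "2 * (l / p) * p \<le> ?x" using z_ge p_pos l by (intro mult_mono) auto
        then show ?thesis using p_pos by simp
      qed
      also have "\<dots> = 3 / 2 * p ^ 2"
        using lp exp_add[of "- l" "- l"] by (simp add: power2_eq_square)
      finally have "q \<le> (3 / 2 * p ^ 2) ^ 2" unfolding q_def
        using slope_pos[of ?x] by (intro power_mono) auto
      also have "\<dots> = 9 / 4 * (p ^ 3 * p)" by (simp add: power2_eq_square power3_eq_cube)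
      finally have "2 * q / p \<le> 9 / 2 * p ^ 3" using p_pos by (simp add: field_simps)
      also have "\<dots> \<le> 9 / 2 * (1 / 16) ^ 3" using p16 p_pos by (intro mult_left_mono power_mono) auto
      also have "\<dots> \<le> 1" by (simp add: power3_eq_cube)
      finally show ?thesis using ck by (smt (verit) mult_nonneg_nonneg of_nat_0_le_iff)
    next
      case False
      then have "2 * (l / p) \<le> real (M - k)" using Ll kM by linarith
      moreover have "q / 3 \<le> cost (real k * z)"
      proof -
        have "q / 3 \<le> cost ?x" unfolding q_def by (rule cost_ge_slope[OF True])
        also have "\<dots> \<le> cost (real k * z)" using z_pos kM by (intro cost_antimono) auto
        finally show ?thesis .
      qed
      ultimately have "2 * (l / p) * (q / 3) \<le> real (M - k) * cost (real k * z)"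
        using l p_pos q by (intro mult_mono) auto
      moreover have "2 * (3 / p) * (q / 3) \<le> 2 * (l / p) * (q / 3)"
        using lpp q by (intro mult_right_mono) auto
      ultimately show ?thesis by simp
    qed
    then show ?thesis using S qz unfolding gc by linarith
  next
    case False
    then have kz: "real k * z \<le> x0" using z_pos by (simp add: algebra_simps)
    have c: "1 / 3 \<le> cost (real k * z)"
      using cost_ge_x0[OF _ kz] x0_ge z_pos kM by simp
    have "real k * p \<le> real k * z" using z_ge by (intro mult_left_mono) auto
    then have "real k * p \<le> 1" using kz x0_le_1 by simp
    then have "real k \<le> 1 / p" using p_pos by (simp add: field_simps)
    also have "\<dots> \<le> l / p" using l p_pos by (intro divide_right_mono) auto
    finally have "3 * (l / p) \<le> real (M - k)" using Ll kM by linarith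
    then have "3 * (l / p) * (1 / 3) \<le> real (M - k) * cost (real k * z)"
      using c l p_pos by (intro mult_mono) auto
    then have 1: "l / p \<le> real (M - k) * cost (real k * z)" by simp
    have "2 / z * (pi ^ 2 / 18 - cost_area z) \<le> 2 / z * 1"
      using pi_square_le cost_area_z_le(2)[OF p16] z_pos by (intro mult_left_mono) auto
    also have "\<dots> \<le> 2 / p" using z_ge p_pos by (simp add: divide_left_mono)
    also have "\<dots> \<le> l / p" using l p_pos by (intro divide_right_mono) auto
    finally have 2: "2 / z * (pi ^ 2 / 18 - cost_area z) \<le> l / p" .
    have "0 \<le> S" unfolding S_def using z_pos by (intro sum_nonneg less_imp_le cost_pos) auto
    then show ?thesis using 1 2 unfolding gc by simp
  qed
qed

text \<open>On the left stands what a step loses: the union bound, the factor 1 / (u n * u m) and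
  the corners. On the right stands what a logarithmic potential releases. The sum ln m + ln n rises
  by order \<sigma> + \<tau> \<ge> \<delta>, which covers the first two losses. The corner exponent
  has order l^2 \<sigma> \<tau> / p; a side of length at least 1 / \<delta> forces \<sigma> or
  \<tau> below 3 \<delta>, so the potential covers it too.\<close>

lemma step_cost:
  fixes m n s t L :: nat
  assumes p16: "p \<le> 1 / 16" and l_def: "l = ln (1 / p)" and d_def: "\<delta> = sqrt p" and l3: "3 \<le> l"
    and L: "real L \<le> 4 * l / p + 1"
    and mn: "1 \<le> m" "1 \<le> n" "m < L" "n < L" "1 / \<delta> \<le> real m \<or> 1 / \<delta> \<le> real n"
    and st: "real s \<le> \<delta> * m + 2" "real t \<le> \<delta> * n + 2" "\<delta> * m \<le> real s \<or> \<delta> * n \<le> real t"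
  shows "4 * ln (real (L + 1)) + 2 * l + real (s * t) * (p / (u n * u m))
    \<le> 1000 * l ^ 2 / \<delta> * ((ln (real (m + s)) - ln (real m)) + (ln (real (n + t)) - ln (real n)))"
proof -
  define \<sigma> \<tau> where "\<sigma> = real s / real m" and "\<tau> = real t / real n"
  have d: "0 < \<delta>" "\<delta> ^ 2 = p" "\<delta> \<le> 1 / 4"
    using p_pos real_sqrt_le_mono[OF p16] by (auto simp: d_def real_sqrt_divide)
  have m: "0 < real m" and n: "0 < real n" using mn by auto
  have nn: "0 \<le> \<sigma>" "0 \<le> \<tau>" by (auto simp: \<sigma>_def \<tau>_def)
  have ratio: "real a / real b \<le> \<delta> + 2 / real b" if "real a \<le> \<delta> * real b + 2" "0 < real b" for a b :: nat
    using that by (simp add: field_simps)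
  have s3: "\<sigma> \<le> 3" and t3: "\<tau> \<le> 3"
  proof -
    have "2 / real m \<le> 2" "2 / real n \<le> 2" using mn by (auto simp: field_simps)
    then show "\<sigma> \<le> 3" "\<tau> \<le> 3"
      using ratio[OF st(1) m] ratio[OF st(2) n] d by (auto simp: \<sigma>_def \<tau>_def)
  qed
  have big: "real a / real b \<le> 3 * \<delta>" if "real a \<le> \<delta> * real b + 2" "0 < real b" "1 / \<delta> \<le> real b" for a b :: nat
  proof -
    have "2 / real b \<le> 2 * \<delta>" using that d by (simp add: field_simps)
    then show ?thesis using ratio[OF that(1,2)] by simp
  qed
  have prod: "\<sigma> * \<tau> \<le> 3 * \<delta> * (\<sigma> + \<tau>)"
    using mn(5)
  proof
    assume "1 / \<delta> \<le> real m"
    then have "\<sigma> \<le> 3 * \<delta>" using big[OF st(1) m] by (simp add: \<sigma>_def)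
    then have "\<sigma> * \<tau> \<le> 3 * \<delta> * \<tau>" using nn by (intro mult_right_mono)
    also have "\<dots> \<le> 3 * \<delta> * (\<sigma> + \<tau>)" using nn d by (intro mult_left_mono) auto
    finally show ?thesis .
  next
    assume "1 / \<delta> \<le> real n"
    then have "\<tau> \<le> 3 * \<delta>" using big[OF st(2) n] by (simp add: \<tau>_def)
    then have "\<sigma> * \<tau> \<le> \<sigma> * (3 * \<delta>)" using nn by (intro mult_left_mono)
    also have "\<dots> \<le> (\<sigma> + \<tau>) * (3 * \<delta>)" using nn d by (intro mult_right_mono) auto
    finally show ?thesis by (simp only: mult.commute)
  qed
  have ul: "p * real k / (6 * l) \<le> u k" if "k < L" for k
  proof -
    have "p * real k \<le> p * (4 * l / p + 1)" using that L p_pos by (intro mult_left_mono) auto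
    also have "\<dots> = 4 * l + p" using p_pos by (simp add: field_simps)
    finally have "1 + p * real k \<le> 6 * l" using l3 p16 by simp
    then have "p * real k / (6 * l) \<le> p * real k / (1 + p * real k)"
      using p_pos l3 by (intro divide_left_mono mult_pos_pos add_pos_nonneg) auto
    also have "\<dots> \<le> u k" by (rule u_ge_linear)
    finally show ?thesis .
  qed
  have X: "real (s * t) * (p / (u n * u m)) \<le> 108 * l ^ 2 / \<delta> * (\<sigma> + \<tau>)"
  proof -
    have le: "(p * real n / (6 * l)) * (p * real m / (6 * l)) \<le> u n * u m"
      using ul mn p_pos l3 u_bounds by (intro mult_mono) auto
    have pos: "0 < (p * real n / (6 * l)) * (p * real m / (6 * l))"
      using p_pos l3 m n by simp
    have "p / (u n * u m) \<le> p / ((p * real n / (6 * l)) * (p * real m / (6 * l)))"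
      by (rule divide_left_mono[OF le less_imp_le[OF p_pos] mult_pos_pos[OF less_le_trans[OF pos le] pos]])
    then have "real (s * t) * (p / (u n * u m)) \<le> real (s * t) * (p / ((p * real n / (6 * l)) * (p * real m / (6 * l))))"
      by (intro mult_left_mono) auto
    also have "\<dots> = 36 * l ^ 2 / p * (\<sigma> * \<tau>)"
      using p_pos m n l3 by (simp add: \<sigma>_def \<tau>_def field_simps power2_eq_square)
    also have "\<dots> \<le> 36 * l ^ 2 / p * (3 * \<delta> * (\<sigma> + \<tau>))"
      using p_pos by (intro mult_left_mono prod) auto
    also have "\<dots> = 108 * l ^ 2 / \<delta> * (\<sigma> + \<tau>)"
      using d(1) by (simp add: power2_eq_square field_simps flip: d(2))
    finally show ?thesis .
  qed
  have lnL: "ln (real (L + 1)) \<le> 4 * l"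
  proof -
    have "1 \<le> l / p" using l3 p16 p_pos by (simp add: field_simps)
    then have "real (L + 1) \<le> 6 * (l / p)" using L by simp
    then have "ln (real (L + 1)) \<le> ln (6 * (l / p))" by (intro ln_mono) auto
    also have "\<dots> = ln 6 + (ln l - ln p)"
      using l3 p_pos by (simp add: ln_mult ln_div)
    also have "\<dots> = ln 6 + (ln l + l)"
      using p_pos by (simp add: l_def ln_div)
    also have "\<dots> \<le> (6 - 1) + ((l - 1) + l)"
      using l3 by (intro add_mono ln_le_minus_one) auto
    finally show ?thesis using l3 by simp
  qed
  have lnr: "(1 / 4) * x \<le> ln (1 + x)" if "0 \<le> x" "x \<le> 3" for x :: real
  proof -
    have "ln (1 / (1 + x)) \<le> 1 / (1 + x) - 1" using that by (intro ln_le_minus_one) auto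
    then have "x / (1 + x) \<le> ln (1 + x)" using that by (simp add: ln_div field_simps)
    moreover have "x / 4 \<le> x / (1 + x)" using that by (intro divide_left_mono) auto
    ultimately show ?thesis by linarith
  qed
  have lns: "ln (real (m + s)) - ln (real m) = ln (1 + \<sigma>)"
  proof -
    have "real (m + s) = real m * (1 + \<sigma>)" using m by (simp add: \<sigma>_def field_simps)
    then show ?thesis using m nn by (simp add: ln_mult)
  qed
  have lnt: "ln (real (n + t)) - ln (real n) = ln (1 + \<tau>)"
  proof -
    have "real (n + t) = real n * (1 + \<tau>)" using n by (simp add: \<tau>_def field_simps)
    then show ?thesis using n nn by (simp add: ln_mult)
  qed
  have sum: "\<delta> \<le> \<sigma> + \<tau>"
  proof -
    have "\<delta> \<le> \<sigma> \<or> \<delta> \<le> \<tau>" using st(3) m n by (auto simp: \<sigma>_def \<tau>_def field_simps)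
    then show ?thesis using nn by auto
  qed
  have "4 * ln (real (L + 1)) + 2 * l \<le> 18 * l" using lnL by simp
  also have "\<dots> \<le> 142 * l ^ 2 / \<delta> * \<delta>" using d l3 by (simp add: power2_eq_square)
  also have "\<dots> \<le> 142 * l ^ 2 / \<delta> * (\<sigma> + \<tau>)" using sum d by (intro mult_left_mono) auto
  finally have "4 * ln (real (L + 1)) + 2 * l + real (s * t) * (p / (u n * u m))
      \<le> 142 * l ^ 2 / \<delta> * (\<sigma> + \<tau>) + 108 * l ^ 2 / \<delta> * (\<sigma> + \<tau>)"
    using X by linarith
  also have "\<dots> = (142 * l ^ 2 + 108 * l ^ 2) / \<delta> * (\<sigma> + \<tau>)"
    by (simp only: add_divide_distrib distrib_right)
  \<comment> \<open>The constant 1000 is 4 (142 + 108); the factor 4 is lost in ln (1 + x) \<ge> x /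
    4 on [0, 3].\<close>
  also have "\<dots> = 1000 * l ^ 2 / \<delta> * ((1 / 4) * (\<sigma> + \<tau>))" by simp
  also have "\<dots> = 1000 * l ^ 2 / \<delta> * ((1 / 4) * \<sigma> + (1 / 4) * \<tau>)" by (simp only: distrib_left)
  also have "\<dots> \<le> 1000 * l ^ 2 / \<delta> * (ln (1 + \<sigma>) + ln (1 + \<tau>))"
    using d nn s3 t3 by (intro mult_left_mono add_mono lnr) auto
  finally show ?thesis unfolding lns lnt .
qed

lemma growth_prob_upper:
  assumes p16: "p \<le> 1 / 16" and l3: "3 \<le> ln (1 / p)"
  shows "growth_prob p \<le> exp ((- 2 * (pi ^ 2 / 18) + 13000 * sqrt p * (ln (1 / p)) ^ 3) / p)"
proof -
  define l \<delta> where "l = ln (1 / p)" and "\<delta> = sqrt p"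
  \<comment> \<open>At length \<open>L\<close> the tail of the integral is negligible. From
    \<open>M0\<close> on, a ratio 1 + \<delta> amounts to at least one line.\<close>
  define L M0 where "L = nat \<lceil>4 * l / p\<rceil>" and "M0 = nat \<lceil>1 / \<delta>\<rceil>"
  define \<kappa> Q \<Lambda> where "\<kappa> = 1000 * l ^ 2 / \<delta>" and "Q = 2 * ln (real (2 * L))"
    and "\<Lambda> = 2 / z * (pi ^ 2 / 18 - cost_area z) - 1"
  \<comment> \<open>The exponent combines the total price \<open>\<Lambda>\<close>, the part of it
    already paid by an m by n rectangle, and a potential, nonnegative for sides up to 2 L, whose
    decrease pays for the losses of each step.\<close>
  define B where "B = (\<lambda>m n::nat. exp (- \<Lambda> + growth_cost z m n + \<kappa> * (Q - ln (real m) - ln (real n))))"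
  have d: "0 < \<delta>" "\<delta> ^ 2 = p" "\<delta> \<le> 1 / 4"
    using p_pos real_sqrt_le_mono[OF p16] by (auto simp: \<delta>_def real_sqrt_divide)
  have l: "3 \<le> l" using l3 by (simp add: l_def)
  have lp: "exp l = 1 / p" using p_pos by (simp add: l_def)
  have \<kappa>: "0 \<le> \<kappa>" using d by (simp add: \<kappa>_def)
  have inv: "16 \<le> 1 / p" using p16 p_pos by (simp add: field_simps)
  have lpinv: "48 \<le> l / p"
  proof -
    have "3 * 16 \<le> l * (1 / p)" using l inv by (intro mult_mono) auto
    then show ?thesis by simp
  qed
  have L: "4 * l / p \<le> real L" "real L \<le> 4 * l / p + 1"
    unfolding L_def using lpinv by (auto simp: le_nat_iff)
  have L4: "4 \<le> L" using L(1) lpinv by simp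
  have invd: "4 \<le> 1 / \<delta>" using d by (simp add: field_simps)
  have M0: "1 / \<delta> \<le> real M0" "real M0 \<le> 1 / \<delta> + 1"
    unfolding M0_def using invd by linarith+
  have step: "real (L + 1) ^ 4 * (bet (u n) ^ s * bet (u m) ^ t / (u n * u m) * exp (real (s * t) * (p / (u n * u m)))
        * B (m + s) (n + t)) \<le> B m n"
    if mn: "1 \<le> m" "1 \<le> n" "m < L" "n < L" "M0 \<le> max m n"
      and st: "real s \<le> \<delta> * m + 2" "real t \<le> \<delta> * n + 2" "\<delta> * m \<le> real s \<or> \<delta> * n \<le> real t"
    for m n s t :: nat
  proof -
    let ?X = "real (s * t) * (p / (u n * u m))"
    have "real M0 \<le> real m \<or> real M0 \<le> real n" using mn(5) by (auto simp: le_max_iff_disj)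
    then have big: "1 / \<delta> \<le> real m \<or> 1 / \<delta> \<le> real n" using M0(1) by linarith
    have key: "4 * ln (real (L + 1)) + 2 * l + ?X
        \<le> \<kappa> * ((ln (real (m + s)) - ln (real m)) + (ln (real (n + t)) - ln (real n)))"
      unfolding \<kappa>_def by (rule step_cost[OF p16 l_def \<delta>_def l L(2) mn(1-4) big st])
    have gc: "growth_cost z (m + s) (n + t) \<le> growth_cost z m n + real s * cost (real n * z) + real t * cost (real m * z)"
      by (rule growth_cost_add2[OF z_pos mn(1,2)])
    have 1: "real (L + 1) ^ 4 = exp (4 * ln (real (L + 1)))"
      using exp_of_nat_mult[of 4 "ln (real (L + 1))"] by simp
    have 2: "bet (u n) ^ s = exp (- (real s * cost (real n * z)))" "bet (u m) ^ t = exp (- (real t * cost (real m * z)))"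
      using mn exp_of_nat_mult[of s "- cost (real n * z)"] exp_of_nat_mult[of t "- cost (real m * z)"]
      by (simp_all add: bet_u_exp)
    have 3: "1 / (u n * u m) \<le> exp (2 * l)"
    proof -
      have "1 / (u n * u m) \<le> 1 / (p * p)"
        using u_ge_p mn p_pos u_bounds by (intro divide_left_mono mult_mono mult_pos_pos) auto
      also have "\<dots> = exp (2 * l)" using exp_of_nat_mult[of 2 l] lp by (simp add: power2_eq_square)
      finally show ?thesis .
    qed
    have "real (L + 1) ^ 4 * (bet (u n) ^ s * bet (u m) ^ t / (u n * u m) * exp ?X * B (m + s) (n + t))
        = (1 / (u n * u m)) * (real (L + 1) ^ 4 * (bet (u n) ^ s * bet (u m) ^ t * exp ?X * B (m + s) (n + t)))"
      by simp
    also have "\<dots> \<le> exp (2 * l) * (real (L + 1) ^ 4 * (bet (u n) ^ s * bet (u m) ^ t * exp ?X * B (m + s) (n + t)))"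
      using 3 bet_u by (intro mult_right_mono) (auto simp: B_def)
    also have "\<dots> = exp (2 * l + (4 * ln (real (L + 1)) + (- (real s * cost (real n * z)) + (- (real t * cost (real m * z)))
        + ?X + (- \<Lambda> + growth_cost z (m + s) (n + t) + \<kappa> * (Q - ln (real (m + s)) - ln (real (n + t)))))))"
      unfolding 1 2 B_def by (simp only: exp_add)
    also have "\<dots> \<le> B m n"
      unfolding B_def using key gc by (simp add: algebra_simps)
    finally show ?thesis .
  qed
  have base: "1 \<le> B m n" if "L \<le> max m n" "m \<le> 2 * L" "n \<le> 2 * L" "1 \<le> m" "1 \<le> n" for m n
  proof -
    have "\<Lambda> \<le> growth_cost z m n"
      unfolding \<Lambda>_def by (rule growth_cost_ge[OF p16 l3]) (use L that in \<open>auto simp: l_def\<close>)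
    moreover have "ln (real m) \<le> ln (real (2 * L))" "ln (real n) \<le> ln (real (2 * L))"
      using that by (auto intro!: ln_mono simp flip: of_nat_mult)
    then have "0 \<le> \<kappa> * (Q - ln (real m) - ln (real n))" using \<kappa> by (simp add: Q_def)
    ultimately show ?thesis unfolding B_def by simp
  qed
  have bd: "bounded_reach (2 * L) r (B (wid r) (hei r))"
    if "rbox r \<noteq> {}" "M0 \<le> max (wid r) (hei r)" "wid r \<le> 2 * L" "hei r \<le> 2 * L" for r
    by (rule bounded_reach_induct[OF d(1,3) L4 base step _ that]) (auto simp: B_def)
  define D where "D = exp (- \<Lambda> + real (2 * (M0 + 1)) * l + \<kappa> * Q)"
  have D: "B m n \<le> D" if "1 \<le> m" "1 \<le> n" "m \<le> M0 + 1" "n \<le> M0 + 1" for m n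
  proof -
    have "growth_cost z m n \<le> real (m + n) * cost z" by (rule growth_cost_le[OF z_pos that(1,2)])
    also have "\<dots> \<le> real (2 * (M0 + 1)) * l"
      using that cost_area_z_le(3)[OF p16] cost_pos[OF z_pos] by (intro mult_mono) (auto simp: l_def)
    finally have "growth_cost z m n \<le> real (2 * (M0 + 1)) * l" .
    moreover have "0 \<le> ln (real m)" "0 \<le> ln (real n)" using that by auto
    then have "\<kappa> * (Q - ln (real m) - ln (real n)) \<le> \<kappa> * Q"
      using \<kappa> by (intro mult_left_mono) auto
    ultimately show ?thesis unfolding B_def D_def by simp
  qed
  have M0L: "2 \<le> M0" "M0 + 1 \<le> 2 * L"
  proof -
    show "2 \<le> M0" using M0 invd by linarith
    have "1 / \<delta> \<le> 1 / p"
    proof (rule divide_left_mono)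
      show "p \<le> \<delta>" using d by (simp add: power2_eq_square mult_left_le flip: d(2))
    qed (use d p_pos in auto)
    also have "\<dots> \<le> l / p" using l p_pos by (intro divide_right_mono) auto
    finally have "real (M0 + 1) \<le> real (2 * L)" using M0(2) L(1) lpinv by simp
    then show "M0 + 1 \<le> 2 * L" by (simp only: of_nat_le_iff)
  qed
  have "growth_prob p \<le> real (M0 + 1) ^ 4 * D"
    by (rule growth_prob_le[OF M0L bd D])
  also have "\<dots> \<le> exp ((- 2 * (pi ^ 2 / 18) + 13000 * sqrt p * (ln (1 / p)) ^ 3) / p)"
  proof -
    define W where "W = l ^ 3 / \<delta>"
    have M03: "real (M0 + 1) \<le> 3 / \<delta>" using M0(2) invd by simp
    have l2: "9 \<le> l ^ 2" using l power_mono[of 3 l 2] by simp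
    have l27: "27 \<le> l ^ 3" using l power_mono[of 3 l 3] by simp
    have W1: "108 \<le> W"
    proof -
      have "27 * 4 \<le> l ^ 3 * (1 / \<delta>)" using l27 invd l by (intro mult_mono) auto
      then show ?thesis by (simp add: W_def)
    qed
    have W2: "9 * (l / \<delta>) \<le> W"
    proof -
      have "9 * (l / \<delta>) \<le> l ^ 2 * (l / \<delta>)" using l2 l d by (intro mult_right_mono) auto
      then show ?thesis by (simp add: W_def power2_eq_square power3_eq_cube)
    qed
    have W3: "4 * l \<le> l / \<delta>"
      using mult_left_mono[OF invd, of l] l by simp
    have A: "real (M0 + 1) ^ 4 \<le> exp (80 + 2 * l)"
    proof -
      have "real (M0 + 1) ^ 4 \<le> (3 / \<delta>) ^ 4" using M03 by (intro power_mono) auto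
      also have "\<dots> = 81 * (1 / (\<delta> ^ 2)) ^ 2" by (simp add: power_divide eval_nat_numeral)
      also have "\<dots> = 81 * exp (2 * l)" using exp_of_nat_mult[of 2 l] lp d(2) by simp
      also have "\<dots> \<le> exp 80 * exp (2 * l)"
        using exp_ge_add_one_self[of "80::real"] by (intro mult_right_mono) auto
      finally show ?thesis by (simp add: exp_add)
    qed
    have \<Lambda>: "2 * (pi ^ 2 / 18) / p - 2 - 2 * (l + 8) - 1 \<le> \<Lambda>"
    proof -
      have "1 / z \<ge> 1 / (p / (1 - p))"
        using z_le z_pos p_pos p_less_1 by (intro divide_left_mono) auto
      then have "1 / p - 1 \<le> 1 / z" using p_pos by (simp add: field_simps)
      then have "2 * (pi ^ 2 / 18) * (1 / p - 1) \<le> 2 * (pi ^ 2 / 18) * (1 / z)"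
        by (intro mult_left_mono) auto
      then have "2 * (pi ^ 2 / 18) / p - 2 * (pi ^ 2 / 18) \<le> 2 / z * (pi ^ 2 / 18)"
        by (simp add: algebra_simps)
      moreover have "2 / z * cost_area z \<le> 2 / z * (z * (l + 8))"
        using cost_area_z_le(1)[OF p16] z_pos unfolding l_def by (intro mult_left_mono) auto
      then have "2 / z * cost_area z \<le> 2 * (l + 8)" using z_pos by simp
      ultimately show ?thesis
        unfolding \<Lambda>_def right_diff_distrib using pi_square_le by linarith
    qed
    have gcb: "real (2 * (M0 + 1)) * l \<le> 6 * (l / \<delta>)"
    proof -
      have "real (M0 + 1) * l \<le> 3 / \<delta> * l" using M03 l by (intro mult_right_mono) auto
      then have "2 * (real (M0 + 1) * l) \<le> 2 * (3 / \<delta> * l)" by (intro mult_left_mono) auto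
      also have "2 * (real (M0 + 1) * l) = real (2 * (M0 + 1)) * l" by (simp only: of_nat_mult of_nat_numeral mult.assoc)
      also have "2 * (3 / \<delta> * l) = 6 * (l / \<delta>)" by simp
      finally show ?thesis .
    qed
    have \<kappa>Q: "\<kappa> * Q \<le> 12000 * W"
    proof -
      have "real (2 * L) \<le> 12 * (l / p)" using L(2) lpinv by simp
      then have "ln (real (2 * L)) \<le> ln (12 * (l / p))" using L4 by (intro ln_mono) auto
      also have "\<dots> = ln 12 + (ln l - ln p)" using l p_pos by (simp add: ln_mult ln_div)
      also have "\<dots> = ln 12 + (ln l + l)" using p_pos by (simp add: l_def ln_div)
      also have "\<dots> \<le> (12 - 1) + ((l - 1) + l)"
        using l by (intro add_mono ln_le_minus_one) auto
      finally have "Q \<le> 12 * l" using l by (simp add: Q_def)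
      then have "\<kappa> * Q \<le> \<kappa> * (12 * l)" using \<kappa> by (intro mult_left_mono)
      also have "\<dots> = 12000 * W" by (simp add: \<kappa>_def W_def power2_eq_square power3_eq_cube)
      finally show ?thesis .
    qed
    have "real (M0 + 1) ^ 4 * D \<le> exp (80 + 2 * l) * D"
      using A by (intro mult_right_mono) (auto simp: D_def)
    also have "\<dots> = exp (80 + 2 * l + (- \<Lambda> + real (2 * (M0 + 1)) * l + \<kappa> * Q))"
      unfolding D_def by (simp only: exp_add)
    \<comment> \<open>The dominant error is the initial potential \<kappa> Q of at most 12000
      \<open>W\<close>. The remaining 1000 \<open>W\<close> absorb the number and cost of the
      initial rectangles and the first cell of the Riemann sum.\<close>
    also have "\<dots> \<le> exp (- 2 * (pi ^ 2 / 18) / p + 13000 * W)"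
      using \<Lambda> gcb \<kappa>Q W1 W2 W3 by simp
    also have "- 2 * (pi ^ 2 / 18) / p + 13000 * W = (- 2 * (pi ^ 2 / 18) + 13000 * sqrt p * (ln (1 / p)) ^ 3) / p"
    proof -
      have "\<delta> / p = 1 / \<delta>" using d(1) by (simp add: power2_eq_square flip: d(2))
      then have "13000 * W = 13000 * (\<delta> / p) * l ^ 3" by (simp add: W_def)
      then show ?thesis unfolding l_def[symmetric] \<delta>_def[symmetric] by (simp add: diff_divide_distrib)
    qed
    finally show ?thesis .
  qed
  finally show ?thesis .
qed

end

lemma eventually_growth_prob_upper:
  "\<forall>\<^sub>F p in at_right 0. growth_prob p \<le> exp ((- 2 * (pi ^ 2 / 18) + 13000 * sqrt p * (ln (1 / p)) ^ 3) / p)"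
proof -
  have "\<forall>\<^sub>F p::real in at_right 0. 3 \<le> ln (1 / p)" by real_asymp
  moreover have "\<forall>\<^sub>F p::real in at_right 0. 0 < p \<and> p < 1 / 16"
    by (simp add: eventually_at_right_less eventually_conj_iff) real_asymp
  ultimately show ?thesis
  proof eventually_elim
    case (elim p)
    interpret bernoulli_sites p by unfold_locales (use elim in auto)
    show ?case by (rule growth_prob_upper) (use elim in auto)
  qed
qed

theorem theorem1:
  shows "\<exists>c C p0 :: real. c > 0 \<and> C > 0 \<and> p0 > 0 \<and>
    (\<forall>p. 0 < p \<and> p < p0 \<and> p < 1 \<longrightarrow>
       exp ((- 2 * (pi^2 / 18) + c * sqrt p) / p) \<le> growth_prob p \<and>
       growth_prob p \<le> exp ((- 2 * (pi^2 / 18) + C * sqrt p * (ln (1 / p))^3) / p))"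
proof -
  obtain p0 where "p0 > 0" and
    "\<And>p. 0 < p \<Longrightarrow> p < p0 \<Longrightarrow>
       exp ((- 2 * (pi^2 / 18) + exp (- 20) / 64 * sqrt p) / p) \<le> growth_prob p \<and>
       growth_prob p \<le> exp ((- 2 * (pi^2 / 18) + 13000 * sqrt p * (ln (1 / p))^3) / p)"
    using eventually_conj[OF eventually_growth_prob_lower eventually_growth_prob_upper]
    unfolding eventually_at_right_field by blast
  then show ?thesis
    by (intro exI[of _ "exp (- 20) / 64"] exI[of _ 13000] exI[of _ p0]) auto
qed

end
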